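(* Let $C\subset M$ be any adapted box. Then $$m_y(C)=\overline m(C)+K_C(y)\,y^{1/2}\log y,$$ where $|K_C(y)|$ is bounded by some positive constant for all $0<y\le 1/2$. Furthermore, this positive constant can be chosen to be the same for every adapted box contained in $C$; i.e. there is a constant $k>0$ such that $|m_y(C')-\overline m(C')|\le k\,y^{1/2}|\log y|$ for every adapted box $C'\subset C$ and all $0<y\le 1/2$.
   Context: Let $\mathbb H=\{x+iy: y>0\}$ be the upper half-plane with the hyperbolic metric $(dx^2+dy^2)/y^2$, and let $T_1\mathbb H$ be its unit tangent bundle. A unit tangent vector is written $(z,\theta)$, where $z=x+iy\in\mathbb H$ is the base point and $\theta\in\mathbb R/2\pi\mathbb Z$ is its angle measured counter-clockwise from the upward vertical direction. The group $\mathrm{PSL}(2,\mathbb R)$ acts simply transitively on $T_1\mathbb H$ by differentials of Möbius transformations: for $\sigma(z)=\frac{az+b}{cz+d}$, $\sigma(z,\theta)=(\sigma(z),\theta-2\arg(cz+d))$. $M=\mathrm{PSL}(2,\mathbb R)/\mathrm{PSL}(2,\mathbb Z)$ is identified with the quotient of $T_1\mathbb H$ by this action of $\mathrm{PSL}(2,\mathbb Z)$, with projection $P:T_1\mathbb H\to M$. $\overline m$ is the normalized Haar measure on $M$, i.e. the probability measure on $M$ proportional to the one induced by $y^{-2}\,dx\,dy\,d\theta$ on $T_1\mathbb H$. For $y>0$, $m_y$ is the Borel probability measure on $M$ uniformly distributed (with respect to arc length) on the closed unstable horocycle orbit of period $1/y$, which is $P(\{((x,y),\pi): 0\le x\le 1\})$;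 that is, $m_y(f)=\int_0^1 f(P((x,y),\pi))\,dx$. The unstable horocycle flow $h^+_s$ on $T_1\mathbb H$ is the flow commuting with the action of $\mathrm{PSL}(2,\mathbb R)$ and satisfying $h^+_s((x,y),\pi)=((x+sy,y),\pi)$ (so it moves a unit vector at unit speed along the horocycle orthogonal to it and based at the backward endpoint of its geodesic). The basic stable leaf is $L^-=\{(x+iy,0)\}\subset T_1\mathbb H$. An adapted box in $M$ is a set $C=P(\widetilde C)$ with $\widetilde C=\{h^+_s(x+iy,0): \alpha_1\le x\le\alpha_2,\ \beta_1\le y\le\beta_2,\ |s|\le \ell/2\}$ for some $0<\alpha_1<\alpha_2\le 1$, $0<\beta_1<\beta_2$, $\ell>0$, such that $P$ is injective on $\widetilde C$ (the box is embedded). The rectangle $Q=[\alpha_1,\alpha_2]\times[\beta_1,\beta_2]$ (viewed in $L^-$ and projected to $M$) is the base of $C$ and $\ell$ its height. *)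

theory Defs
  imports "HOL-Probability.Probability" "HOL-Real_Asymp.Real_Asymp"
begin

text \<open>An angle \<open>\<theta> \<in> \<real>/2\<pi>\<int>\<close>, measured counter-clockwise from the upward vertical, is encoded by the
  unit complex number \<open>cis \<theta>\<close>. Thus \<open>(z, cis \<theta>)\<close> is the unit tangent vector \<open>(z, \<theta>)\<close>.\<close>

definition T1H :: "(complex \<times> complex) set" where
  "T1H = {(z, u). 0 < Im z \<and> norm u = 1}"

definition SL2R :: "(real^2^2) set" where
  "SL2R = {A. det A = 1}"

definition SL2Z :: "(real^2^2) set" where
  "SL2Z = {A \<in> SL2R. \<forall>i j. A $ i $ j \<in> \<int>}"

text \<open>Both \<open>A\<close> and \<open>-A\<close> act in the same way, so this is an action of the projective group,
  and orbits under \<open>SL2Z\<close> are orbits under \<open>PSL(2,\<int>)\<close>.\<close>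

definition tangent_act :: "real^2^2 \<Rightarrow> complex \<times> complex \<Rightarrow> complex \<times> complex" where
  "tangent_act A = (\<lambda>(z, u).
     ((of_real (A$1$1) * z + of_real (A$1$2)) / (of_real (A$2$1) * z + of_real (A$2$2)),
      u * cis (- 2 * Arg (of_real (A$2$1) * z + of_real (A$2$2)))))"

text \<open>The projection \<open>P\<close>. The points of \<open>M\<close> are the \<open>SL2Z\<close>-orbits in \<open>T1H\<close>.\<close>

definition proj :: "complex \<times> complex \<Rightarrow> (complex \<times> complex) set" where
  "proj v = (\<lambda>A. tangent_act A v) ` SL2Z"

definition M_points :: "(complex \<times> complex) set set" where
  "M_points = proj ` T1H"

text \<open>The Borel sigma-algebra of the quotient topology on \<open>M\<close>.\<close>

definition M_borel :: "(complex \<times> complex) set measure" where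
  "M_borel = sigma M_points
     {U. U \<subseteq> M_points \<and> openin (top_of_set T1H) {v \<in> T1H. proj v \<in> U}}"

text \<open>The measure \<open>dx dy d\<theta> / y\<^sup>2\<close> on \<open>T1H\<close>.\<close>

definition liouville :: "(complex \<times> complex) measure" where
  "liouville =
     distr (density (restrict_space lborel {(x::real, y::real, \<theta>::real). 0 < y \<and> 0 \<le> \<theta> \<and> \<theta> < 2 * pi})
                    (\<lambda>(x, y, \<theta>). ennreal (1 / y\<^sup>2)))
           (restrict_space borel T1H)
           (\<lambda>(x, y, \<theta>). (Complex x y, cis \<theta>))"

text \<open>The unit tangent vectors over the interior of the standard modular domain. They form a
  fundamental domain for the \<open>SL2Z\<close>-action up to a null set, and by invariance of
  \<open>liouville\<close> the measure below does not depend on the choice of fundamental domain.\<close>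

definition modular_domain :: "(complex \<times> complex) set" where
  "modular_domain = {(z, u) \<in> T1H. \<bar>Re z\<bar> < 1/2 \<and> 1 < norm z}"

definition m_bar :: "(complex \<times> complex) set measure" where
  "m_bar = distr (uniform_measure liouville modular_domain) M_borel proj"

definition m_horo :: "real \<Rightarrow> (complex \<times> complex) set measure" where
  "m_horo y = distr (uniform_measure lborel {0..1::real}) M_borel
                (\<lambda>x. proj (Complex x y, cis pi))"

text \<open>The unstable horocycle flow: \<open>T1H\<close> is a single orbit of \<open>SL2R\<close>, so the flow is determined
  by equivariance and its values \<open>h\<^sup>+\<^sub>s(\<i>, \<pi>) = (\<i> + s, \<pi>)\<close>; see
  \<open>h_plus_is_unstable_horocycle_flow\<close> and \<open>unstable_horocycle_flow_unique\<close> below.\<close>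

definition h_plus :: "real \<Rightarrow> complex \<times> complex \<Rightarrow> complex \<times> complex" where
  "h_plus s v = (THE w. \<exists>A\<in>SL2R. v = tangent_act A (\<i>, cis pi) \<and>
                                 w = tangent_act A (Complex s 1, cis pi))"

definition box_lift :: "real \<Rightarrow> real \<Rightarrow> real \<Rightarrow> real \<Rightarrow> real \<Rightarrow> (complex \<times> complex) set" where
  "box_lift \<alpha>1 \<alpha>2 \<beta>1 \<beta>2 l =
     {h_plus s (Complex x y, cis 0) | s x y.
        \<alpha>1 \<le> x \<and> x \<le> \<alpha>2 \<and> \<beta>1 \<le> y \<and> y \<le> \<beta>2 \<and> \<bar>s\<bar> \<le> l / 2}"

definition adapted_box :: "(complex \<times> complex) set set \<Rightarrow> bool" where
  "adapted_box C \<longleftrightarrow>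
     (\<exists>\<alpha>1 \<alpha>2 \<beta>1 \<beta>2 l. 0 < \<alpha>1 \<and> \<alpha>1 < \<alpha>2 \<and> \<alpha>2 \<le> 1 \<and> 0 < \<beta>1 \<and> \<beta>1 < \<beta>2 \<and> 0 < l \<and>
        inj_on proj (box_lift \<alpha>1 \<alpha>2 \<beta>1 \<beta>2 l) \<and>
        C = proj ` box_lift \<alpha>1 \<alpha>2 \<beta>1 \<beta>2 l)"


definition unstable_horocycle_flow :: "(real \<Rightarrow> complex \<times> complex \<Rightarrow> complex \<times> complex) \<Rightarrow> bool" where
  "unstable_horocycle_flow h \<longleftrightarrow>
     (\<forall>s. \<forall>v\<in>T1H. h s v \<in> T1H) \<and>
     (\<forall>v\<in>T1H. h 0 v = v) \<and>
     (\<forall>s t. \<forall>v\<in>T1H. h (s + t) v = h s (h t v)) \<and>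
     (\<forall>s. \<forall>A\<in>SL2R. \<forall>v\<in>T1H. h s (tangent_act A v) = tangent_act A (h s v)) \<and>
     (\<forall>s x y. 0 < y \<longrightarrow> h s (Complex x y, cis pi) = (Complex (x + s * y) y, cis pi))"

lemma cis_minus_two_Arg: "w \<noteq> 0 \<Longrightarrow> cis (- 2 * Arg w) = cnj w / w"
proof -
  assume w: "w \<noteq> 0"
  have "cis (- 2 * Arg w) = inverse (cis (Arg w) * cis (Arg w))"
    by (simp add: cis_mult cis_inverse)
  also have "\<dots> = inverse (sgn w * sgn w)"
    using w by (simp add: cis_Arg)
  also have "\<dots> = of_real (norm w ^ 2) / (w * w)"
    using w by (simp add: sgn_eq field_simps power2_eq_square)
  also have "\<dots> = cnj w / w"
    using w by (subst complex_norm_square) (simp add: field_simps)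
  finally show ?thesis .
qed

abbreviation (input) cofactor :: "real^2^2 \<Rightarrow> complex \<Rightarrow> complex" where
  "cofactor A z \<equiv> of_real (A$2$1) * z + of_real (A$2$2)"

lemma cofactor_nz:
  assumes "A \<in> SL2R" "0 < Im z" shows "cofactor A z \<noteq> 0"
proof
  assume e: "cofactor A z = 0"
  hence "A$2$1 * Im z = 0" by (auto simp: complex_eq_iff)
  hence "A$2$1 = 0" using assms by simp
  moreover from this e have "A$2$2 = 0" by simp
  ultimately show False using assms by (simp add: SL2R_def det_2)
qed

lemma tangent_act_eq:
  assumes "A \<in> SL2R" "0 < Im z"
  shows "tangent_act A (z, u) = ((of_real (A$1$1) * z + of_real (A$1$2)) / cofactor A z,
           u * (cnj (cofactor A z) / cofactor A z))"
  using cis_minus_two_Arg[OF cofactor_nz[OF assms]] by (simp add: tangent_act_def)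

lemma Im_tangent_act:
  assumes "A \<in> SL2R" "0 < Im z"
  shows "Im (fst (tangent_act A (z, u))) = Im z / (norm (cofactor A z))\<^sup>2"
proof -
  have d: "A$1$1 * A$2$2 - A$1$2 * A$2$1 = 1" using assms by (simp add: SL2R_def det_2)
  have "Im (fst (tangent_act A (z, u))) =
      (A$1$1 * A$2$2 - A$1$2 * A$2$1) * Im z / (norm (cofactor A z))\<^sup>2"
    by (simp add: tangent_act_def Im_divide cmod_power2 algebra_simps)
  thus ?thesis using d by simp
qed

lemma tangent_act_in: assumes "A \<in> SL2R" "v \<in> T1H" shows "tangent_act A v \<in> T1H"
proof -
  obtain z u where v: "v = (z, u)" "0 < Im z" "norm u = 1" using assms by (auto simp: T1H_def)
  have "Im (fst (tangent_act A v)) > 0"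
    using Im_tangent_act[OF assms(1) v(2), of u] cofactor_nz[OF assms(1) v(2)] v by simp
  moreover have "norm (snd (tangent_act A v)) = 1"
    using v by (simp add: tangent_act_def norm_mult)
  ultimately show ?thesis by (cases "tangent_act A v") (auto simp: T1H_def)
qed

lemma SL2R_mult: "A \<in> SL2R \<Longrightarrow> B \<in> SL2R \<Longrightarrow> A ** B \<in> SL2R"
  by (simp add: SL2R_def det_mul)

lemma tangent_act_mult:
  assumes "A \<in> SL2R" "B \<in> SL2R" "v \<in> T1H"
  shows "tangent_act (A ** B) v = tangent_act A (tangent_act B v)"
proof -
  obtain z u where v: "v = (z, u)" "0 < Im z" using assms by (auto simp: T1H_def)
  define w where "w = (of_real (B$1$1) * z + of_real (B$1$2)) / cofactor B z"
  have nB: "cofactor B z \<noteq> 0" using cofactor_nz assms v by blast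
  have fB: "tangent_act B v = (w, u * (cnj (cofactor B z) / cofactor B z))"
    unfolding w_def v(1) by (rule tangent_act_eq[OF assms(2) v(2)])
  have wI: "0 < Im w" using tangent_act_in[OF assms(2,3)] unfolding fB by (simp add: T1H_def)
  have nA: "cofactor A w \<noteq> 0" using cofactor_nz assms wI by blast
  have w: "w * cofactor B z = of_real (B$1$1) * z + of_real (B$1$2)" using nB by (simp add: w_def)
  have "cofactor (A ** B) z =
      of_real (A$2$1) * (of_real (B$1$1) * z + of_real (B$1$2)) + of_real (A$2$2) * cofactor B z"
    by (simp add: matrix_matrix_mult_def sum_2 algebra_simps)
  also have "\<dots> = cofactor A w * cofactor B z" by (simp only: w[symmetric]) (simp add: algebra_simps)
  finally have c: "cofactor (A ** B) z = cofactor A w * cofactor B z" .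
  have "of_real ((A**B)$1$1) * z + of_real ((A**B)$1$2) =
      of_real (A$1$1) * (of_real (B$1$1) * z + of_real (B$1$2)) + of_real (A$1$2) * cofactor B z"
    by (simp add: matrix_matrix_mult_def sum_2 algebra_simps)
  also have "\<dots> = (of_real (A$1$1) * w + of_real (A$1$2)) * cofactor B z"
    by (simp only: w[symmetric]) (simp add: algebra_simps)
  finally have n: "of_real ((A**B)$1$1) * z + of_real ((A**B)$1$2) =
      (of_real (A$1$1) * w + of_real (A$1$2)) * cofactor B z" .
  show ?thesis
    unfolding fB tangent_act_eq[OF assms(1) wI]
    unfolding v(1) tangent_act_eq[OF SL2R_mult[OF assms(1,2)] v(2)] n c
    using nB by (simp add: mult_ac)
qed

lemma tangent_act_transitive:
  assumes "v \<in> T1H" obtains A where "A \<in> SL2R" "v = tangent_act A (\<i>, cis pi)"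
proof -
  obtain z u where v: "v = (z, u)" "0 < Im z" "norm u = 1" using assms by (auto simp: T1H_def)
  define p where "p = (pi - Arg u) / 2"
  define K :: "real^2^2" where "K = vector [vector [cos p, - sin p], vector [sin p, cos p]]"
  define r where "r = sqrt (Im z)"
  have r: "r > 0" "r * r = Im z" using v by (auto simp: r_def)
  define B :: "real^2^2" where "B = vector [vector [r, Re z / r], vector [0, 1 / r]]"
  have K: "K \<in> SL2R" by (simp add: SL2R_def K_def det_2 flip: power2_eq_square)
  have B: "B \<in> SL2R" using r by (simp add: SL2R_def B_def det_2)
  have u: "u = cis (Arg u)" using v cis_Arg[of u] by (force simp: sgn_eq)
  have cof: "cofactor K \<i> = cis p" by (simp add: K_def complex_eq_iff)
  have num: "of_real (K$1$1) * \<i> + of_real (K$1$2) = \<i> * cis p"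
    by (simp add: K_def complex_eq_iff)
  have "cis pi * (cnj (cis p) / cis p) = cis (pi - 2 * p)"
    by (simp add: cis_cnj cis_divide cis_mult del: cis_pi)
  also have "pi - 2 * p = Arg u" by (simp add: p_def field_simps)
  also have "cis (Arg u) = u" using u by simp
  finally have Kact: "tangent_act K (\<i>, cis pi) = (\<i>, u)"
    using tangent_act_eq[OF K, of \<i> "cis pi"] unfolding cof num by simp
  have "tangent_act B (\<i>, u) = (z, u)"
    using tangent_act_eq[OF B, of \<i> u] r by (simp add: B_def complex_eq_iff field_simps)
  hence "v = tangent_act (B ** K) (\<i>, cis pi)"
    using Kact v tangent_act_mult[OF B K, of "(\<i>, cis pi)"] by (simp add: T1H_def)
  thus ?thesis using that SL2R_mult[OF B K] by blast
qed

lemma tangent_act_free: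
  assumes A: "A \<in> SL2R" and B: "B \<in> SL2R"
    and e: "tangent_act A (\<i>, cis pi) = tangent_act B (\<i>, cis pi)"
  shows "A = B \<or> A = - B"
proof -
  define a where "a = cofactor A \<i>"
  define b where "b = cofactor B \<i>"
  have nz: "a \<noteq> 0" "b \<noteq> 0" using cofactor_nz A B by (auto simp: a_def b_def)
  note eA = tangent_act_eq[OF A, of \<i> "cis pi", folded a_def]
  note eB = tangent_act_eq[OF B, of \<i> "cis pi", folded b_def]
  have e1: "(of_real (A$1$1) * \<i> + of_real (A$1$2)) / a = (of_real (B$1$1) * \<i> + of_real (B$1$2)) / b"
    using e eA eB by simp
  have e2: "cnj a / a = cnj b / b" using e eA eB by simp
  have "1 / (norm a)\<^sup>2 = 1 / (norm b)\<^sup>2"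
    using e Im_tangent_act[OF A, of \<i> "cis pi"] Im_tangent_act[OF B, of \<i> "cis pi"]
    by (simp add: a_def b_def)
  hence "(norm a)\<^sup>2 = (norm b)\<^sup>2" by simp
  hence "a * cnj a = b * cnj b" by (metis complex_norm_square)
  moreover have "cnj a = a * (cnj b / b)" using e2 nz by (simp add: field_simps)
  ultimately have "a * (a * (cnj b / b)) = b * cnj b" by simp
  hence "a * a * (cnj b / b) = b * b * (cnj b / b)" using nz by (simp add: mult.assoc)
  hence "a * a = b * b" using nz by (subst (asm) mult_cancel_right) simp
  hence "a\<^sup>2 = b\<^sup>2" by (simp add: power2_eq_square)
  hence ab: "a = b \<or> a = - b" by (simp add: power2_eq_iff)
  thus ?thesis
  proof
    assume ab: "a = b"
    have "of_real (A$1$1) * \<i> + of_real (A$1$2) = of_real (B$1$1) * \<i> + (of_real (B$1$2) :: complex)"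
      using e1 nz unfolding ab by simp
    hence "A = B"
      using ab by (simp add: vec_eq_iff forall_2 a_def b_def complex_eq_iff)
    thus ?thesis ..
  next
    assume ab: "a = - b"
    have gen: "p = - q" if "p / (- b) = q / b" for p q :: complex
    proof -
      have "(- p) / b = q / b" using that by simp
      hence "- p = q" using nz by (simp only: divide_cancel_right) simp
      thus ?thesis by auto
    qed
    have "of_real (A$1$1) * \<i> + of_real (A$1$2) = - (of_real (B$1$1) * \<i> + of_real (B$1$2))"
      using e1 unfolding ab by (rule gen)
    hence "A = - B"
      using ab by (simp add: vec_eq_iff forall_2 a_def b_def complex_eq_iff)
    thus ?thesis ..
  qed
qed

lemma tangent_act_uminus:
  assumes "A \<in> SL2R" "v \<in> T1H" shows "tangent_act (- A) v = tangent_act A v"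
proof -
  obtain z u where v: "v = (z, u)" "0 < Im z" using assms by (auto simp: T1H_def)
  have mA: "- A \<in> SL2R" using assms by (simp add: SL2R_def det_2)
  define c where "c = cofactor A z"
  have c: "cofactor (- A) z = - c" by (simp add: c_def)
  have n: "of_real ((-A)$1$1) * z + of_real ((-A)$1$2) = - (of_real (A$1$1) * z + of_real (A$1$2))"
    by simp
  have neg: "(- p) / (- q) = p / q" for p q :: complex by simp
  show ?thesis
    unfolding v(1) tangent_act_eq[OF assms(1) v(2)] tangent_act_eq[OF mA v(2)] n c
      c_def[symmetric]
    by (simp only: complex_cnj_minus neg)
qed

lemma h_plus_tangent_act:
  assumes A: "A \<in> SL2R"
  shows "h_plus s (tangent_act A (\<i>, cis pi)) = tangent_act A (Complex s 1, cis pi)"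
  unfolding h_plus_def
proof (rule the_equality)
  show "\<exists>A'\<in>SL2R. tangent_act A (\<i>, cis pi) = tangent_act A' (\<i>, cis pi) \<and>
     tangent_act A (Complex s 1, cis pi) = tangent_act A' (Complex s 1, cis pi)"
    using A by blast
next
  fix w assume "\<exists>A'\<in>SL2R. tangent_act A (\<i>, cis pi) = tangent_act A' (\<i>, cis pi) \<and>
     w = tangent_act A' (Complex s 1, cis pi)"
  then obtain B where B: "B \<in> SL2R" "tangent_act A (\<i>, cis pi) = tangent_act B (\<i>, cis pi)"
    "w = tangent_act B (Complex s 1, cis pi)" by blast
  have "A = B \<or> A = - B" using tangent_act_free A B by blast
  thus "w = tangent_act A (Complex s 1, cis pi)"
    using B tangent_act_uminus[OF B(1), of "(Complex s 1, cis pi)"] by (auto simp: T1H_def)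
qed

lemma h_plus_commute:
  assumes "A \<in> SL2R" "v \<in> T1H" shows "h_plus s (tangent_act A v) = tangent_act A (h_plus s v)"
proof -
  obtain B where B: "B \<in> SL2R" "v = tangent_act B (\<i>, cis pi)"
    using tangent_act_transitive assms by blast
  have 1: "(\<i>, cis pi) \<in> T1H" and 2: "(Complex s 1, cis pi) \<in> T1H" by (auto simp: T1H_def)
  show ?thesis
    unfolding B(2) tangent_act_mult[OF assms(1) B(1) 1, symmetric]
      h_plus_tangent_act[OF B(1)] h_plus_tangent_act[OF SL2R_mult[OF assms(1) B(1)]]
    by (rule tangent_act_mult[OF assms(1) B(1) 2])
qed

lemma horizontal_as_act:
  assumes "0 < y"
  obtains A where "A \<in> SL2R" "\<And>s. tangent_act A (Complex s 1, cis pi) = (Complex (x + s * y) y, cis pi)"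
proof -
  define r where "r = sqrt y"
  have r: "r > 0" "r * r = y" using assms by (auto simp: r_def)
  define B :: "real^2^2" where "B = vector [vector [r, x / r], vector [0, 1 / r]]"
  have B: "B \<in> SL2R" using r by (simp add: SL2R_def B_def det_2)
  have "tangent_act B (Complex s 1, cis pi) = (Complex (x + s * y) y, cis pi)" for s
    using tangent_act_eq[OF B, of "Complex s 1" "cis pi"] r
    by (auto simp add: B_def complex_eq_iff field_simps)
  thus ?thesis using that B by blast
qed

lemma h_plus_horizontal:
  assumes "0 < y" shows "h_plus s (Complex x y, cis pi) = (Complex (x + s * y) y, cis pi)"
proof -
  obtain A where A: "A \<in> SL2R" "\<And>s. tangent_act A (Complex s 1, cis pi) = (Complex (x + s * y) y, cis pi)"
    using horizontal_as_act[OF assms] by blast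
  have "tangent_act A (\<i>, cis pi) = (Complex x y, cis pi)"
    using A(2)[of 0] by (simp add: imaginary_unit.code)
  thus ?thesis using h_plus_tangent_act[OF A(1), of s] A(2)[of s] by simp
qed

lemma h_plus_is_unstable_horocycle_flow: "unstable_horocycle_flow h_plus"
  unfolding unstable_horocycle_flow_def
proof (intro conjI allI ballI impI)
  fix s v assume "v \<in> T1H"
  then obtain B where B: "B \<in> SL2R" "v = tangent_act B (\<i>, cis pi)" using tangent_act_transitive by blast
  show "h_plus s v \<in> T1H"
    unfolding B(2) h_plus_tangent_act[OF B(1)] by (rule tangent_act_in[OF B(1)]) (simp add: T1H_def)
next
  fix v assume "v \<in> T1H"
  then obtain B where B: "B \<in> SL2R" "v = tangent_act B (\<i>, cis pi)" using tangent_act_transitive by blast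
  show "h_plus 0 v = v"
    unfolding B(2) h_plus_tangent_act[OF B(1)] by (simp add: imaginary_unit.code)
next
  fix s t v assume "v \<in> T1H"
  then obtain B where B: "B \<in> SL2R" "v = tangent_act B (\<i>, cis pi)" using tangent_act_transitive by blast
  have "(Complex t 1, cis pi) \<in> T1H" by (simp add: T1H_def)
  thus "h_plus (s + t) v = h_plus s (h_plus t v)"
    unfolding B(2) h_plus_tangent_act[OF B(1)]
    by (simp add: h_plus_commute[OF B(1)] h_plus_horizontal add.commute del: cis_pi)
qed (simp_all only: h_plus_commute h_plus_horizontal)

lemma unstable_horocycle_flow_unique:
  assumes h: "unstable_horocycle_flow h" and "v \<in> T1H" shows "h s v = h_plus s v"
proof -
  obtain B where B: "B \<in> SL2R" "v = tangent_act B (\<i>, cis pi)"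
    using tangent_act_transitive assms by blast
  have i: "\<i> = Complex 0 1" by (simp add: complex_eq_iff)
  have "(\<i>, cis pi) \<in> T1H" by (simp add: T1H_def)
  hence "h s v = tangent_act B (h s (\<i>, cis pi))"
    using h B unfolding unstable_horocycle_flow_def by blast
  also have "h s (\<i>, cis pi) = (Complex s 1, cis pi)"
    using h unfolding unstable_horocycle_flow_def i by simp
  finally show ?thesis using h_plus_tangent_act[OF B(1)] B(2) by simp
qed

lemma proj_measurable: "proj \<in> measurable (restrict_space borel T1H) M_borel"
  unfolding M_borel_def
proof (rule measurable_measure_of)
  show "{U. U \<subseteq> M_points \<and> openin (top_of_set T1H) {v \<in> T1H. proj v \<in> U}} \<subseteq> Pow M_points" by blast
  show "proj \<in> space (restrict_space borel T1H) \<rightarrow> M_points"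
    by (auto simp: space_restrict_space M_points_def)
  fix U assume "U \<in> {U. U \<subseteq> M_points \<and> openin (top_of_set T1H) {v \<in> T1H. proj v \<in> U}}"
  then obtain S where S: "open S" "{v \<in> T1H. proj v \<in> U} = T1H \<inter> S" by (auto simp: openin_open)
  have "proj -` U \<inter> space (restrict_space borel T1H) = T1H \<inter> S"
    using S(2) by (auto simp: space_restrict_space)
  thus "proj -` U \<inter> space (restrict_space borel T1H) \<in> sets (restrict_space borel T1H)"
    using S(1) by (auto simp: sets_restrict_space)
qed

lemma prob_space_m_horo:
  assumes "0 < y" shows "prob_space (m_horo y)"
proof -
  have "(\<lambda>x. (Complex x y, cis pi)) \<in> measurable borel (restrict_space borel T1H)"
    using assms
    by (intro measurable_restrict_space2 borel_measurable_continuous_onI)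
       (auto simp: T1H_def Complex_eq intro!: continuous_intros)
  hence m: "(\<lambda>x. proj (Complex x y, cis pi)) \<in> measurable (uniform_measure lborel {0..1::real}) M_borel"
    unfolding measurable_cong_sets[OF sets_uniform_measure refl]
    using measurable_compose[OF _ proj_measurable] by simp
  show ?thesis unfolding m_horo_def
    by (rule prob_space.prob_space_distr[OF prob_space_uniform_measure m]) auto
qed

abbreviation (input) coord_domain :: "(real \<times> real \<times> real) set" where
  "coord_domain \<equiv> {(x, y, \<theta>). 0 < y \<and> 0 \<le> \<theta> \<and> \<theta> < 2 * pi}"

lemma coord_domain_borel: "coord_domain \<in> sets borel"
proof -
  have "coord_domain = {p. 0 < fst (snd p)} \<inter> {p. 0 \<le> snd (snd p)} \<inter> {p. snd (snd p) < 2 * pi}"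
    by auto
  moreover have "open {p :: real \<times> real \<times> real. 0 < fst (snd p)}"
    "closed {p :: real \<times> real \<times> real. 0 \<le> snd (snd p)}"
    "open {p :: real \<times> real \<times> real. snd (snd p) < 2 * pi}"
    by (intro open_Collect_less closed_Collect_le continuous_intros)+
  ultimately show ?thesis by auto
qed

lemma coord_measurable:
  "(\<lambda>(x, y, \<theta>). (Complex x y, cis \<theta>)) \<in>
     measurable (restrict_space lborel coord_domain) (restrict_space borel T1H)"
proof (rule measurable_restrict_space2)
  have "(\<lambda>(x, y, \<theta>). (Complex x y, cis \<theta>)) \<in> borel_measurable borel"
    by (rule borel_measurable_continuous_onI)
       (auto simp: Complex_eq split_beta intro!: continuous_intros)
  thus "(\<lambda>(x, y, \<theta>). (Complex x y, cis \<theta>)) \<in> borel_measurable (restrict_space lborel coord_domain)"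
    by (intro measurable_restrict_space1) simp
qed (auto simp: T1H_def space_restrict_space)

lemma modular_domain_sets: "modular_domain \<in> sets (restrict_space borel T1H)"
proof -
  have "open {v :: complex \<times> complex. \<bar>Re (fst v)\<bar> < 1/2 \<and> 1 < norm (fst v)}"
    by (intro open_Collect_conj open_Collect_less continuous_intros)
  moreover have "modular_domain = T1H \<inter> {v. \<bar>Re (fst v)\<bar> < 1/2 \<and> 1 < norm (fst v)}"
    by (auto simp: modular_domain_def)
  ultimately show ?thesis by (auto simp: sets_restrict_space)
qed

lemma emeasure_modular_domain:
  "emeasure liouville modular_domain =
     (\<integral>\<^sup>+ (x, y, \<theta>). ennreal (1 / y\<^sup>2) *
        indicator {(x, y, \<theta>). 0 < y \<and> 0 \<le> \<theta> \<and> \<theta> < 2 * pi \<and> \<bar>x\<bar> < 1/2 \<and> 1 < x\<^sup>2 + y\<^sup>2} (x, y, \<theta>) \<partial>lborel)"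
proof -
  let ?f = "\<lambda>(x::real, y, \<theta>). (Complex x y, cis \<theta>)"
  let ?R = "restrict_space lborel coord_domain"
  let ?w = "\<lambda>(x::real, y::real, \<theta>::real). ennreal (1 / y\<^sup>2)"
  have w: "?w \<in> borel_measurable borel" by (simp add: borel_prod[symmetric])
  hence wR: "?w \<in> borel_measurable ?R" by (intro measurable_restrict_space1) simp
  have f: "?f \<in> measurable (density ?R ?w) (restrict_space borel T1H)"
    using coord_measurable by (simp add: measurable_cong_sets[OF sets_density refl])
  have pre: "?f -` modular_domain \<inter> space ?R \<in> sets ?R"
    using measurable_sets[OF coord_measurable modular_domain_sets] .
  have "emeasure liouville modular_domain = emeasure (density ?R ?w) (?f -` modular_domain \<inter> space ?R)"
    unfolding liouville_def using emeasure_distr[OF f modular_domain_sets] by simp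
  also have "\<dots> = (\<integral>\<^sup>+ p. ?w p * indicator (?f -` modular_domain \<inter> space ?R) p \<partial>?R)"
    by (rule emeasure_density[OF wR pre])
  also have "\<dots> = (\<integral>\<^sup>+ p. ?w p * indicator (?f -` modular_domain \<inter> space ?R) p * indicator coord_domain p \<partial>lborel)"
    using coord_domain_borel by (intro nn_integral_restrict_space) simp
  also have "\<dots> = (\<integral>\<^sup>+ (x, y, \<theta>). ennreal (1 / y\<^sup>2) *
        indicator {(x, y, \<theta>). 0 < y \<and> 0 \<le> \<theta> \<and> \<theta> < 2 * pi \<and> \<bar>x\<bar> < 1/2 \<and> 1 < x\<^sup>2 + y\<^sup>2} (x, y, \<theta>) \<partial>lborel)"
    by (intro nn_integral_cong)
       (auto simp: indicator_def modular_domain_def T1H_def space_restrict_space cmod_def)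
  finally show ?thesis .
qed

lemma nn_integral_lborel_pair:
  fixes f :: "'a::euclidean_space \<times> 'b::euclidean_space \<Rightarrow> ennreal"
  assumes "f \<in> borel_measurable borel"
  shows "(\<integral>\<^sup>+ p. f p \<partial>lborel) = (\<integral>\<^sup>+ x. \<integral>\<^sup>+ y. f (x, y) \<partial>lborel \<partial>lborel)"
  using lborel.nn_integral_fst[of f lborel] assms by (simp add: lborel_prod)

lemma emeasure_modular_domain_finite: "emeasure liouville modular_domain \<noteq> \<infinity>"
proof -
  let ?X = "\<lambda>x. indicator {-1/2..1/2::real} x :: ennreal"
  let ?Y = "\<lambda>y. ennreal (1 / y\<^sup>2) * indicator {1/2::real..} y :: ennreal"
  let ?T = "\<lambda>t. indicator {0..2*pi} t :: ennreal"
  have Y: "(\<integral>\<^sup>+ y. ?Y y \<partial>lborel) = ennreal (0 - (- 1 / (1/2)))"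
  proof (rule nn_integral_FTC_atLeast)
    show "((\<lambda>y::real. - 1 / y) \<longlongrightarrow> 0) at_top" by real_asymp
    show "DERIV (\<lambda>y::real. - 1 / y) y :> 1 / y\<^sup>2" if "1/2 \<le> y" for y
      using that by (auto intro!: derivative_eq_intros simp: power2_eq_square)
  qed auto
  have "emeasure liouville modular_domain \<le> (\<integral>\<^sup>+ (x, y, t). ?X x * (?Y y * ?T t) \<partial>lborel)"
    unfolding emeasure_modular_domain
  proof (rule nn_integral_mono, clarify)
    fix x y t :: real
    have "1/2 \<le> y" if "0 < y" "\<bar>x\<bar> < 1/2" "1 < x\<^sup>2 + y\<^sup>2"
    proof (rule ccontr)
      assume "\<not> 1/2 \<le> y"
      hence "y\<^sup>2 \<le> (1/2)\<^sup>2" "\<bar>x\<bar>\<^sup>2 \<le> (1/2)\<^sup>2" using that by (intro power_mono; simp)+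
      thus False using that by (simp add: power2_eq_square)
    qed
    thus "ennreal (1 / y\<^sup>2) *
        indicator {(x, y, \<theta>). 0 < y \<and> 0 \<le> \<theta> \<and> \<theta> < 2 * pi \<and> \<bar>x\<bar> < 1/2 \<and> 1 < x\<^sup>2 + y\<^sup>2} (x, y, t)
        \<le> ?X x * (?Y y * ?T t)"
      by (auto simp: indicator_def)
  qed
  also have "\<dots> = (\<integral>\<^sup>+ x. ?X x * (\<integral>\<^sup>+ y. ?Y y * (\<integral>\<^sup>+ t. ?T t \<partial>lborel) \<partial>lborel) \<partial>lborel)"
    by (simp add: nn_integral_lborel_pair borel_prod[symmetric] nn_integral_cmult mult.assoc
             del: nn_integral_indicator)
  also have "\<dots> < \<infinity>"
    by (simp add: nn_integral_multc Y ennreal_mult_less_top)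
  finally show ?thesis by simp
qed

lemma emeasure_modular_domain_pos: "emeasure liouville modular_domain \<noteq> 0"
proof -
  let ?B = "box (0, 1, 0) (1/2, 2, 1) :: (real \<times> real \<times> real) set"
  have b: "?B = {0<..<1/2} \<times> {1<..<2} \<times> {0<..<1}"
    by (auto simp: mem_box Basis_prod_def)
  have "emeasure lborel ?B = ennreal (1/2)"
    by (subst emeasure_lborel_box_eq) (auto simp: Basis_prod_def)
  moreover have "0 < ennreal (1/4)" "0 < ennreal (1/2)" by (simp_all only: ennreal_less_zero_iff)
  ultimately have "0 < ennreal (1/4) * emeasure lborel ?B" by (simp only: ennreal_zero_less_mult_iff)
  also have "\<dots> = (\<integral>\<^sup>+ p. ennreal (1/4) * indicator ?B p \<partial>lborel)"
    by (simp add: nn_integral_cmult_indicator)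
  also have "\<dots> \<le> emeasure liouville modular_domain"
    unfolding emeasure_modular_domain
  proof (rule nn_integral_mono, clarify)
    fix x y t :: real
    have "1/4 \<le> 1 / y\<^sup>2 \<and> 1 < x\<^sup>2 + y\<^sup>2" if "0 < x" "1 < y" "y < 2"
    proof -
      have "y\<^sup>2 \<le> 2\<^sup>2" using that by (intro power_mono) auto
      moreover have "1 < y\<^sup>2" using that by (simp add: one_less_power)
      ultimately show ?thesis using that by (simp add: field_simps add_pos_pos less_add_same_cancel2 add_strict_increasing)
    qed
    moreover have "1 < 2 * pi" using pi_gt3 by simp
    ultimately show "ennreal (1/4) * indicator ?B (x, y, t) \<le> ennreal (1 / y\<^sup>2) *
        indicator {(x, y, \<theta>). 0 < y \<and> 0 \<le> \<theta> \<and> \<theta> < 2 * pi \<and> \<bar>x\<bar> < 1/2 \<and> 1 < x\<^sup>2 + y\<^sup>2} (x, y, t)"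
      unfolding b by (auto simp: indicator_def intro!: ennreal_leI)
  qed
  finally show ?thesis by simp
qed

lemma prob_space_m_bar: "prob_space m_bar"
proof -
  have sets_eq: "sets (uniform_measure liouville modular_domain) = sets (restrict_space borel T1H)"
    by (simp only: sets_uniform_measure) (simp only: liouville_def sets_distr)
  have m: "proj \<in> measurable (uniform_measure liouville modular_domain) M_borel"
    unfolding measurable_cong_sets[OF sets_eq refl] by (rule proj_measurable)
  show ?thesis unfolding m_bar_def
    by (rule prob_space.prob_space_distr[OF prob_space_uniform_measure m])
       (fact emeasure_modular_domain_pos emeasure_modular_domain_finite)+
qed

end

theory Submission
  imports Defs "HOL-Computational_Algebra.Squarefree"
begin

text \<open>
  Every unit tangent vector is \<open>frame A\<close>, the image of the downward vector at \<open>\<i>\<close> under a matrix \<open>A\<close> of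
  determinant one that is unique up to sign. For \<open>A\<^sub>2\<^sub>1 \<noteq> 0\<close> it is determined by its first column \<open>(p, q)\<close>
  and the number \<open>s = A\<^sub>2\<^sub>2 / A\<^sub>2\<^sub>1\<close>; the group acts linearly on \<open>(p, q)\<close> and by translations on \<open>s\<close>,
  and the unstable horocycle flow moves \<open>s\<close> alone. The lift of a box is the set where \<open>\<bar>s\<bar> \<le> l / 2\<close> and
  \<open>(p, q)\<close> lies in a double cone cut off by \<open>b1 \<le> 1 / q\<^sup>2 \<le> b2\<close>; let \<open>H\<close> be the half of it with \<open>q > 0\<close>,
  a trapezoid.

  Both measures of a box \<open>C\<close> unfold over \<open>SL2Z\<close>, because an orbit that meets an embedded set meets it
  for exactly one pair \<open>\<plusminus> A\<close> (\<open>nn_integral_orbit_visits\<close>).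

  \<^item> The horocycle of height \<open>y\<close> meets the lifted leaf in the points with first column \<open>\<surd>y (a, c)\<close>,
    \<open>a\<close> and \<open>c\<close> coprime, and each crossing of the box uses up length \<open>l y\<close>. So \<open>m_y(C)\<close> is \<open>l y\<close>
    times the number of primitive lattice points in \<open>H / \<surd>y\<close> (\<open>measure_m_horo_box\<close>).

  \<^item> The Liouville measure is \<open>2 dp dq ds\<close> (\<open>nn_integral_liouville_chart\<close>). This makes its invariance
    evident, and since the modular domain has volume \<open>2 \<pi>\<^sup>2 / 3\<close>, the normalized measure of \<open>C\<close> is
    \<open>6 / \<pi>\<^sup>2\<close> times \<open>l\<close> times the area of \<open>H\<close> (\<open>measure_m_bar_box\<close>).

  What remains is to count primitive points: a compact convex set in the square of radius \<open>R\<close> that misses the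
  origin contains \<open>6 / \<pi>\<^sup>2\<close> times its area many, up to \<open>O(R (1 + log R))\<close> (\<open>primitive_points_convex\<close>, by
  Moebius inversion). Here \<open>R\<close> is of the order \<open>y powr (- 1/2)\<close>, and the factor \<open>l y\<close> turns the error
  into \<open>O(y powr (1/2) * \<bar>ln y\<bar>)\<close>.

  Uniformity over the boxes \<open>C' \<subseteq> C\<close> needs one more idea, as their bases may lie arbitrarily low, where
  the trapezoid \<open>H'\<close> of \<open>C'\<close> is huge. The lift of \<open>C'\<close> is connected, and the translates of the lift
  of \<open>C\<close> are disjoint and locally finite; so a single element of \<open>SL2Z\<close> carries the first lift into
  the second (\<open>sub_box_translate\<close>). It preserves primitive points, area and convexity and moves \<open>H'\<close>
  into the double cone of \<open>C\<close>, and \<open>l' \<le> l\<close>. Hence the error for \<open>C'\<close> is bounded in terms of \<open>C\<close>.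
\<close>

section \<open>The Moebius function\<close>

definition moebius :: "nat \<Rightarrow> int" where
  "moebius n = (if squarefree n then (-1) ^ card (prime_factors n) else 0)"

lemma abs_moebius_le: "\<bar>moebius n\<bar> \<le> 1"
  by (simp add: moebius_def power_abs)

lemma moebius_prime_times:
  assumes p: "prime p" and d: "\<not> p dvd d"
  shows "moebius (p * d) = - moebius d"
proof -
  have d0: "d \<noteq> 0" using d by (metis dvd_0_right)
  have cop: "coprime p d" using p d by (simp add: prime_imp_coprime)
  have sf: "squarefree (p * d) \<longleftrightarrow> squarefree d"
    using cop p by (auto intro: squarefree_mult_coprime squarefree_prime dest: squarefree_multD)
  have "prime_factors (p * d) = insert p (prime_factors d)"
    using p d0 by (subst prime_factors_product) (auto simp: prime_factorization_prime)
  moreover have "p \<notin> prime_factors d" using d by auto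
  ultimately show ?thesis by (simp add: moebius_def sf)
qed

text \<open>Fix a prime \<open>p\<close> dividing \<open>n\<close>. The squarefree divisors of \<open>n\<close> fall into pairs \<open>d\<close>, \<open>p * d\<close>
  with \<open>p\<close> not dividing \<open>d\<close>, and the two terms of a pair cancel.\<close>

lemma sum_moebius_divisors:
  assumes "n > 0"
  shows "(\<Sum>d | d dvd n. moebius d) = (if n = 1 then 1 else 0)"
proof (cases "n = 1")
  case True
  have "{d::nat. d dvd 1} = {1}" by auto
  with True show ?thesis by (simp add: moebius_def)
next
  case False
  then obtain p where p: "prime p" "p dvd n" using prime_factor_nat by blast
  define A where "A = {d. d dvd n \<and> \<not> p dvd d \<and> squarefree d}"
  have fin: "finite {d. d dvd n}" using assms by simp
  have A: "finite A" unfolding A_def by (rule finite_subset[OF _ fin]) auto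
  have split: "{d. d dvd n \<and> squarefree d} = A \<union> (*) p ` A"
  proof (intro equalityI subsetI)
    fix d assume d: "d \<in> {d. d dvd n \<and> squarefree d}"
    show "d \<in> A \<union> (*) p ` A"
    proof (cases "p dvd d")
      case True
      then obtain e where e: "d = p * e" by auto
      have "squarefree e" "e dvd n" using d e by (auto dest: squarefree_multD dvd_mult_right)
      moreover have "\<not> p dvd e"
      proof
        assume "p dvd e"
        hence "p ^ 2 dvd d" unfolding e power2_eq_square by (rule mult_dvd_mono[OF dvd_refl])
        thus False using d p by (auto simp: squarefree_def)
      qed
      ultimately show ?thesis using e by (auto simp: A_def)
    qed (use d in \<open>auto simp: A_def\<close>)
  next
    fix d assume d: "d \<in> A \<union> (*) p ` A"
    have "p * e dvd n \<and> squarefree (p * e)" if "e \<in> A" for e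
    proof -
      have "coprime p e" using p that by (auto simp: A_def prime_imp_coprime)
      thus ?thesis using that p
        by (auto simp: A_def intro: squarefree_mult_coprime squarefree_prime divides_mult)
    qed
    thus "d \<in> {d. d dvd n \<and> squarefree d}" using d by (auto simp: A_def)
  qed
  have "(\<Sum>d | d dvd n. moebius d) = (\<Sum>d | d dvd n \<and> squarefree d. moebius d)"
    by (rule sum.mono_neutral_right[OF fin]) (auto simp: moebius_def)
  also have "\<dots> = (\<Sum>d\<in>A. moebius d) + (\<Sum>d\<in>(*) p ` A. moebius d)"
    unfolding split by (rule sum.union_disjoint) (use A in \<open>auto simp: A_def\<close>)
  also have "(\<Sum>d\<in>(*) p ` A. moebius d) = (\<Sum>d\<in>A. moebius (p * d))"
    using p by (subst sum.reindex) (auto simp: inj_on_def)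
  also have "\<dots> = (\<Sum>d\<in>A. - moebius d)"
    by (intro sum.cong refl moebius_prime_times) (use p in \<open>auto simp: A_def\<close>)
  finally show ?thesis using False by (simp add: sum_negf)
qed

lemma harmonic_le: "N \<ge> 1 \<Longrightarrow> (\<Sum>d=1..N. 1 / real d) \<le> 1 + ln (real N)"
proof (induction N rule: dec_induct)
  case (step n)
  have n: "real n > 0" using step by simp
  have "ln (real n / real (Suc n)) \<le> real n / real (Suc n) - 1" using n by (intro ln_le_minus_one) simp
  hence "1 / real (Suc n) \<le> ln (real (Suc n)) - ln (real n)"
    using n by (simp add: ln_div field_simps)
  thus ?case using step by simp
qed simp

text \<open>The terms are dominated by the telescoping differences \<open>1 / n - 1 / (n + 1)\<close>.\<close>

lemma inverse_squares_tail:
  assumes "M \<ge> 1"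
  shows "\<bar>pi\<^sup>2 / 6 - (\<Sum>n=1..M. 1 / real n ^ 2)\<bar> \<le> 1 / real M"
proof -
  define f where "f n = 1 / real n ^ 2" for n
  have S: "(\<lambda>n. f (Suc n)) sums (pi\<^sup>2 / 6)" using inverse_squares_sums by (simp add: f_def add.commute)
  have part: "(\<Sum>n=1..K. f n) = (\<Sum>n<K. f (Suc n))" for K
    by (rule sum.reindex_bij_witness[of _ Suc "\<lambda>n. n - 1"]) auto
  have lim: "(\<lambda>K. \<Sum>n=1..K. f n) \<longlonglongrightarrow> pi\<^sup>2 / 6" using S unfolding part sums_def .
  have up: "(\<Sum>n=1..K. f n) \<le> (\<Sum>n=1..M. f n) + 1 / real M - 1 / real K" if "K \<ge> M" for K
    using that
  proof (induction K rule: dec_induct)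
    case (step K)
    have K: "real K > 0" using step assms by simp
    have "f (Suc K) \<le> 1 / (real K * real (Suc K))"
      unfolding f_def power2_eq_square using K by (intro divide_left_mono mult_right_mono) auto
    also have "\<dots> = 1 / real K - 1 / real (Suc K)" using K by (simp add: field_simps)
    finally show ?case using step by simp
  qed simp
  have lo: "(\<Sum>n=1..M. f n) \<le> (\<Sum>n=1..K. f n)" if "K \<ge> M" for K
    by (rule sum_mono2) (use that in \<open>auto simp: f_def\<close>)
  have "pi\<^sup>2 / 6 \<le> (\<Sum>n=1..M. f n) + 1 / real M"
    by (rule Lim_bounded[OF lim, of M]) (meson up diff_le_self divide_nonneg_nonneg le_diff_eq of_nat_0_le_iff order_trans zero_le_one add_increasing2 order_refl le_add_same_cancel1)
  moreover have "(\<Sum>n=1..M. f n) \<le> pi\<^sup>2 / 6"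
    by (rule Lim_bounded2[OF lim, of M]) (use lo in auto)
  ultimately show ?thesis by (simp add: f_def)
qed

text \<open>Weighting \<open>\<mu>(d) / d\<^sup>2\<close> with the partial sum of \<open>\<zeta>(2)\<close> up to \<open>N div d\<close> and collecting the terms with
  equal \<open>k = d * n\<close> gives exactly \<open>1\<close>. Replacing each weight by \<open>\<zeta>(2) = \<pi>\<^sup>2 / 6\<close> changes the term of \<open>d\<close>
  by at most \<open>2 / (N d)\<close>.\<close>

lemma sum_moebius_over_squares:
  assumes N: "N \<ge> 1"
  shows "\<bar>(\<Sum>d=1..N. moebius d / real d ^ 2) - 6 / pi\<^sup>2\<bar> \<le> 2 * (1 + ln (real N)) / real N"
proof -
  define z where "z = pi\<^sup>2 / 6"
  have z1: "z \<ge> 1"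
  proof -
    have "3\<^sup>2 \<le> pi\<^sup>2" using pi_gt3 by (intro power_mono) auto
    thus ?thesis by (simp add: z_def)
  qed
  define T where "T M = (\<Sum>n=1..M. 1 / real n ^ 2)" for M
  have "(\<Sum>d=1..N. moebius d / real d ^ 2 * T (N div d)) =
        (\<Sum>d=1..N. \<Sum>n=1..N div d. moebius d / real (d * n) ^ 2)"
    by (simp add: T_def sum_distrib_left power_mult_distrib)
  also have "\<dots> = (\<Sum>(d,n)\<in>Sigma {1..N} (\<lambda>d. {1..N div d}). moebius d / real (d * n) ^ 2)"
    by (subst sum.Sigma) auto
  also have "\<dots> = (\<Sum>(k,d)\<in>Sigma {1..N} (\<lambda>k. {d. d dvd k}). moebius d / real k ^ 2)"
  proof (rule sum.reindex_bij_witness[of _ "\<lambda>(k,d). (d, k div d)" "\<lambda>(d,n). (d * n, d)"], goal_cases)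
    case (2 a)
    then obtain d n where "a = (d,n)" "1 \<le> d" "d \<le> N" "1 \<le> n" "n \<le> N div d" by auto
    moreover from this have "d * n \<le> N" by (metis less_eq_div_iff_mult_less_eq mult.commute less_eq_Suc_le One_nat_def)
    ultimately show ?case by (auto simp: Suc_le_eq)
  next
    case (4 b)
    then obtain k d where "b = (k,d)" "1 \<le> k" "k \<le> N" "d dvd k" by auto
    moreover from this have "d > 0" "d \<le> k" by (auto dest: dvd_imp_le intro: Nat.gr0I)
    ultimately show ?case by (auto simp: div_le_mono Suc_le_eq div_greater_zero_iff)
  qed auto
  also have "\<dots> = (\<Sum>k=1..N. (\<Sum>d | d dvd k. real_of_int (moebius d)) / real k ^ 2)"
    by (subst sum.Sigma[symmetric]) (auto simp: sum_divide_distrib)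
  also have "\<dots> = (\<Sum>k=1..N. if k = 1 then 1 else 0)"
    by (intro sum.cong refl) (simp add: sum_moebius_divisors flip: of_int_sum)
  also have "\<dots> = 1" using N by simp
  finally have one: "(\<Sum>d=1..N. moebius d / real d ^ 2 * T (N div d)) = 1" .
  have "\<bar>z * (\<Sum>d=1..N. moebius d / real d ^ 2) - 1\<bar> =
        \<bar>\<Sum>d=1..N. moebius d / real d ^ 2 * (z - T (N div d))\<bar>"
    unfolding one[symmetric] sum_distrib_left sum_subtractf[symmetric] by (simp add: right_diff_distrib mult_ac diff_divide_distrib)
  also have "\<dots> \<le> (\<Sum>d=1..N. \<bar>moebius d / real d ^ 2 * (z - T (N div d))\<bar>)" by (rule sum_abs)
  also have "\<dots> \<le> (\<Sum>d=1..N. 2 / real N * (1 / real d))"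
  proof (rule sum_mono)
    fix d assume d: "d \<in> {1..N}"
    define M where "M = N div d"
    have M: "M \<ge> 1" using d by (simp add: M_def Suc_le_eq div_greater_zero_iff)
    have "N \<le> d * (M + 1)" using d unfolding M_def
      by (metis add.commute dividend_less_times_div less_imp_le_nat mult.commute plus_1_eq_Suc Suc_le_eq One_nat_def atLeastAtMost_iff mult_Suc_right)
    also have "\<dots> \<le> d * (2 * M)" using M by (intro mult_left_mono) auto
    finally have "real N \<le> 2 * real d * real M" by (metis mult.assoc mult.left_commute of_nat_le_iff of_nat_mult of_nat_numeral)
    hence "1 / real M \<le> 2 * real d / real N" using M N by (simp add: field_simps)
    with inverse_squares_tail[OF M] have b: "\<bar>z - T M\<bar> \<le> 2 * real d / real N" by (simp add: z_def T_def)
    have m: "\<bar>real_of_int (moebius d)\<bar> \<le> 1" using abs_moebius_le[of d] by linarith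
    have "\<bar>moebius d / real d ^ 2 * (z - T M)\<bar> = \<bar>real_of_int (moebius d)\<bar> * \<bar>z - T M\<bar> / real d ^ 2"
      by (simp add: abs_mult)
    also have "\<dots> \<le> 1 * (2 * real d / real N) / real d ^ 2"
      by (intro divide_right_mono mult_mono m b) auto
    also have "\<dots> = 2 / real N * (1 / real d)" using d by (simp add: power2_eq_square)
    finally show "\<bar>moebius d / real d ^ 2 * (z - T (N div d))\<bar> \<le> 2 / real N * (1 / real d)"
      by (simp add: M_def)
  qed
  also have "\<dots> = 2 / real N * (\<Sum>d=1..N. 1 / real d)" by (simp add: sum_distrib_left)
  also have "\<dots> \<le> 2 / real N * (1 + ln (real N))" by (intro mult_left_mono harmonic_le N) auto
  finally have B: "\<bar>z * (\<Sum>d=1..N. moebius d / real d ^ 2) - 1\<bar> \<le> 2 / real N * (1 + ln (real N))" .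
  have "\<bar>(\<Sum>d=1..N. moebius d / real d ^ 2) - 6 / pi\<^sup>2\<bar> = \<bar>z * (\<Sum>d=1..N. moebius d / real d ^ 2) - 1\<bar> / z"
  proof -
    have "(\<Sum>d=1..N. moebius d / real d ^ 2) - 6 / pi\<^sup>2 = (z * (\<Sum>d=1..N. moebius d / real d ^ 2) - 1) / z"
      using z1 by (simp add: z_def diff_divide_distrib)
    thus ?thesis using z1 by (simp add: abs_divide)
  qed
  also have "\<dots> \<le> \<bar>z * (\<Sum>d=1..N. moebius d / real d ^ 2) - 1\<bar>"
    using z1 mult_right_mono[OF z1 abs_ge_zero] by (simp add: divide_le_eq mult.commute)
  also note B
  finally show ?thesis by (simp add: mult.commute)
qed

section \<open>Lattice points in convex sets\<close>

lemma card_integers_in_compact_convex: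
  fixes I :: "real set"
  assumes "compact I" "convex I"
  shows "finite {n::int. of_int n \<in> I}"
    and "\<bar>real (card {n::int. of_int n \<in> I}) - measure lborel I\<bar> \<le> 1"
proof -
  obtain a b where I: "I = {a..b}"
    using assms convex_connected connected_compact_interval_1 by blast
  have S: "{n::int. of_int n \<in> I} = {\<lceil>a\<rceil>..\<lfloor>b\<rfloor>}" by (auto simp: I le_floor_iff ceiling_le_iff)
  show "finite {n::int. of_int n \<in> I}" by (simp add: S)
  show "\<bar>real (card {n::int. of_int n \<in> I}) - measure lborel I\<bar> \<le> 1"
  proof (cases "a \<le> b")
    case True
    have "\<lceil>a\<rceil> \<le> \<lfloor>b\<rfloor> + 1" using True by linarith
    hence "real (card {n::int. of_int n \<in> I}) = of_int \<lfloor>b\<rfloor> - of_int \<lceil>a\<rceil> + 1"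
      by (simp add: S)
    thus ?thesis using True unfolding I by (simp add: measure_lborel_Icc) linarith
  next
    case False
    hence "I = {}" by (auto simp: I)
    thus ?thesis by simp
  qed
qed

lemma compact_convex_row:
  fixes D :: "(real \<times> real) set"
  assumes "compact D" "convex D"
  shows "compact {x. (x, y) \<in> D}" "convex {x. (x, y) \<in> D}"
proof -
  have "{x. (x, y) \<in> D} = fst ` (D \<inter> UNIV \<times> {y})" by force
  moreover have "compact (D \<inter> UNIV \<times> {y})" "convex (D \<inter> UNIV \<times> {y})"
    using assms by (auto intro!: compact_Int_closed closed_Times convex_Int convex_Times)
  ultimately show "compact {x. (x, y) \<in> D}" "convex {x. (x, y) \<in> D}"
    by (auto intro!: compact_continuous_image continuous_intros convex_linear_image bounded_linear_fst bounded_linear.linear)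
qed

lemma compact_convex_column:
  fixes D :: "(real \<times> real) set"
  assumes "compact D" "convex D"
  shows "compact {y. (x, y) \<in> D}" "convex {y. (x, y) \<in> D}"
proof -
  have "{y. (x, y) \<in> D} = snd ` (D \<inter> {x} \<times> UNIV)" by force
  moreover have "compact (D \<inter> {x} \<times> UNIV)" "convex (D \<inter> {x} \<times> UNIV)"
    using assms by (auto intro!: compact_Int_closed closed_Times convex_Int convex_Times)
  ultimately show "compact {y. (x, y) \<in> D}" "convex {y. (x, y) \<in> D}"
    by (auto intro!: compact_continuous_image continuous_intros convex_linear_image bounded_linear_snd bounded_linear.linear)
qed

definition lattice_points :: "(real \<times> real) set \<Rightarrow> (int \<times> int) set" where
  "lattice_points D = {(a, c). (of_int a, of_int c) \<in> D}"

lemma lattice_points_in_box: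
  assumes "\<And>p q. (p, q) \<in> D \<Longrightarrow> \<bar>p\<bar> \<le> R \<and> \<bar>q\<bar> \<le> R"
  shows "lattice_points D \<subseteq> {-\<lfloor>R\<rfloor>..\<lfloor>R\<rfloor>} \<times> {-\<lfloor>R\<rfloor>..\<lfloor>R\<rfloor>}"
proof
  fix v assume "v \<in> lattice_points D"
  then obtain a c where v: "v = (a, c)" "(of_int a, of_int c) \<in> D" by (auto simp: lattice_points_def)
  have "\<bar>a\<bar> \<le> \<lfloor>R\<rfloor>" "\<bar>c\<bar> \<le> \<lfloor>R\<rfloor>" using assms[OF v(2)] by (simp_all add: le_floor_iff)
  thus "v \<in> {-\<lfloor>R\<rfloor>..\<lfloor>R\<rfloor>} \<times> {-\<lfloor>R\<rfloor>..\<lfloor>R\<rfloor>}" using v by auto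
qed

text \<open>Passing from the area to the number of lattice points is done one coordinate at a time. On every
  vertical line the length of \<open>D\<close> and the number of points with integral second coordinate differ by
  at most one; integrated over \<open>[-R, R]\<close> this compares the area with the total length of the rows at
  integral heights. Each of these at most \<open>2 R + 1\<close> rows in turn has as many integers as its length,
  up to one.\<close>

lemma lattice_points_convex:
  fixes D :: "(real \<times> real) set"
  assumes D: "compact D" "convex D" and R: "R \<ge> 0"
    and box: "\<And>p q. (p, q) \<in> D \<Longrightarrow> \<bar>p\<bar> \<le> R \<and> \<bar>q\<bar> \<le> R"
  shows "\<bar>real (card (lattice_points D)) - measure lborel D\<bar> \<le> 4 * R + 1"
proof -
  define N where "N = \<lfloor>R\<rfloor>"
  have N: "0 \<le> N" "of_int N \<le> R" using R by (auto simp: N_def)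
  have Nin: "n \<in> {-N..N}" if "(x, of_int n) \<in> D" for x n
  proof -
    have "\<bar>n\<bar> \<le> N" using box[OF that] by (simp add: N_def le_floor_iff)
    thus ?thesis by auto
  qed
  define f where "f x = measure lborel {y. (x, y) \<in> D}" for x
  define g where "g x = (\<Sum>n\<in>{-N..N}. indicator {x. (x, of_int n) \<in> D} x :: real)" for x
  define row where "row n = measure lborel {x. (x, of_int n) \<in> D}" for n :: int
  have Dborel[measurable]: "D \<in> sets borel" by (rule borel_closed[OF compact_imp_closed[OF D(1)]])
  have secrow[measurable]: "{x. (x, y) \<in> D} \<in> sets borel" for y
    by (rule borel_closed[OF compact_imp_closed[OF compact_convex_row(1)[OF D]]])
  have seccol: "{y. (x, y) \<in> D} \<in> sets borel" for x
    by (rule borel_closed[OF compact_imp_closed[OF compact_convex_column(1)[OF D]]])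
  have finD: "emeasure lborel D < \<infinity>" using D(1) by (rule emeasure_compact_finite)
  have intD: "integrable (lborel \<Otimes>\<^sub>M lborel) (indicator D :: _ \<Rightarrow> real)"
    unfolding lborel_prod using finD by (intro integrable_real_indicator) auto
  have inner: "(\<integral>y. indicator D (x, y) \<partial>lborel) = f x" for x
  proof -
    have "(\<lambda>y. indicator D (x, y) :: real) = indicator {y. (x, y) \<in> D}" by (auto simp: indicator_def)
    thus ?thesis using seccol by (simp add: f_def)
  qed
  have fint: "integrable lborel f"
    using lborel_pair.integrable_fst'[OF intD] unfolding inner .
  have area: "(\<integral>x. f x \<partial>lborel) = measure lborel D"
    using lborel_pair.integral_fst'[OF intD] unfolding inner by (simp add: lborel_prod)
  have rowfin: "emeasure lborel {x. (x, y) \<in> D} < \<infinity>" for y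
    by (rule emeasure_compact_finite[OF compact_convex_row(1)[OF D]])
  have gint: "integrable lborel g" unfolding g_def
    using rowfin by (intro Bochner_Integration.integrable_sum integrable_real_indicator) auto
  have intg: "(\<integral>x. g x \<partial>lborel) = (\<Sum>n\<in>{-N..N}. row n)" unfolding g_def row_def
    using rowfin by (subst Bochner_Integration.integral_sum) (auto intro!: integrable_real_indicator)
  have fg: "\<bar>f x - g x\<bar> \<le> indicator {-R..R} x" for x
  proof -
    have fin: "finite {n. (x, real_of_int n) \<in> D}"
      using card_integers_in_compact_convex(1)[OF compact_convex_column[OF D, of x]] by simp
    have "g x = real (card {n. (x, real_of_int n) \<in> D})"
    proof -
      have "g x = (\<Sum>n | (x, real_of_int n) \<in> D. 1)"
        unfolding g_def
      proof (rule sum.mono_neutral_cong_right)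
        show "{n. (x, real_of_int n) \<in> D} \<subseteq> {-N..N}" using Nin by blast
      qed auto
      thus ?thesis by simp
    qed
    hence le1: "\<bar>f x - g x\<bar> \<le> 1"
      using card_integers_in_compact_convex(2)[OF compact_convex_column[OF D, of x]]
      by (simp add: f_def)
    have "f x - g x = 0" if "x \<notin> {-R..R}"
    proof -
      have "(x, y) \<notin> D" for y using that box[of x y] by auto
      thus ?thesis by (simp add: f_def g_def)
    qed
    thus ?thesis using le1 by (cases "x \<in> {-R..R}") auto
  qed
  have "\<bar>measure lborel D - (\<Sum>n\<in>{-N..N}. row n)\<bar> = \<bar>\<integral>x. f x - g x \<partial>lborel\<bar>"
    using fint gint area intg by (subst Bochner_Integration.integral_diff) auto
  also have "\<dots> \<le> (\<integral>x. \<bar>f x - g x\<bar> \<partial>lborel)" by (rule integral_abs_bound)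
  also have "\<dots> \<le> (\<integral>x. indicator {-R..R} x \<partial>lborel)"
    using fint gint fg by (intro integral_mono) (auto intro!: integrable_real_indicator simp: emeasure_lborel_Icc_eq)
  also have "\<dots> = 2 * R" using R by (simp add: measure_lborel_Icc)
  finally have 1: "\<bar>measure lborel D - (\<Sum>n\<in>{-N..N}. row n)\<bar> \<le> 2 * R" .

  have rowfin': "finite {a. (real_of_int a, of_int n) \<in> D}" for n :: int
    using card_integers_in_compact_convex(1)[OF compact_convex_row[OF D, of "of_int n"]] by simp
  have "lattice_points D = (\<lambda>(n, a). (a, n)) ` Sigma {-N..N} (\<lambda>n. {a. (of_int a, of_int n) \<in> D})"
  proof (intro equalityI subsetI)
    fix v assume "v \<in> lattice_points D"
    then obtain a n where v: "v = (a, n)" "(of_int a, of_int n) \<in> D" by (auto simp: lattice_points_def)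
    hence "(n, a) \<in> Sigma {-N..N} (\<lambda>n. {a. (of_int a, of_int n) \<in> D})" using Nin by blast
    thus "v \<in> (\<lambda>(n, a). (a, n)) ` Sigma {-N..N} (\<lambda>n. {a. (of_int a, of_int n) \<in> D})"
      unfolding v(1) by (rule rev_image_eqI) simp
  qed (auto simp: lattice_points_def)
  hence "card (lattice_points D) = card (Sigma {-N..N} (\<lambda>n. {a. (real_of_int a, of_int n) \<in> D}))"
    by (simp add: card_image inj_on_def)
  also have "\<dots> = (\<Sum>n\<in>{-N..N}. card {a. (real_of_int a, of_int n) \<in> D})"
    using rowfin' by (subst card_SigmaI) auto
  finally have "\<bar>real (card (lattice_points D)) - (\<Sum>n\<in>{-N..N}. row n)\<bar> =
      \<bar>\<Sum>n\<in>{-N..N}. real (card {a. (real_of_int a, of_int n) \<in> D}) - row n\<bar>"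
    by (simp add: sum_subtractf)
  also have "\<dots> \<le> (\<Sum>n\<in>{-N..N}. \<bar>real (card {a. (real_of_int a, of_int n) \<in> D}) - row n\<bar>)" by (rule sum_abs)
  also have "\<dots> \<le> (\<Sum>n\<in>{-N..N}. 1)"
    unfolding row_def
    using card_integers_in_compact_convex(2)[OF compact_convex_row[OF D]] by (intro sum_mono) auto
  also have "\<dots> \<le> 2 * R + 1" using N by simp
  finally show ?thesis using 1 by linarith
qed

lemma measure_lborel_scale:
  fixes D :: "(real \<times> real) set"
  assumes "compact D" "r \<noteq> 0"
  shows "measure lborel ((*\<^sub>R) r ` D) = r\<^sup>2 * measure lborel D"
proof -
  have c: "compact ((*\<^sub>R) r ` D)" using assms(1) by (rule compact_scaling)
  have "measure lebesgue ((*\<^sub>R) r ` D) = r\<^sup>2 * measure lebesgue D"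
    using measure_lebesgue_affine[of r 0 D] by (simp add: power2_eq_square)
  thus ?thesis using c assms(1) by (simp add: measure_completion borel_closed compact_imp_closed)
qed

section \<open>Primitive lattice points in convex sets\<close>

definition primitive_points :: "(real \<times> real) set \<Rightarrow> (int \<times> int) set" where
  "primitive_points D = {(a, c). coprime a c \<and> (of_int a, of_int c) \<in> D}"

lemma card_multiples_in_lattice_points:
  assumes "d > 0"
  shows "card {(a, c) \<in> lattice_points D. int d dvd a \<and> int d dvd c} =
         card (lattice_points ((*\<^sub>R) (1 / real d) ` D))"
proof (rule bij_betw_same_card[of "\<lambda>(a, c). (a div int d, c div int d)"],
    rule bij_betw_byWitness[where f'="\<lambda>(a, c). (int d * a, int d * c)"])
  show "\<forall>v\<in>{(a, c) \<in> lattice_points D. int d dvd a \<and> int d dvd c}.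
      (\<lambda>(a, c). (int d * a, int d * c)) ((\<lambda>(a, c). (a div int d, c div int d)) v) = v"
    by auto
  show "\<forall>v\<in>lattice_points ((*\<^sub>R) (1 / real d) ` D).
      (\<lambda>(a, c). (a div int d, c div int d)) ((\<lambda>(a, c). (int d * a, int d * c)) v) = v"
    using assms by auto
  show "(\<lambda>(a, c). (a div int d, c div int d)) ` {(a, c) \<in> lattice_points D. int d dvd a \<and> int d dvd c}
      \<subseteq> lattice_points ((*\<^sub>R) (1 / real d) ` D)"
  proof clarify
    fix a c assume "(a, c) \<in> lattice_points D" "int d dvd a" "int d dvd c"
    then obtain a' c' where ac: "a = int d * a'" "c = int d * c'" by (meson dvdE)
    with \<open>(a, c) \<in> lattice_points D\<close> have "(real d * of_int a', real d * of_int c') \<in> D"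
      by (simp add: lattice_points_def)
    thus "(a div int d, c div int d) \<in> lattice_points ((*\<^sub>R) (1 / real d) ` D)"
      using assms ac by (auto simp: lattice_points_def intro!: image_eqI[where x="(real d * of_int a', real d * of_int c')"])
  qed
  show "(\<lambda>(a, c). (int d * a, int d * c)) ` lattice_points ((*\<^sub>R) (1 / real d) ` D)
      \<subseteq> {(a, c) \<in> lattice_points D. int d dvd a \<and> int d dvd c}"
    using assms by (auto simp: lattice_points_def)
qed

text \<open>Moebius inversion over the greatest common divisor. As \<open>D\<close> does not contain the origin, no lattice
  point in \<open>D\<close> has coordinates with a common divisor above \<open>R\<close>.\<close>

lemma card_primitive_points:
  assumes box: "\<And>p q. (p, q) \<in> D \<Longrightarrow> \<bar>p\<bar> \<le> R \<and> \<bar>q\<bar> \<le> R"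
    and 0: "(0, 0) \<notin> D" and R: "R \<ge> 1"
  shows "int (card (primitive_points D)) =
    (\<Sum>d=1..nat \<lfloor>R\<rfloor>. moebius d * int (card (lattice_points ((*\<^sub>R) (1 / real d) ` D))))"
proof -
  define N where "N = nat \<lfloor>R\<rfloor>"
  define L where "L = lattice_points D"
  have Lsub: "L \<subseteq> {-\<lfloor>R\<rfloor>..\<lfloor>R\<rfloor>} \<times> {-\<lfloor>R\<rfloor>..\<lfloor>R\<rfloor>}"
    unfolding L_def by (rule lattice_points_in_box[OF box])
  have L: "finite L" by (rule finite_subset[OF Lsub]) auto
  define G where "G v = nat (gcd (fst v) (snd v))" for v :: "int \<times> int"
  have G: "G v > 0 \<and> G v \<le> N" if "v \<in> L" for v
  proof -
    obtain a c where v: "v = (a, c)" by fastforce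
    have ac: "\<bar>a\<bar> \<le> \<lfloor>R\<rfloor>" "\<bar>c\<bar> \<le> \<lfloor>R\<rfloor>"
      using subsetD[OF Lsub that] unfolding v by auto
    have nz: "a \<noteq> 0 \<or> c \<noteq> 0" using that 0 unfolding L_def v by (auto simp: lattice_points_def)
    have "gcd a c \<le> \<lfloor>R\<rfloor>"
    proof (cases "a = 0")
      case True thus ?thesis using ac by simp
    next
      case False thus ?thesis using ac gcd_le1_int[of a c]
        by (metis abs_of_nonneg dvd_imp_le_int gcd_dvd1 gcd_ge_0_int order_trans)
    qed
    thus ?thesis using nz R by (auto simp: G_def v N_def nat_le_iff)
  qed
  have div: "int d dvd a \<and> int d dvd c \<longleftrightarrow> d dvd G (a, c)" for d a c
  proof -
    have "int d dvd a \<and> int d dvd c \<longleftrightarrow> int d dvd gcd a c" by simp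
    also have "\<dots> \<longleftrightarrow> int d dvd int (nat (gcd a c))" by simp
    also have "\<dots> \<longleftrightarrow> d dvd G (a, c)" unfolding G_def int_dvd_int_iff by simp
    finally show ?thesis .
  qed
  have "(\<Sum>d=1..N. moebius d * int (card (lattice_points ((*\<^sub>R) (1 / real d) ` D)))) =
        (\<Sum>d=1..N. \<Sum>v | v \<in> L \<and> d dvd G v. moebius d)"
  proof (intro sum.cong refl)
    fix d assume d: "d \<in> {1..N}"
    have "{(a, c) \<in> L. int d dvd a \<and> int d dvd c} = {v. v \<in> L \<and> d dvd G v}"
      by (auto simp: div)
    thus "moebius d * int (card (lattice_points ((*\<^sub>R) (1 / real d) ` D))) = (\<Sum>v | v \<in> L \<and> d dvd G v. moebius d)"
      using card_multiples_in_lattice_points[of d D] d by (simp add: L_def)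
  qed
  also have "\<dots> = (\<Sum>v\<in>L. \<Sum>d | d \<in> {1..N} \<and> d dvd G v. moebius d)"
    using L by (subst sum.swap_restrict) auto
  also have "\<dots> = (\<Sum>v\<in>L. if G v = 1 then 1 else 0)"
  proof (intro sum.cong refl)
    fix v assume v: "v \<in> L"
    have "{d. d \<in> {1..N} \<and> d dvd G v} = {d. d dvd G v}"
      using G[OF v] by (auto simp: Suc_le_eq intro: Nat.gr0I dest: dvd_imp_le)
    thus "(\<Sum>d | d \<in> {1..N} \<and> d dvd G v. moebius d) = (if G v = 1 then 1 else 0)"
      using sum_moebius_divisors[of "G v"] G[OF v] by simp
  qed
  also have "\<dots> = int (card {v \<in> L. G v = 1})"
    using L by (simp add: sum.If_cases Int_def)
  also have "{v \<in> L. G v = 1} = primitive_points D"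
    by (auto simp: L_def G_def lattice_points_def primitive_points_def coprime_iff_gcd_eq_1)
  finally show ?thesis by (simp add: N_def)
qed

text \<open>The lattice point count is applied to the sets \<open>D / d\<close>. Summing its errors \<open>4 R / d + 1\<close> over
  \<open>d \<le> R\<close>, and replacing the partial sum of \<open>\<mu>(d) / d\<^sup>2\<close> by \<open>6 / \<pi>\<^sup>2\<close>, both cost \<open>O(R log R)\<close>.\<close>

lemma primitive_points_convex:
  assumes D: "compact D" "convex D"
    and box: "\<And>p q. (p, q) \<in> D \<Longrightarrow> \<bar>p\<bar> \<le> R \<and> \<bar>q\<bar> \<le> R"
    and 0: "(0, 0) \<notin> D" and R: "R \<ge> 1"
  shows "\<bar>real (card (primitive_points D)) - 6 / pi\<^sup>2 * measure lborel D\<bar> \<le> 21 * R * (1 + ln R)"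
proof -
  define N where "N = nat \<lfloor>R\<rfloor>"
  have N: "N \<ge> 1" "real N \<le> R" "R \<le> 2 * real N"
  proof -
    have "1 \<le> \<lfloor>R\<rfloor>" using R by simp
    hence "int N = \<lfloor>R\<rfloor>" by (simp add: N_def)
    with R have "real N \<le> R" "R < real N + 1" "N \<ge> 1" by linarith+
    thus "N \<ge> 1" "real N \<le> R" "R \<le> 2 * real N" using R by linarith+
  qed
  have lnN: "ln (real N) \<le> ln R" using N by (intro ln_mono) auto
  have lnR: "ln R \<ge> 0" using R by simp
  define A where "A = measure lborel D"
  define l where "l d = card (lattice_points ((*\<^sub>R) (1 / real d) ` D))" for d
  have A: "0 \<le> A" "A \<le> 4 * R\<^sup>2"
  proof -
    have "D \<subseteq> {-R..R} \<times> {-R..R}" using box by (force simp: abs_le_iff)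
    hence sub: "D \<subseteq> cbox (-R, -R) (R, R)" by (auto simp: cbox_Pair_eq)
    have "A \<le> measure lborel (cbox (-R, -R) (R, R))" unfolding A_def
      by (rule measure_mono_fmeasurable[OF sub])
         (use D in \<open>auto simp: borel_closed compact_imp_closed\<close>)
    also have "\<dots> = 4 * R\<^sup>2" using R
      by (simp add: measure_lborel_cbox_eq Basis_prod_def power2_eq_square)
    finally show "A \<le> 4 * R\<^sup>2" .
  qed (simp add: A_def)
  have l: "\<bar>real (l d) - A / real d ^ 2\<bar> \<le> 4 * R * (1 / real d) + 1" if d: "d \<in> {1..N}" for d
  proof -
    have d0: "real d > 0" using d by auto
    have "\<bar>real (l d) - measure lborel ((*\<^sub>R) (1 / real d) ` D)\<bar> \<le> 4 * (R / real d) + 1"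
      unfolding l_def
    proof (rule lattice_points_convex)
      show "compact ((*\<^sub>R) (1 / real d) ` D)" "convex ((*\<^sub>R) (1 / real d) ` D)"
        using D by (auto intro: compact_scaling convex_scaling)
      show "\<bar>p\<bar> \<le> R / real d \<and> \<bar>q\<bar> \<le> R / real d" if "(p, q) \<in> (*\<^sub>R) (1 / real d) ` D" for p q
        using that box d0 by (fastforce simp: abs_divide intro!: divide_right_mono)
    qed (use R in auto)
    thus ?thesis using D d0 by (simp add: measure_lborel_scale A_def power_divide)
  qed
  have mu: "\<bar>real_of_int (moebius d)\<bar> \<le> 1" for d using abs_moebius_le[of d] by linarith
  have card: "real (card (primitive_points D)) = (\<Sum>d=1..N. real_of_int (moebius d) * real (l d))"
    using arg_cong[OF card_primitive_points[OF box 0 R], of real_of_int] by (simp add: N_def l_def)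
  have "\<bar>real (card (primitive_points D)) - A * (\<Sum>d=1..N. moebius d / real d ^ 2)\<bar> =
        \<bar>\<Sum>d=1..N. real_of_int (moebius d) * (real (l d) - A / real d ^ 2)\<bar>"
    unfolding card by (simp add: sum_distrib_left right_diff_distrib sum_subtractf mult_ac)
  also have "\<dots> \<le> (\<Sum>d=1..N. \<bar>real_of_int (moebius d) * (real (l d) - A / real d ^ 2)\<bar>)" by (rule sum_abs)
  also have "\<dots> \<le> (\<Sum>d=1..N. 4 * R * (1 / real d) + 1)"
  proof (rule sum_mono)
    fix d assume d: "d \<in> {1..N}"
    have "\<bar>real_of_int (moebius d) * (real (l d) - A / real d ^ 2)\<bar> \<le> 1 * (4 * R * (1 / real d) + 1)"
      unfolding abs_mult by (intro mult_mono mu l[OF d]) auto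
    thus "\<bar>real_of_int (moebius d) * (real (l d) - A / real d ^ 2)\<bar> \<le> 4 * R * (1 / real d) + 1" by simp
  qed
  also have "\<dots> = 4 * R * (\<Sum>d=1..N. 1 / real d) + real N"
    by (simp add: sum.distrib sum_distrib_left)
  also have "\<dots> \<le> 4 * R * (1 + ln R) + R"
  proof -
    have "(\<Sum>d=1..N. 1 / real d) \<le> 1 + ln R" using harmonic_le[OF N(1)] lnN by linarith
    thus ?thesis using N R by (intro add_mono mult_left_mono) auto
  qed
  also have "\<dots> \<le> 5 * R * (1 + ln R)" using R lnR by (simp add: algebra_simps)
  finally have 1: "\<bar>real (card (primitive_points D)) - A * (\<Sum>d=1..N. moebius d / real d ^ 2)\<bar> \<le> 5 * R * (1 + ln R)" .
  have "\<bar>A * (\<Sum>d=1..N. moebius d / real d ^ 2) - 6 / pi\<^sup>2 * A\<bar> = A * \<bar>(\<Sum>d=1..N. moebius d / real d ^ 2) - 6 / pi\<^sup>2\<bar>"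
  proof -
    have "A * x - 6 / pi\<^sup>2 * A = A * (x - 6 / pi\<^sup>2)" for x by (simp add: algebra_simps)
    thus ?thesis using A(1) by (simp only: abs_mult abs_of_nonneg)
  qed
  also have "\<dots> \<le> (4 * R\<^sup>2) * (2 * (1 + ln (real N)) / real N)"
    using A sum_moebius_over_squares[OF N(1)] by (intro mult_mono) auto
  also have "\<dots> \<le> (4 * R\<^sup>2) * (2 * (1 + ln R) / (R / 2))"
    using N R lnN lnR by (intro mult_left_mono frac_le) auto
  also have "\<dots> = 16 * R * (1 + ln R)" using R by (simp add: power2_eq_square)
  finally show ?thesis using 1 unfolding A_def by (simp add: algebra_simps)
qed

section \<open>Frames and the modular group\<close>

definition frame :: "real^2^2 \<Rightarrow> complex \<times> complex" where
  "frame A = tangent_act A (\<i>, cis pi)"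

lemma base_vector_in_T1H: "(\<i>, cis pi) \<in> T1H"
  by (simp add: T1H_def)

lemma frame_in_T1H: "A \<in> SL2R \<Longrightarrow> frame A \<in> T1H"
  unfolding frame_def by (rule tangent_act_in[OF _ base_vector_in_T1H])

lemma frame_mult: "A \<in> SL2R \<Longrightarrow> B \<in> SL2R \<Longrightarrow> frame (A ** B) = tangent_act A (frame B)"
  unfolding frame_def by (rule tangent_act_mult[OF _ _ base_vector_in_T1H])

lemma frame_eq_iff:
  assumes "A \<in> SL2R" "B \<in> SL2R"
  shows "frame A = frame B \<longleftrightarrow> A = B \<or> A = - B"
  using tangent_act_free[OF assms] tangent_act_uminus[OF assms(2) base_vector_in_T1H]
  unfolding frame_def by blast

lemma frame_surj: "v \<in> T1H \<Longrightarrow> \<exists>A\<in>SL2R. v = frame A"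
  unfolding frame_def using tangent_act_transitive by blast

lemma frame_coordinates:
  assumes "A \<in> SL2R"
  shows "frame A =
    (Complex ((A$1$1 * A$2$1 + A$1$2 * A$2$2) / ((A$2$1)\<^sup>2 + (A$2$2)\<^sup>2)) (1 / ((A$2$1)\<^sup>2 + (A$2$2)\<^sup>2)),
     - (Complex (A$2$2) (- A$2$1) / Complex (A$2$2) (A$2$1)))"
proof -
  have cof: "cofactor A \<i> = Complex (A$2$2) (A$2$1)" by (simp add: complex_eq_iff)
  have num: "of_real (A$1$1) * \<i> + of_real (A$1$2) = Complex (A$1$2) (A$1$1)" by (simp add: complex_eq_iff)
  have d: "A$1$1 * A$2$2 - A$1$2 * A$2$1 = 1" using assms by (simp add: SL2R_def det_2)
  have "Complex (A$1$2) (A$1$1) / Complex (A$2$2) (A$2$1) =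
    Complex ((A$1$1 * A$2$1 + A$1$2 * A$2$2) / ((A$2$1)\<^sup>2 + (A$2$2)\<^sup>2)) (1 / ((A$2$1)\<^sup>2 + (A$2$2)\<^sup>2))"
    unfolding complex_eq_iff using d by (simp add: Re_divide Im_divide add.commute)
  thus ?thesis
    using tangent_act_eq[OF assms, of \<i> "cis pi"] unfolding frame_def cof num by (simp add: complex_cnj)
qed

text \<open>The adjugate, which is the inverse for matrices of determinant one.\<close>

definition adj :: "real^2^2 \<Rightarrow> real^2^2" where
  "adj A = vector [vector [A$2$2, - A$1$2], vector [- A$2$1, A$1$1]]"

lemma adj_entries [simp]:
  "adj A $ 1 $ 1 = A$2$2" "adj A $ 1 $ 2 = - A$1$2" "adj A $ 2 $ 1 = - A$2$1" "adj A $ 2 $ 2 = A$1$1"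
  by (simp_all add: adj_def)

lemma adj_adj [simp]: "adj (adj A) = A"
  by (simp add: vec_eq_iff forall_2)

lemma adj_SL2R: "A \<in> SL2R \<Longrightarrow> adj A \<in> SL2R"
  by (simp add: SL2R_def det_2 mult.commute)

lemma matrix_mult_entries:
  fixes A B :: "real^2^2"
  shows "(A ** B) $ i $ j = A$i$1 * B$1$j + A$i$2 * B$2$j"
  by (simp add: matrix_matrix_mult_def sum_2)

lemma adj_mult: "A \<in> SL2R \<Longrightarrow> adj A ** A = mat 1" "A \<in> SL2R \<Longrightarrow> A ** adj A = mat 1"
  by (auto simp add: SL2R_def det_2 vec_eq_iff forall_2 matrix_mult_entries mat_def mult.commute)

lemma SL2Z_SL2R: "A \<in> SL2Z \<Longrightarrow> A \<in> SL2R"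
  by (simp add: SL2Z_def)

lemma SL2Z_mult: "A \<in> SL2Z \<Longrightarrow> B \<in> SL2Z \<Longrightarrow> A ** B \<in> SL2Z"
  by (auto simp: SL2Z_def SL2R_mult matrix_mult_entries)

lemma SL2Z_adj: "A \<in> SL2Z \<Longrightarrow> adj A \<in> SL2Z"
  by (auto simp: SL2Z_def adj_SL2R forall_2)

lemma SL2Z_one: "mat 1 \<in> SL2Z"
  by (auto simp: SL2Z_def SL2R_def mat_def det_2)

lemma SL2Z_uminus: "A \<in> SL2Z \<Longrightarrow> - A \<in> SL2Z"
  by (auto simp: SL2Z_def SL2R_def det_2)

lemma SL2R_nonzero: "A \<in> SL2R \<Longrightarrow> A \<noteq> - A"
proof
  assume "A \<in> SL2R" "A = - A"
  hence "A $ i $ j = - A $ i $ j" for i j by (metis vector_uminus_component)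
  hence "A $ i $ j = 0" for i j by (smt (verit))
  with \<open>A \<in> SL2R\<close> show False by (simp add: SL2R_def det_2)
qed

definition int_matrix :: "int \<Rightarrow> int \<Rightarrow> int \<Rightarrow> int \<Rightarrow> real^2^2" where
  "int_matrix a b c d = vector [vector [of_int a, of_int b], vector [of_int c, of_int d]]"

lemma int_matrix_entries [simp]:
  "int_matrix a b c d $ 1 $ 1 = of_int a" "int_matrix a b c d $ 1 $ 2 = of_int b"
  "int_matrix a b c d $ 2 $ 1 = of_int c" "int_matrix a b c d $ 2 $ 2 = of_int d"
  by (simp_all add: int_matrix_def)

lemma int_matrix_in_SL2Z: "int_matrix a b c d \<in> SL2Z \<longleftrightarrow> a * d - b * c = 1"
proof -
  have "int_matrix a b c d \<in> SL2Z \<longleftrightarrow> real_of_int (a * d - b * c) = of_int 1"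
    by (simp add: SL2Z_def SL2R_def det_2 forall_2)
  thus ?thesis unfolding of_int_eq_iff .
qed

lemma SL2Z_cases:
  assumes "A \<in> SL2Z"
  obtains a b c d where "A = int_matrix a b c d" "a * d - b * c = 1"
proof -
  have "\<exists>n. A $ i $ j = of_int n" for i j using assms unfolding SL2Z_def Ints_def by auto
  then obtain a b c d where "A$1$1 = of_int a" "A$1$2 = of_int b" "A$2$1 = of_int c" "A$2$2 = of_int d"
    by metis
  hence A: "A = int_matrix a b c d" by (simp add: vec_eq_iff forall_2)
  thus ?thesis using that int_matrix_in_SL2Z assms by blast
qed

lemma countable_SL2Z: "countable SL2Z"
proof -
  have "SL2Z \<subseteq> range (\<lambda>(a, b, c, d). int_matrix a b c d)"
  proof
    fix A assume "A \<in> SL2Z"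
    then obtain a b c d where "A = int_matrix a b c d" by (rule SL2Z_cases)
    thus "A \<in> range (\<lambda>(a, b, c, d). int_matrix a b c d)"
      by (intro range_eqI[of _ _ "(a, b, c, d)"]) simp
  qed
  thus ?thesis by (meson countable_image countable_subset countableI_type)
qed

lemma tangent_act_one: "tangent_act (mat 1) v = v"
  by (cases v) (simp add: tangent_act_def mat_def)

lemma tangent_act_adj:
  assumes "A \<in> SL2R" "v \<in> T1H"
  shows "tangent_act (adj A) (tangent_act A v) = v" "tangent_act A (tangent_act (adj A) v) = v"
  using tangent_act_mult[OF adj_SL2R[OF assms(1)] assms] tangent_act_mult[OF assms(1) adj_SL2R[OF assms(1)] assms(2)]
    adj_mult[OF assms(1)] by (simp_all add: tangent_act_one)

lemma tangent_act_free_T1H: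
  assumes "A \<in> SL2R" "B \<in> SL2R" "v \<in> T1H" "tangent_act A v = tangent_act B v"
  shows "A = B \<or> A = - B"
proof -
  obtain V where V: "V \<in> SL2R" "v = frame V" using frame_surj assms(3) by blast
  have "frame (A ** V) = frame (B ** V)" using assms V by (simp add: frame_mult)
  hence "A ** V = B ** V \<or> A ** V = - (B ** V)"
    using frame_eq_iff[OF SL2R_mult[OF assms(1) V(1)] SL2R_mult[OF assms(2) V(1)]] by simp
  hence "A ** V = B ** V \<or> A ** V = (- B) ** V"
    by (auto simp: vec_eq_iff forall_2 matrix_mult_entries)
  hence "A ** V ** adj V = B ** V ** adj V \<or> A ** V ** adj V = (- B) ** V ** adj V" by auto
  thus ?thesis using adj_mult[OF V(1)] by (simp add: matrix_mul_assoc[symmetric] matrix_mul_rid)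
qed

lemma proj_tangent_act:
  assumes "A \<in> SL2Z" "v \<in> T1H" shows "proj (tangent_act A v) = proj v"
proof (intro equalityI subsetI)
  fix w assume "w \<in> proj (tangent_act A v)"
  then obtain B where B: "B \<in> SL2Z" "w = tangent_act B (tangent_act A v)" by (auto simp: proj_def)
  hence "w = tangent_act (B ** A) v" using assms by (simp add: tangent_act_mult SL2Z_SL2R)
  thus "w \<in> proj v" using SL2Z_mult[OF B(1) assms(1)] by (auto simp: proj_def)
next
  fix w assume "w \<in> proj v"
  then obtain B where B: "B \<in> SL2Z" "w = tangent_act B v" by (auto simp: proj_def)
  hence "w = tangent_act B (tangent_act (adj A) (tangent_act A v))"
    using assms by (simp add: tangent_act_adj SL2Z_SL2R)
  also have "\<dots> = tangent_act (B ** adj A) (tangent_act A v)"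
    using assms B by (subst tangent_act_mult) (auto simp: SL2Z_SL2R SL2Z_adj tangent_act_in)
  finally show "w \<in> proj (tangent_act A v)"
    using SL2Z_mult[OF B(1) SL2Z_adj[OF assms(1)]] by (auto simp: proj_def)
qed

lemma proj_in_image_iff:
  assumes "v \<in> T1H" "S \<subseteq> T1H"
  shows "proj v \<in> proj ` S \<longleftrightarrow> (\<exists>A\<in>SL2Z. tangent_act A v \<in> S)"
proof
  assume "proj v \<in> proj ` S"
  then obtain w where w: "w \<in> S" "proj v = proj w" by auto
  have "w \<in> proj w" unfolding proj_def using SL2Z_one by (rule rev_image_eqI) (simp add: tangent_act_one)
  hence "w \<in> proj v" using w by simp
  thus "\<exists>A\<in>SL2Z. tangent_act A v \<in> S" using w(1) by (auto simp: proj_def)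
next
  assume "\<exists>A\<in>SL2Z. tangent_act A v \<in> S"
  then obtain A where "A \<in> SL2Z" "tangent_act A v \<in> S" by blast
  thus "proj v \<in> proj ` S" using proj_tangent_act[OF _ assms(1)] by (metis imageI)
qed

text \<open>The unfolding identity. The stabilizer in \<open>SL2Z\<close> of a vector is \<open>{1, -1}\<close>, so if \<open>proj\<close> is injective
  on \<open>S\<close>, then an orbit that meets \<open>S\<close> does so for exactly two group elements. It is applied to
  lifted boxes and to the modular domain.\<close>

lemma nn_integral_orbit_visits:
  assumes v: "v \<in> T1H" and S: "S \<subseteq> T1H" and inj: "inj_on proj S"
  shows "(\<integral>\<^sup>+A. indicator S (tangent_act A v) \<partial>count_space SL2Z) = 2 * indicator (proj ` S) (proj v)"
proof (cases "proj v \<in> proj ` S")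
  case True
  then obtain A where A: "A \<in> SL2Z" "tangent_act A v \<in> S"
    using proj_in_image_iff[OF v S] by blast
  have eq: "{B \<in> SL2Z. tangent_act B v \<in> S} = {A, - A}"
  proof (intro equalityI subsetI)
    fix B assume "B \<in> {B \<in> SL2Z. tangent_act B v \<in> S}"
    hence B: "B \<in> SL2Z" "tangent_act B v \<in> S" by auto
    have "proj (tangent_act B v) = proj (tangent_act A v)" using A B v by (simp add: proj_tangent_act)
    hence "tangent_act B v = tangent_act A v" using inj A B by (auto dest: inj_onD)
    thus "B \<in> {A, - A}" using tangent_act_free_T1H[OF _ _ v] A B SL2Z_SL2R by blast
  next
    fix B assume "B \<in> {A, - A}"
    thus "B \<in> {B \<in> SL2Z. tangent_act B v \<in> S}"
      using A SL2Z_uminus tangent_act_uminus[OF SL2Z_SL2R[OF A(1)] v] by auto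
  qed
  have "(\<integral>\<^sup>+B. indicator S (tangent_act B v) \<partial>count_space SL2Z) =
        (\<integral>\<^sup>+B. indicator {B \<in> SL2Z. tangent_act B v \<in> S} B \<partial>count_space SL2Z)"
    by (intro nn_integral_cong) (auto simp: indicator_def)
  also have "\<dots> = emeasure (count_space SL2Z) {A, - A}"
    using A SL2Z_uminus by (subst nn_integral_indicator) (auto simp: eq)
  also have "\<dots> = of_nat (card {A, - A})" using A SL2Z_uminus by (intro emeasure_count_space_finite) auto
  also have "card {A, - A} = 2" using SL2R_nonzero[OF SL2Z_SL2R[OF A(1)]] by simp
  finally show ?thesis using True by simp
next
  case False
  hence "tangent_act A v \<notin> S" if "A \<in> SL2Z" for A using that proj_in_image_iff[OF v S] by blast
  hence "(\<integral>\<^sup>+A. indicator S (tangent_act A v) \<partial>count_space SL2Z) = (\<integral>\<^sup>+A. 0 \<partial>count_space SL2Z)"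
    by (intro nn_integral_cong) auto
  thus ?thesis using False by simp
qed

section \<open>Proper discontinuity\<close>

text \<open>On \<open>frame A\<close> this is the squared Frobenius norm of \<open>A\<close>. It is the means to control group elements
  by the vectors that they move.\<close>

definition height_norm :: "complex \<times> complex \<Rightarrow> real" where
  "height_norm v = ((norm (fst v))\<^sup>2 + 1) / Im (fst v)"

lemma height_norm_frame:
  assumes "A \<in> SL2R"
  shows "height_norm (frame A) = (A$1$1)\<^sup>2 + (A$1$2)\<^sup>2 + (A$2$1)\<^sup>2 + (A$2$2)\<^sup>2"
proof -
  define a b c d where abcd: "a = A$1$1" "b = A$1$2" "c = A$2$1" "d = A$2$2"
  have det: "a * d - b * c = 1" using assms by (simp add: SL2R_def det_2 abcd)
  define r where "r = c\<^sup>2 + d\<^sup>2"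
  have "c \<noteq> 0 \<or> d \<noteq> 0" using det by auto
  hence r: "r > 0" by (simp add: r_def sum_power2_gt_zero_iff)
  have "(a * c + b * d)\<^sup>2 + (a * d - b * c)\<^sup>2 = (a\<^sup>2 + b\<^sup>2) * r"
    by (simp add: r_def power2_eq_square algebra_simps)
  hence key: "(a * c + b * d)\<^sup>2 + 1 = (a\<^sup>2 + b\<^sup>2) * r" using det by simp
  have "height_norm (frame A) = (((a * c + b * d) / r)\<^sup>2 + (1 / r)\<^sup>2 + 1) / (1 / r)"
    unfolding height_norm_def frame_coordinates[OF assms] abcd r_def by (simp add: cmod_power2)
  also have "\<dots> = ((a * c + b * d)\<^sup>2 + 1) / r + r"
    using r by (simp add: field_simps power2_eq_square)
  also have "\<dots> = a\<^sup>2 + b\<^sup>2 + r" unfolding key using r by simp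
  finally show ?thesis by (simp add: abcd r_def)
qed

lemma continuous_on_height_norm: "continuous_on T1H height_norm"
  unfolding height_norm_def by (intro continuous_intros) (auto simp: T1H_def)

definition visits :: "real \<Rightarrow> (real^2^2) set" where
  "visits R = {A \<in> SL2Z. \<exists>v\<in>T1H. height_norm v \<le> R \<and> height_norm (tangent_act A v) \<le> R}"

text \<open>If \<open>v = frame V\<close>, then \<open>A\<close> moves \<open>v\<close> to \<open>frame B\<close> for \<open>B = A V\<close>. The integral entries of \<open>A = B V\<^sup>-\<^sup>1\<close>
  are bounded in terms of those of \<open>B\<close> and \<open>V\<close>, which the norms of the two vectors control.\<close>

lemma finite_visits: "finite (visits R)"
proof (rule finite_subset)
  define N where "N = \<lceil>2 * R\<rceil>"
  show "finite ((\<lambda>(a, b, c, d). int_matrix a b c d) ` ({-N..N} \<times> {-N..N} \<times> {-N..N} \<times> {-N..N}))" by simp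
  show "visits R \<subseteq>
    (\<lambda>(a, b, c, d). int_matrix a b c d) ` ({-N..N} \<times> {-N..N} \<times> {-N..N} \<times> {-N..N})"
    unfolding visits_def
  proof clarify
    fix A z u assume A: "A \<in> SL2Z" and zu: "(z, u) \<in> T1H" "height_norm (z, u) \<le> R" "height_norm (tangent_act A (z, u)) \<le> R"
    obtain V where V: "V \<in> SL2R" "(z, u) = frame V" using frame_surj zu by blast
    define B where "B = A ** V"
    have B: "B \<in> SL2R" using A V by (simp add: B_def SL2R_mult SL2Z_SL2R)
    have "tangent_act A (z, u) = frame B" using A V by (simp add: B_def frame_mult SL2Z_SL2R)
    hence nB: "(B$1$1)\<^sup>2 + (B$1$2)\<^sup>2 + (B$2$1)\<^sup>2 + (B$2$2)\<^sup>2 \<le> R"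
      and nV: "(V$1$1)\<^sup>2 + (V$1$2)\<^sup>2 + (V$2$1)\<^sup>2 + (V$2$2)\<^sup>2 \<le> R"
      using zu B V by (auto simp: height_norm_frame)
    have AB: "A = B ** adj V"
      using adj_mult[OF V(1)] by (simp add: B_def matrix_mul_assoc[symmetric] matrix_mul_rid)
    have sq: "\<bar>p * q - r * s\<bar> \<le> 2 * R" if "p\<^sup>2 \<le> R" "q\<^sup>2 \<le> R" "r\<^sup>2 \<le> R" "s\<^sup>2 \<le> R" for p q r s
    proof -
      have "\<bar>x * y\<bar> \<le> (x\<^sup>2 + y\<^sup>2) / 2" for x y :: real
      proof -
        have "0 \<le> (x - y)\<^sup>2" "0 \<le> (x + y)\<^sup>2" by simp_all
        thus ?thesis by (simp add: power2_eq_square algebra_simps abs_le_iff)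
      qed
      note amgm = this
      have "(p\<^sup>2 + q\<^sup>2) / 2 \<le> R" "(r\<^sup>2 + s\<^sup>2) / 2 \<le> R" using that by auto
      hence "\<bar>p * q\<bar> \<le> R" "\<bar>r * s\<bar> \<le> R"
        using order_trans[OF amgm] by blast+
      hence "\<bar>p * q\<bar> + \<bar>r * s\<bar> \<le> 2 * R" by simp
      thus ?thesis by (rule order_trans[OF abs_triangle_ineq4])
    qed
    have nn: "0 \<le> x\<^sup>2" for x :: real by simp
    have eB: "(B$1$1)\<^sup>2 \<le> R" "(B$1$2)\<^sup>2 \<le> R" "(B$2$1)\<^sup>2 \<le> R" "(B$2$2)\<^sup>2 \<le> R"
      using nB nn[of "B$1$1"] nn[of "B$1$2"] nn[of "B$2$1"] nn[of "B$2$2"] by linarith+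
    have eV: "(V$1$1)\<^sup>2 \<le> R" "(V$1$2)\<^sup>2 \<le> R" "(V$2$1)\<^sup>2 \<le> R" "(V$2$2)\<^sup>2 \<le> R"
      using nV nn[of "V$1$1"] nn[of "V$1$2"] nn[of "V$2$1"] nn[of "V$2$2"] by linarith+
    obtain a b c d where abcd: "A = int_matrix a b c d" using A by (rule SL2Z_cases)
    have "A$1$1 = B$1$1 * V$2$2 - B$1$2 * V$2$1" "A$1$2 = B$1$2 * V$1$1 - B$1$1 * V$1$2"
      "A$2$1 = B$2$1 * V$2$2 - B$2$2 * V$2$1" "A$2$2 = B$2$2 * V$1$1 - B$2$1 * V$1$2"
      by (simp_all add: AB matrix_mult_entries)
    hence "\<bar>A$1$1\<bar> \<le> 2 * R" "\<bar>A$1$2\<bar> \<le> 2 * R" "\<bar>A$2$1\<bar> \<le> 2 * R" "\<bar>A$2$2\<bar> \<le> 2 * R"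
      using sq eB eV by metis+
    moreover have "\<bar>n\<bar> \<le> N" if "\<bar>real_of_int n\<bar> \<le> 2 * R" for n
      using that le_of_int_ceiling[of "2 * R"] unfolding N_def by linarith
    ultimately have "\<bar>a\<bar> \<le> N" "\<bar>b\<bar> \<le> N" "\<bar>c\<bar> \<le> N" "\<bar>d\<bar> \<le> N"
      unfolding abcd int_matrix_entries by blast+
    hence "(a, b, c, d) \<in> {-N..N} \<times> {-N..N} \<times> {-N..N} \<times> {-N..N}" by auto
    thus "A \<in> (\<lambda>(a, b, c, d). int_matrix a b c d) ` ({-N..N} \<times> {-N..N} \<times> {-N..N} \<times> {-N..N})"
      unfolding abcd by (rule rev_image_eqI) simp
  qed
qed

lemma continuous_on_tangent_act:
  assumes "A \<in> SL2R" shows "continuous_on T1H (tangent_act A)"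
proof -
  have nz: "cofactor A (fst v) \<noteq> 0" if "v \<in> T1H" for v
    using that cofactor_nz[OF assms] by (auto simp: T1H_def)
  have "continuous_on T1H (\<lambda>v. ((of_real (A$1$1) * fst v + of_real (A$1$2)) / cofactor A (fst v),
           snd v * (cnj (cofactor A (fst v)) / cofactor A (fst v))))"
    using nz by (intro continuous_intros) auto
  thus ?thesis
    by (rule continuous_on_eq) (use tangent_act_eq[OF assms] in \<open>auto simp: T1H_def\<close>)
qed

lemma openin_preimage_T1H:
  assumes "continuous_on T1H f" "open U"
  shows "openin (top_of_set T1H) {v \<in> T1H. f v \<in> U}"
  using continuous_openin_preimage_gen[OF assms] by (simp add: vimage_def Int_def)

lemma height_norm_bounded:
  assumes "compact K" "K \<subseteq> T1H"
  obtains b where "\<And>v. v \<in> K \<Longrightarrow> height_norm v \<le> b"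
proof -
  have "bounded (height_norm ` K)"
    by (rule compact_imp_bounded[OF compact_continuous_image[OF continuous_on_subset[OF continuous_on_height_norm assms(2)] assms(1)]])
  then obtain b where "\<forall>v\<in>K. \<bar>height_norm v\<bar> \<le> b" by (auto simp: bounded_iff)
  thus ?thesis using that abs_le_D1 by blast
qed

text \<open>On the open set of vectors of \<open>height_norm\<close> below \<open>R\<close>, only finitely many group elements can move a
  vector into \<open>K\<close>. So the condition is locally a finite intersection of open conditions.\<close>

lemma openin_not_visiting_compact:
  assumes K: "compact K" "K \<subseteq> T1H"
  shows "openin (top_of_set T1H) {v \<in> T1H. \<forall>A\<in>SL2Z. tangent_act A v \<notin> K}"
proof -
  obtain b where b: "\<And>v. v \<in> K \<Longrightarrow> height_norm v \<le> b" using height_norm_bounded[OF K] by blast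
  \<comment> \<open>For \<open>v\<close> with \<open>height_norm v < R\<close>, an element that moves \<open>v\<close> into \<open>K\<close> lies in \<open>visits (max R b)\<close>.\<close>
  define U where "U R = {v \<in> T1H. height_norm v < R} \<inter>
    (\<Inter>A\<in>visits (max R b).
       {v \<in> T1H. tangent_act A v \<in> - K}) \<inter> T1H" for R
  have "openin (top_of_set T1H) (U R)" for R
  proof -
    have o1: "openin (top_of_set T1H) {v \<in> T1H. height_norm v < R}"
      using openin_preimage_T1H[OF continuous_on_height_norm, of "{..<R}"] by simp
    have "openin (top_of_set T1H) {v \<in> T1H. tangent_act A v \<in> - K}" if "A \<in> SL2Z" for A
      using that K by (intro openin_preimage_T1H continuous_on_tangent_act) (auto simp: SL2Z_SL2R compact_imp_closed)
    hence "openin (top_of_set T1H) ((\<Inter>A\<in>visits (max R b).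
       {v \<in> T1H. tangent_act A v \<in> - K}) \<inter> topspace (top_of_set T1H))"
      by (intro openin_INT finite_visits) (auto simp: visits_def)
    thus ?thesis unfolding U_def Int_assoc topspace_euclidean_subtopology
      by (rule openin_Int[OF o1])
  qed
  hence "openin (top_of_set T1H) (\<Union>R. U R)" by blast
  also have "(\<Union>R. U R) = {v \<in> T1H. \<forall>A\<in>SL2Z. tangent_act A v \<notin> K}"
  proof (intro equalityI subsetI)
    fix v assume "v \<in> (\<Union>R. U R)"
    then obtain R where R: "v \<in> U R" by blast
    have "tangent_act A v \<notin> K" if A: "A \<in> SL2Z" for A
    proof
      assume inK: "tangent_act A v \<in> K"
      have "height_norm v \<le> max R b" "height_norm (tangent_act A v) \<le> max R b" "v \<in> T1H"
        using R b[OF inK] by (auto simp: U_def)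
      hence "tangent_act A v \<in> - K" using R A unfolding U_def visits_def by blast
      thus False using inK by simp
    qed
    thus "v \<in> {v \<in> T1H. \<forall>A\<in>SL2Z. tangent_act A v \<notin> K}" using R by (auto simp: U_def)
  next
    fix v assume v: "v \<in> {v \<in> T1H. \<forall>A\<in>SL2Z. tangent_act A v \<notin> K}"
    have "v \<in> U (height_norm v + 1)" using v unfolding U_def visits_def by auto
    thus "v \<in> (\<Union>R. U R)" by blast
  qed
  finally show ?thesis .
qed

text \<open>The image is closed in \<open>M\<close>. In particular the measure of a box is not the default value \<open>0\<close> of sets
  outside the sigma-algebra.\<close>

lemma proj_compact_measurable:
  assumes K: "compact K" "K \<subseteq> T1H"
  shows "proj ` K \<in> sets M_borel"
proof -
  have sub: "{U. U \<subseteq> M_points \<and> openin (top_of_set T1H) {v \<in> T1H. proj v \<in> U}} \<subseteq> Pow M_points" by blast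
  have "{v \<in> T1H. proj v \<in> M_points - proj ` K} = {v \<in> T1H. \<forall>A\<in>SL2Z. tangent_act A v \<notin> K}"
    using proj_in_image_iff[OF _ K(2)] by (auto simp: M_points_def)
  hence "M_points - proj ` K \<in> sets M_borel"
    using openin_not_visiting_compact[OF K] unfolding M_borel_def
    by (subst sets_measure_of[OF sub]) (auto intro!: sigma_sets.Basic)
  hence "space M_borel - (M_points - proj ` K) \<in> sets M_borel" by (rule sets.compl_sets)
  moreover have "space M_borel = M_points" unfolding M_borel_def by (rule space_measure_of[OF sub])
  moreover have "M_points - (M_points - proj ` K) = proj ` K" using K(2) by (auto simp: M_points_def)
  ultimately show ?thesis by simp
qed

lemma connected_subset_disjoint_closed_family:
  assumes S: "connected S" and F: "finite F" "\<And>T. T \<in> F \<Longrightarrow> closed T" "S \<subseteq> \<Union>F"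
    and disj: "\<And>T T'. T \<in> F \<Longrightarrow> T' \<in> F \<Longrightarrow> T \<inter> T' \<noteq> {} \<Longrightarrow> T = T'"
    and x: "x \<in> S" "x \<in> T" "T \<in> F"
  shows "S \<subseteq> T"
proof -
  have cl: "closed T" "closed (\<Union>(F - {T}))" using F x by auto
  have "T \<inter> \<Union>(F - {T}) \<inter> S = {}" using disj x by blast
  moreover have "S \<subseteq> T \<union> \<Union>(F - {T})" using F by blast
  ultimately have "T \<inter> S = {} \<or> \<Union>(F - {T}) \<inter> S = {}"
    using S cl unfolding connected_closed by blast
  thus ?thesis using x F by blast
qed

text \<open>The translates of \<open>K\<close> are pairwise disjoint or equal because \<open>proj\<close> is injective on \<open>K\<close>, and only
  finitely many of them meet the compact set \<open>K'\<close>. A connected set covered by finitely many disjoint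
  closed sets lies in one of them.\<close>

lemma connected_lift_in_one_translate:
  assumes K: "compact K" "K \<subseteq> T1H" "inj_on proj K"
    and K': "compact K'" "K' \<subseteq> T1H" "connected K'" "K' \<noteq> {}"
    and sub: "proj ` K' \<subseteq> proj ` K"
  shows "\<exists>A\<in>SL2Z. \<forall>v\<in>K'. tangent_act A v \<in> K"
proof -
  obtain b1 where b1: "\<And>v. v \<in> K \<Longrightarrow> height_norm v \<le> b1" using height_norm_bounded[OF K(1,2)] by blast
  obtain b2 where b2: "\<And>v. v \<in> K' \<Longrightarrow> height_norm v \<le> b2" using height_norm_bounded[OF K'(1,2)] by blast
  define b where "b = max b1 b2"
  define G where "G = visits b"
  define F where "F = (\<lambda>A. tangent_act A ` K) ` G"
  have finF: "finite F" unfolding F_def G_def by (intro finite_imageI finite_visits)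
  have clF: "closed T" if TF: "T \<in> F" for T
  proof -
    obtain A where "T = tangent_act A ` K" "A \<in> G" using TF unfolding F_def by (rule imageE)
    hence A: "A \<in> SL2Z" "T = tangent_act A ` K" by (auto simp: G_def visits_def)
    have "continuous_on K (tangent_act A)"
      using continuous_on_subset[OF continuous_on_tangent_act K(2)] A SL2Z_SL2R by blast
    thus ?thesis using A K(1) by (simp add: compact_continuous_image compact_imp_closed)
  qed
  have cov: "\<exists>A\<in>G. v \<in> tangent_act A ` K" if v: "v \<in> K'" for v
  proof -
    have "proj v \<in> proj ` K" using sub v by blast
    then obtain A where A: "A \<in> SL2Z" "tangent_act A v \<in> K"
      using proj_in_image_iff[of v K] K K' v by blast
    have vT: "v \<in> T1H" using K' v by blast
    have ret: "tangent_act (adj A) (tangent_act A v) = v" using tangent_act_adj vT A SL2Z_SL2R by blast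
    have "tangent_act A v \<in> T1H" "height_norm (tangent_act A v) \<le> b" "height_norm v \<le> b"
      using A(2) K(2) b1[OF A(2)] b2[OF v] by (auto simp: b_def)
    hence "adj A \<in> G" unfolding G_def visits_def mem_Collect_eq using SL2Z_adj[OF A(1)] ret by metis
    thus ?thesis using ret A by (metis imageI)
  qed
  have disj: "T = T'" if T: "T \<in> F" "T' \<in> F" "T \<inter> T' \<noteq> {}" for T T'
  proof -
    obtain A A' where A: "A \<in> SL2Z" "T = tangent_act A ` K" "A' \<in> SL2Z" "T' = tangent_act A' ` K"
      using T unfolding F_def G_def visits_def by blast
    then obtain v v' where v: "v \<in> K" "v' \<in> K" "tangent_act A v = tangent_act A' v'" using T by blast
    have vT: "v \<in> T1H" "v' \<in> T1H" using v K by auto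
    have "proj v = proj v'" using v A vT proj_tangent_act by metis
    hence "v = v'" using K v by (auto dest: inj_onD)
    hence "A = A' \<or> A = - A'" using tangent_act_free_T1H[of A A' v] v A vT SL2Z_SL2R by blast
    thus ?thesis
    proof
      assume "A = - A'"
      have "tangent_act A w = tangent_act A' w" if "w \<in> K" for w
        using \<open>A = - A'\<close> tangent_act_uminus[of A' w] A that K SL2Z_SL2R by auto
      thus ?thesis using A by (auto cong: image_cong_simp)
    qed (use A in simp)
  qed
  obtain v0 where v0: "v0 \<in> K'" using K' by blast
  obtain A where A: "A \<in> G" "v0 \<in> tangent_act A ` K" using cov[OF v0] by blast
  have "K' \<subseteq> tangent_act A ` K"
  proof (rule connected_subset_disjoint_closed_family[OF K'(3) finF clF _ disj v0 A(2)])
    show "K' \<subseteq> \<Union>F" using cov by (auto simp: F_def)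
    show "tangent_act A ` K \<in> F" using A by (auto simp: F_def)
  qed
  moreover have AZ: "A \<in> SL2Z" using A by (simp add: G_def visits_def)
  ultimately have "\<forall>v\<in>K'. tangent_act (adj A) v \<in> K"
    using tangent_act_adj(1)[OF SL2Z_SL2R[OF AZ]] K(2) by fastforce
  thus ?thesis using SL2Z_adj[OF AZ] by blast
qed

section \<open>Boxes in matrix coordinates\<close>

text \<open>Right multiplication with the unipotent matrices of the horocycle flow fixes the first column and
  adds to \<open>s\<close>. The remaining entry is forced by the determinant.\<close>

definition coset_matrix :: "real \<Rightarrow> real \<Rightarrow> real \<Rightarrow> real^2^2" where
  "coset_matrix p q s = vector [vector [p, p * s - 1 / q], vector [q, q * s]]"

lemma coset_matrix_entries [simp]:
  "coset_matrix p q s $ 1 $ 1 = p" "coset_matrix p q s $ 1 $ 2 = p * s - 1 / q"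
  "coset_matrix p q s $ 2 $ 1 = q" "coset_matrix p q s $ 2 $ 2 = q * s"
  by (simp_all add: coset_matrix_def)

lemma coset_matrix_SL2R: "q \<noteq> 0 \<Longrightarrow> coset_matrix p q s \<in> SL2R"
  by (simp add: SL2R_def det_2 algebra_simps)

lemma SL2R_eq_coset_matrix:
  assumes "A \<in> SL2R" "A$2$1 \<noteq> 0"
  shows "A = coset_matrix (A$1$1) (A$2$1) (A$2$2 / A$2$1)"
proof -
  have "A$1$1 * A$2$2 - A$1$2 * A$2$1 = 1" using assms by (simp add: SL2R_def det_2)
  thus ?thesis using assms(2) by (simp add: vec_eq_iff forall_2 field_simps)
qed

text \<open>The vector \<open>frame (coset_matrix p q s)\<close> in coordinates. For \<open>q = 0\<close> division by zero gives a point
  with imaginary part \<open>0\<close>, which is not in \<open>T1H\<close>.\<close>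

definition horo_chart :: "real \<times> real \<times> real \<Rightarrow> complex \<times> complex" where
  "horo_chart = (\<lambda>(p, q, s). (Complex (p / q - s / (q\<^sup>2 * (1 + s\<^sup>2))) (1 / (q\<^sup>2 * (1 + s\<^sup>2))),
                  - (Complex s (- 1) / Complex s 1)))"

lemma frame_coset_matrix:
  assumes "q \<noteq> 0" shows "frame (coset_matrix p q s) = horo_chart (p, q, s)"
proof -
  have s: "1 + s\<^sup>2 > 0" "1 + s\<^sup>2 \<noteq> 0" by (simp_all add: add_pos_nonneg) (metis add_pos_nonneg less_irrefl zero_le_power2 zero_less_one)
  have d: "q\<^sup>2 + (q * s)\<^sup>2 = q\<^sup>2 * (1 + s\<^sup>2)" by (simp add: power_mult_distrib algebra_simps)
  have n: "p * q + (p * s - 1 / q) * (q * s) = p / q * (q\<^sup>2 * (1 + s\<^sup>2)) - s"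
    using assms by (simp add: field_simps power2_eq_square)
  have "(p * q + (p * s - 1 / q) * (q * s)) / (q\<^sup>2 * (1 + s\<^sup>2)) = p / q - s / (q\<^sup>2 * (1 + s\<^sup>2))"
    unfolding n diff_divide_distrib using assms s by simp
  moreover have "Complex (q * s) (- q) / Complex (q * s) q = Complex s (- 1) / Complex s 1"
  proof -
    have "Complex (q * s) (- q) = of_real q * Complex s (- 1)" "Complex (q * s) q = of_real q * Complex s 1"
      by (simp_all add: complex_eq_iff)
    thus ?thesis using assms by simp
  qed
  ultimately show ?thesis
    using frame_coordinates[OF coset_matrix_SL2R[OF assms, of p s]] by (simp add: horo_chart_def d)
qed

lemma h_plus_upward:
  assumes "y > 0"
  shows "h_plus s (Complex x y, cis 0) = frame (coset_matrix (x / sqrt y) (1 / sqrt y) s)"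
proof -
  define q where "q = 1 / sqrt y"
  define A where "A = coset_matrix (x / sqrt y) q 0"
  have q: "q \<noteq> 0" "q\<^sup>2 = 1 / y" "x / sqrt y / q = x" using assms by (auto simp: q_def power_divide)
  have A: "A \<in> SL2R" using q by (simp add: A_def coset_matrix_SL2R)
  have up: "tangent_act A (\<i>, cis pi) = (Complex x y, cis 0)"
    using frame_coset_matrix[of q "x / sqrt y" 0] q unfolding frame_def A_def
    by (simp add: horo_chart_def complex_eq_iff Re_divide Im_divide)
  define n :: "real^2^2" where "n = vector [vector [1, s], vector [0, 1]]"
  have n: "n \<in> SL2R" by (simp add: n_def SL2R_def det_2)
  have "tangent_act n (\<i>, cis pi) = (Complex s 1, cis pi)"
    using tangent_act_eq[OF n, of \<i> "cis pi"] by (simp add: n_def complex_eq_iff)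
  hence "h_plus s (Complex x y, cis 0) = frame (A ** n)"
    using h_plus_tangent_act[OF A, of s] up frame_mult[OF A n] by (simp add: frame_def)
  also have "A ** n = coset_matrix (x / sqrt y) q s"
    by (simp add: vec_eq_iff forall_2 matrix_mult_entries A_def n_def)
  finally show ?thesis by (simp add: q_def)
qed

text \<open>The first columns \<open>\<plusminus> (x / \<surd>y, 1 / \<surd>y)\<close> that belong to the vectors \<open>(x + \<i> y, 0)\<close> of the base.\<close>

definition base_cone :: "real \<Rightarrow> real \<Rightarrow> real \<Rightarrow> real \<Rightarrow> (real \<times> real) set" where
  "base_cone a1 a2 b1 b2 =
     {(p, q). q \<noteq> 0 \<and> a1 \<le> p / q \<and> p / q \<le> a2 \<and> b1 \<le> 1 / q\<^sup>2 \<and> 1 / q\<^sup>2 \<le> b2}"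

text \<open>Membership in a box becomes a condition on the matrix, on which the group acts by multiplication.\<close>

lemma frame_in_box_lift_iff:
  assumes "0 < b1" "A \<in> SL2R"
  shows "frame A \<in> box_lift a1 a2 b1 b2 l \<longleftrightarrow>
         (A$1$1, A$2$1) \<in> base_cone a1 a2 b1 b2 \<and> \<bar>A$2$2 / A$2$1\<bar> \<le> l / 2"
proof
  assume "frame A \<in> box_lift a1 a2 b1 b2 l"
  then obtain s x y where sxy: "frame A = h_plus s (Complex x y, cis 0)"
    "a1 \<le> x" "x \<le> a2" "b1 \<le> y" "y \<le> b2" "\<bar>s\<bar> \<le> l / 2" by (auto simp: box_lift_def)
  have y: "y > 0" using sxy assms by simp
  define B where "B = coset_matrix (x / sqrt y) (1 / sqrt y) s"
  have B: "B \<in> SL2R" unfolding B_def using y by (intro coset_matrix_SL2R) simp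
  have "frame A = frame B" using sxy h_plus_upward[OF y] by (simp add: B_def)
  hence "A = B \<or> A = - B" using frame_eq_iff[OF assms(2) B] by simp
  thus "(A$1$1, A$2$1) \<in> base_cone a1 a2 b1 b2 \<and> \<bar>A$2$2 / A$2$1\<bar> \<le> l / 2"
    using y sxy by (auto simp: B_def base_cone_def power_divide)
next
  assume r: "(A$1$1, A$2$1) \<in> base_cone a1 a2 b1 b2 \<and> \<bar>A$2$2 / A$2$1\<bar> \<le> l / 2"
  define x where "x = A$1$1 / A$2$1"
  define y where "y = 1 / (A$2$1)\<^sup>2"
  define s where "s = A$2$2 / A$2$1"
  have nz: "A$2$1 \<noteq> 0" and xys: "a1 \<le> x" "x \<le> a2" "b1 \<le> y" "y \<le> b2" "\<bar>s\<bar> \<le> l / 2"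
    using r by (auto simp: base_cone_def x_def y_def s_def)
  have y: "y > 0" "sqrt y = 1 / \<bar>A$2$1\<bar>" using nz by (simp_all add: y_def real_sqrt_divide)
  define B where "B = coset_matrix (x / sqrt y) (1 / sqrt y) s"
  have B: "B \<in> SL2R" unfolding B_def using y(1) by (intro coset_matrix_SL2R) simp
  have "A = B \<or> A = - B"
  proof (cases "A$2$1 > 0")
    case True
    hence "x / sqrt y = A$1$1" "1 / sqrt y = A$2$1" using nz by (simp_all add: y x_def)
    thus ?thesis using SL2R_eq_coset_matrix[OF assms(2) nz] by (simp add: B_def s_def)
  next
    case False
    hence "x / sqrt y = - A$1$1" "1 / sqrt y = - A$2$1" using nz by (simp_all add: y x_def)
    hence "- A = B" using arg_cong[OF SL2R_eq_coset_matrix[OF assms(2) nz], of uminus]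
      by (simp add: B_def s_def vec_eq_iff forall_2)
    thus ?thesis by auto
  qed
  hence "frame A = h_plus s (Complex x y, cis 0)"
    using frame_eq_iff[OF assms(2) B] h_plus_upward[OF y(1)] by (simp add: B_def)
  thus "frame A \<in> box_lift a1 a2 b1 b2 l" using xys by (auto simp: box_lift_def)
qed

text \<open>\<open>h_plus s (Complex x y, cis 0)\<close> in coordinates; see \<open>box_lift_eq_image\<close>.\<close>

definition box_param :: "real \<times> real \<times> real \<Rightarrow> complex \<times> complex" where
  "box_param = (\<lambda>(x, y, s). (Complex (x - y * s / (1 + s\<^sup>2)) (y / (1 + s\<^sup>2)), - (Complex s (- 1) / Complex s 1)))"

lemma box_lift_eq_image:
  assumes "0 < b1"
  shows "box_lift a1 a2 b1 b2 l =
    box_param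
      ` ({a1..a2} \<times> {b1..b2} \<times> {- (l / 2)..l / 2})"
proof -
  have "h_plus s (Complex x y, cis 0) =
      (Complex (x - y * s / (1 + s\<^sup>2)) (y / (1 + s\<^sup>2)), - (Complex s (- 1) / Complex s 1))"
    if "b1 \<le> y" for s x y
  proof -
    have y: "y > 0" using that assms by simp
    show ?thesis unfolding h_plus_upward[OF y] using y
      by (subst frame_coset_matrix) (auto simp: horo_chart_def power_divide)
  qed
  note eq = this
  show ?thesis
  proof (intro equalityI subsetI)
    fix v assume "v \<in> box_lift a1 a2 b1 b2 l"
    then obtain s x y where v: "v = h_plus s (Complex x y, cis 0)"
      "a1 \<le> x" "x \<le> a2" "b1 \<le> y" "y \<le> b2" "\<bar>s\<bar> \<le> l / 2" by (auto simp: box_lift_def)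
    show "v \<in> box_param
      ` ({a1..a2} \<times> {b1..b2} \<times> {- (l / 2)..l / 2})"
      by (rule image_eqI[where x="(x, y, s)"]) (use v eq in \<open>auto simp: box_param_def\<close>)
  next
    fix v assume "v \<in> box_param
      ` ({a1..a2} \<times> {b1..b2} \<times> {- (l / 2)..l / 2})"
    then obtain x y s where v: "v = (Complex (x - y * s / (1 + s\<^sup>2)) (y / (1 + s\<^sup>2)), - (Complex s (- 1) / Complex s 1))"
      "a1 \<le> x" "x \<le> a2" "b1 \<le> y" "y \<le> b2" "- (l / 2) \<le> s" "s \<le> l / 2" by (auto simp: box_param_def)
    have "\<bar>s\<bar> \<le> l / 2" using v by linarith
    moreover have "v = h_plus s (Complex x y, cis 0)" using v eq by simp
    ultimately show "v \<in> box_lift a1 a2 b1 b2 l" using v(2-5) unfolding box_lift_def by blast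
  qed
qed

lemma one_plus_square_nonzero: "1 + s\<^sup>2 \<noteq> (0::real)"
  by (metis add_pos_nonneg less_irrefl zero_le_power2 zero_less_one)

lemma box_lift_topology:
  assumes "0 < b1" "a1 < a2" "b1 < b2" "0 < l"
  shows "compact (box_lift a1 a2 b1 b2 l)" "connected (box_lift a1 a2 b1 b2 l)"
    "box_lift a1 a2 b1 b2 l \<noteq> {}" "box_lift a1 a2 b1 b2 l \<subseteq> T1H"
proof -
  have c: "continuous_on S box_param" for S
    unfolding box_param_def split_beta Complex_eq
    by (intro continuous_intros) (auto simp: one_plus_square_nonzero complex_eq_iff)
  show "compact (box_lift a1 a2 b1 b2 l)" unfolding box_lift_eq_image[OF assms(1)]
    by (intro compact_continuous_image c compact_Times compact_Icc)
  show "connected (box_lift a1 a2 b1 b2 l)" unfolding box_lift_eq_image[OF assms(1)]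
    by (intro connected_continuous_image c connected_Times connected_Icc)
  show "box_lift a1 a2 b1 b2 l \<noteq> {}" unfolding box_lift_eq_image[OF assms(1)] using assms by simp
  have "0 < y / (1 + s\<^sup>2)" if "b1 \<le> y" for y s using that assms by (intro divide_pos_pos) (auto simp: add_pos_nonneg)
  moreover have "norm (- (Complex s (- 1) / Complex s 1)) = 1" for s
  proof -
    have "Complex s (- 1) = cnj (Complex s 1)" "Complex s 1 \<noteq> 0" by (simp_all add: complex_eq_iff)
    thus ?thesis by (simp only: norm_minus_cancel norm_divide complex_mod_cnj) simp
  qed
  ultimately show "box_lift a1 a2 b1 b2 l \<subseteq> T1H" unfolding box_lift_eq_image[OF assms(1)]
    by (auto simp: T1H_def box_param_def)
qed

section \<open>The horocycle measure of a box\<close>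

lemma nn_integral_lborel_cong_except:
  fixes f g :: "real \<Rightarrow> ennreal"
  assumes "\<And>x. x \<noteq> c \<Longrightarrow> f x = g x"
  shows "(\<integral>\<^sup>+x. f x \<partial>lborel) = (\<integral>\<^sup>+x. g x \<partial>lborel)"
proof (rule nn_integral_cong_AE)
  show "AE x in lborel. f x = g x"
    using AE_lborel_singleton[of c] by eventually_elim (rule assms)
qed

lemma nn_integral_unfold_integer_translates:
  fixes f :: "real \<Rightarrow> ennreal"
  assumes [measurable]: "f \<in> borel_measurable borel"
  shows "(\<integral>\<^sup>+k. (\<integral>\<^sup>+x. f (x + of_int k) * indicator {0..1} x \<partial>lborel) \<partial>count_space (UNIV :: int set)) =
         (\<integral>\<^sup>+x. f x \<partial>lborel)"
proof -
  have shift: "(\<integral>\<^sup>+x. f (x + of_int k) * indicator {0..1} x \<partial>lborel) =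
      (\<integral>\<^sup>+x. f x * indicator {of_int k..<of_int k + 1} x \<partial>lborel)" for k :: int
  proof -
    have "(\<integral>\<^sup>+x. f (x + of_int k) * indicator {0..1} x \<partial>lborel) =
          (\<integral>\<^sup>+x. f (of_int k + 1 * x) * indicator {of_int k..<of_int k + 1} (of_int k + 1 * x) \<partial>lborel)"
      by (rule nn_integral_lborel_cong_except[of 1]) (auto simp: indicator_def add.commute)
    also have "\<dots> = (\<integral>\<^sup>+x. f x * indicator {of_int k..<of_int k + 1} x \<partial>lborel)"
      using nn_integral_real_affine[of "\<lambda>x. f x * indicator {of_int k..<of_int k + 1} x" 1 "of_int k"] by simp
    finally show ?thesis .
  qed
  have one: "(\<integral>\<^sup>+k. indicator {of_int k..<of_int k + 1} x \<partial>count_space (UNIV :: int set)) = (1 :: ennreal)" for x :: real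
  proof -
    have "(\<integral>\<^sup>+k. indicator {of_int k..<of_int k + 1} x \<partial>count_space (UNIV :: int set)) =
          (\<integral>\<^sup>+k. indicator {\<lfloor>x\<rfloor>} k \<partial>count_space (UNIV :: int set))"
      by (intro nn_integral_cong) (auto simp: indicator_def floor_unique; linarith)
    thus ?thesis by simp
  qed
  have "(\<integral>\<^sup>+k. (\<integral>\<^sup>+x. f (x + of_int k) * indicator {0..1} x \<partial>lborel) \<partial>count_space (UNIV :: int set)) =
        (\<integral>\<^sup>+x. (\<integral>\<^sup>+k. f x * indicator {of_int k..<of_int k + 1} x \<partial>count_space (UNIV :: int set)) \<partial>lborel)"
    unfolding shift by (rule nn_integral_count_space_nn_integral[symmetric]) auto
  also have "\<dots> = (\<integral>\<^sup>+x. f x \<partial>lborel)"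
    by (simp add: nn_integral_cmult one)
  finally show ?thesis .
qed

lemma base_cone_bounded:
  assumes "0 < a1" "a2 \<le> 1" "0 < b1" "(p, q) \<in> base_cone a1 a2 b1 b2"
  shows "\<bar>p\<bar> \<le> 1 / sqrt b1 \<and> \<bar>q\<bar> \<le> 1 / sqrt b1"
proof -
  have q: "q \<noteq> 0" "b1 \<le> 1 / q\<^sup>2" "0 < p / q" "p / q \<le> 1" using assms by (auto simp: base_cone_def)
  have "q\<^sup>2 \<le> 1 / b1" using q assms by (simp add: field_simps)
  hence "\<bar>q\<bar> \<le> sqrt (1 / b1)" by (metis real_sqrt_abs real_sqrt_le_iff)
  hence 1: "\<bar>q\<bar> \<le> 1 / sqrt b1" by (simp add: real_sqrt_divide)
  have "\<bar>p / q\<bar> \<le> 1" using q by (simp only: abs_of_pos)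
  hence "\<bar>p / q\<bar> * \<bar>q\<bar> \<le> 1 * \<bar>q\<bar>" by (intro mult_right_mono) auto
  moreover have "\<bar>p / q\<bar> * \<bar>q\<bar> = \<bar>p\<bar>" using q by (simp add: abs_divide)
  ultimately have "\<bar>p\<bar> \<le> \<bar>q\<bar>" by simp
  thus ?thesis using 1 by simp
qed

lemma scaled_base_cone_bounded:
  assumes "0 < a1" "a2 \<le> 1" "0 < b1" "0 < y" "(sqrt y * p, sqrt y * q) \<in> base_cone a1 a2 b1 b2"
  shows "\<bar>p\<bar> \<le> 1 / sqrt b1 / sqrt y \<and> \<bar>q\<bar> \<le> 1 / sqrt b1 / sqrt y"
  using base_cone_bounded[OF assms(1-3,5)] assms(4)
  by (simp add: abs_mult pos_le_divide_eq mult.commute del: divide_divide_eq_left)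

lemma finite_primitive_points:
  assumes "\<And>p q. (p, q) \<in> D \<Longrightarrow> \<bar>p\<bar> \<le> R \<and> \<bar>q\<bar> \<le> R"
  shows "finite (primitive_points D)"
  by (rule finite_subset[OF _ finite_subset[OF lattice_points_in_box[OF assms]]])
     (auto simp: primitive_points_def lattice_points_def)

text \<open>The matrices in \<open>SL2Z\<close> with first column \<open>(a, c)\<close> arise from one of them by adding the integral
  multiples of the first column to the second.\<close>

lemma nn_integral_SL2Z_first_column:
  fixes f :: "real^2^2 \<Rightarrow> ennreal" and P :: "(int \<times> int) set"
  assumes P: "\<And>a c. (a, c) \<in> P \<Longrightarrow> coprime a c"
    and bd: "\<And>a c. (a, c) \<in> P \<Longrightarrow> a * d (a, c) - b (a, c) * c = 1"
    and supp: "\<And>a b c d. f (int_matrix a b c d) \<noteq> 0 \<Longrightarrow> int_matrix a b c d \<in> SL2Z \<Longrightarrow> (a, c) \<in> P"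
  shows "(\<integral>\<^sup>+A. f A \<partial>count_space SL2Z) =
    (\<integral>\<^sup>+v. (\<integral>\<^sup>+k. f (int_matrix (fst v) (b v + k * fst v) (snd v) (d v + k * snd v)) \<partial>count_space UNIV)
       \<partial>count_space P)"
proof -
  define g where "g = (\<lambda>(v :: int \<times> int, k). int_matrix (fst v) (b v + k * fst v) (snd v) (d v + k * snd v))"
  define S where "S = g ` (P \<times> UNIV)"
  have gin: "g (v, k) \<in> SL2Z" if "v \<in> P" for v k
    using bd[of "fst v" "snd v"] that by (auto simp: g_def int_matrix_in_SL2Z algebra_simps)
  have inj: "inj_on g (P \<times> UNIV)"
  proof (rule inj_onI, clarify)
    fix a c k a' c' k' assume P': "(a, c) \<in> P" "(a', c') \<in> P" and e: "g ((a, c), k) = g ((a', c'), k')"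
    have ent: "g ((a, c), k) $ i $ j = g ((a', c'), k') $ i $ j" for i j using e by simp
    have ac: "a = a'" "c = c'" using ent[of 1 1] ent[of 2 1] by (auto simp: g_def)
    have "b (a, c) + k * a = b (a, c) + k' * a" "d (a, c) + k * c = d (a, c) + k' * c"
      using ent[of 1 2] ent[of 2 2] unfolding ac g_def by (auto simp flip: of_int_mult of_int_add)
    moreover have "a \<noteq> 0 \<or> c \<noteq> 0" using P[OF P'(1)] by auto
    ultimately show "(a, c) = (a', c') \<and> k = k'" using ac by auto
  qed
  have cover: "A \<in> S" if A: "A \<in> SL2Z" "f A \<noteq> 0" for A
  proof -
    obtain a b' c d' where A': "A = int_matrix a b' c d'" "a * d' - b' * c = 1" using A(1) by (rule SL2Z_cases)
    have v: "(a, c) \<in> P" using supp A A' by blast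
    define d0 where "d0 = d (a, c)"
    define b0 where "b0 = b (a, c)"
    have e: "a * d0 - b0 * c = 1" using bd[OF v] by (simp add: d0_def b0_def)
    define k where "k = b' * d0 - b0 * d'"
    have "b' = b0 + k * a"
    proof -
      have "b0 + k * a = b0 + b' * (a * d0) - b0 * (a * d')" by (simp add: k_def algebra_simps)
      also have "a * d0 = 1 + b0 * c" using e by simp
      also have "a * d' = 1 + b' * c" using A'(2) by simp
      finally show ?thesis by (simp add: algebra_simps)
    qed
    moreover have "d' = d0 + k * c"
    proof -
      have "d0 + k * c = d0 + d0 * (b' * c) - d' * (b0 * c)" by (simp add: k_def algebra_simps)
      also have "b' * c = a * d' - 1" using A'(2) by simp
      also have "b0 * c = a * d0 - 1" using e by simp
      finally show ?thesis by (simp add: algebra_simps)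
    qed
    ultimately have "A = g ((a, c), k)" by (simp add: A'(1) g_def b0_def d0_def)
    thus ?thesis using v by (auto simp: S_def)
  qed
  have SZ: "S \<subseteq> SL2Z" using gin by (auto simp: S_def)
  have "(\<integral>\<^sup>+A. f A \<partial>count_space SL2Z) = (\<integral>\<^sup>+A. f A \<partial>count_space S)"
    using SZ cover by (intro nn_integral_count_space_eq) auto
  also have "\<dots> = (\<integral>\<^sup>+x. f (g x) \<partial>count_space (P \<times> UNIV))"
    using inj unfolding S_def by (intro nn_integral_bij_count_space[symmetric] inj_on_imp_bij_betw)
  also have "\<dots> = (\<integral>\<^sup>+x. f (g x) * indicator (P \<times> UNIV) x \<partial>count_space UNIV)"
    by (rule nn_integral_count_space_indicator) simp
  also have "\<dots> = (\<integral>\<^sup>+v. (\<integral>\<^sup>+k. f (g (v, k)) * indicator P v \<partial>count_space UNIV) \<partial>count_space UNIV)"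
    by (subst nn_integral_fst_count_space[symmetric]) (auto intro!: nn_integral_cong simp: indicator_def)
  also have "\<dots> = (\<integral>\<^sup>+v. (\<integral>\<^sup>+k. f (g (v, k)) \<partial>count_space UNIV) * indicator P v \<partial>count_space UNIV)"
    by (intro nn_integral_cong nn_integral_multc) auto
  also have "\<dots> = (\<integral>\<^sup>+v. (\<integral>\<^sup>+k. f (g (v, k)) \<partial>count_space UNIV) \<partial>count_space P)"
    by (rule nn_integral_count_space_indicator[symmetric]) simp
  finally show ?thesis by (simp add: g_def)
qed

lemma coprime_completion:
  "\<exists>d b :: int \<times> int \<Rightarrow> int. \<forall>a c. coprime a c \<longrightarrow> a * d (a, c) - b (a, c) * c = 1"
proof -
  have "\<exists>w. coprime (fst v) (snd v) \<longrightarrow> fst v * fst w - snd w * snd v = 1" for v :: "int \<times> int"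
  proof (cases "coprime (fst v) (snd v)")
    case True
    hence "gcd (fst v) (snd v) = 1" by (rule coprime_imp_gcd_eq_1)
    moreover obtain u w where "u * fst v + w * snd v = gcd (fst v) (snd v)" using bezout_int by blast
    ultimately have "fst v * fst (u, - w) - snd (u, - w) * snd v = 1" by (simp add: mult.commute)
    thus ?thesis by blast
  qed auto
  hence "\<forall>v. \<exists>w. coprime (fst v) (snd v) \<longrightarrow> fst v * fst w - snd w * snd v = (1::int)" by blast
  from choice[OF this] obtain w :: "int \<times> int \<Rightarrow> int \<times> int" where
    w: "\<forall>v. coprime (fst v) (snd v) \<longrightarrow> fst v * fst (w v) - snd (w v) * snd v = 1" by blast
  show ?thesis
  proof (intro exI allI impI)
    fix a c :: int assume "coprime a c"
    thus "a * (\<lambda>v. fst (w v)) (a, c) - (\<lambda>v. snd (w v)) (a, c) * c = 1"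
      using w[rule_format, of "(a, c)"] by simp
  qed
qed

lemma horocycle_point_frame:
  assumes "y > 0"
  defines "H \<equiv> \<lambda>x. vector [vector [sqrt y, x / sqrt y], vector [0, 1 / sqrt y]] :: real^2^2"
  shows "H x \<in> SL2R" "frame (H x) = (Complex x y, cis pi)"
proof -
  show H: "H x \<in> SL2R" using assms by (simp add: SL2R_def det_2)
  show "frame (H x) = (Complex x y, cis pi)"
    using assms unfolding frame_coordinates[OF H] by (simp add: power_divide complex_eq_iff Re_divide Im_divide)
qed

text \<open>Unfolding turns twice the measure into a sum over \<open>SL2Z\<close>. A matrix with first column \<open>(a, c)\<close> moves
  the horocycle at height \<open>y\<close> to vectors with first column \<open>\<surd>y (a, c)\<close>; the matrices that share this
  column differ by integral translations of \<open>x\<close>. Together they therefore see the whole horocycle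
  line, which crosses the box for a set of \<open>x\<close> of length \<open>l y\<close>.\<close>

lemma emeasure_m_horo_box:
  assumes ab: "0 < a1" "a1 < a2" "a2 \<le> 1" "0 < b1" "b1 < b2" "0 < l" and y: "0 < y"
    and inj: "inj_on proj (box_lift a1 a2 b1 b2 l)"
  defines "D \<equiv> {(p, q). (sqrt y * p, sqrt y * q) \<in> base_cone a1 a2 b1 b2}"
  shows "2 * emeasure (m_horo y) (proj ` box_lift a1 a2 b1 b2 l) = ennreal (l * y * real (card (primitive_points D)))"
proof -
  define B where "B = box_lift a1 a2 b1 b2 l"
  define v where "v x = (Complex x y, cis pi)" for x
  note top = box_lift_topology[OF ab(4,2,5,6), folded B_def]
  have vT: "v x \<in> T1H" for x using y by (simp add: v_def T1H_def)
  have PB[measurable]: "proj ` B \<in> sets M_borel" by (rule proj_compact_measurable[OF top(1,4)])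
  have "v \<in> measurable borel (restrict_space borel T1H)"
    using vT by (intro measurable_restrict_space2 borel_measurable_continuous_onI)
       (auto simp: v_def Complex_eq intro!: continuous_intros)
  hence pv[measurable]: "(\<lambda>x. proj (v x)) \<in> measurable borel M_borel"
    by (rule measurable_compose[OF _ proj_measurable])
  have pv': "(\<lambda>x. proj (v x)) \<in> measurable (uniform_measure lborel {0..1}) M_borel"
    using pv unfolding measurable_cong_sets[OF sets_uniform_measure refl] by simp
  have pre: "(\<lambda>x. proj (v x)) -` proj ` B \<in> sets borel"
    using measurable_sets[OF pv PB] by simp

  define C where "C a c d = {x::real. \<bar>(of_int c * x + of_int d) / (of_int c * y)\<bar> \<le> l / 2}" for a c d :: int
  have Cm[measurable]: "C a c d \<in> sets borel" for a c d
    unfolding C_def by measurable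
  have act: "tangent_act (int_matrix a b c d) (v x) \<in> B \<longleftrightarrow> (of_int a, of_int c) \<in> D \<and> x \<in> C a c d"
    if Z: "int_matrix a b c d \<in> SL2Z" for a b c d x
  proof -
    define H :: "real^2^2" where "H = vector [vector [sqrt y, x / sqrt y], vector [0, 1 / sqrt y]]"
    note H = horocycle_point_frame[OF y, of x, folded H_def v_def]
    have A: "int_matrix a b c d \<in> SL2R" using Z by (rule SL2Z_SL2R)
    have e: "tangent_act (int_matrix a b c d) (v x) = frame (int_matrix a b c d ** H)"
      using frame_mult[OF A H(1)] H(2) by simp
    have "(int_matrix a b c d ** H) $ 1 $ 1 = sqrt y * of_int a" "(int_matrix a b c d ** H) $ 2 $ 1 = sqrt y * of_int c"
      by (simp_all add: matrix_mult_entries H_def)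
    moreover have "(int_matrix a b c d ** H) $ 2 $ 2 / (sqrt y * of_int c) = (of_int c * x + of_int d) / (of_int c * y)"
      using y by (simp add: matrix_mult_entries H_def field_simps)
    ultimately show ?thesis unfolding e B_def frame_in_box_lift_iff[OF ab(4) SL2R_mult[OF A H(1)]]
      by (simp only: D_def C_def mem_Collect_eq case_prod_conv)
  qed
  have actm: "(\<lambda>x. indicator B (tangent_act A (v x)) * indicator {0..1} x :: ennreal) \<in> borel_measurable borel"
    if "A \<in> SL2Z" for A
  proof -
    obtain a b c d where A: "A = int_matrix a b c d" using \<open>A \<in> SL2Z\<close> by (rule SL2Z_cases)
    have "(\<lambda>x. indicator B (tangent_act A (v x)) * indicator {0..1} x :: ennreal) =
          (\<lambda>x. indicator D (real_of_int a, real_of_int c) * indicator (C a c d) x * indicator {0..1} x)"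
      using act[of a b c d] that unfolding A by (auto simp: indicator_def fun_eq_iff)
    thus ?thesis by simp
  qed

  define P where "P = primitive_points D"
  have finP: "finite P" unfolding P_def
    by (rule finite_primitive_points) (use scaled_base_cone_bounded[OF ab(1,3,4) y] in \<open>auto simp: D_def\<close>)
  obtain d b where bd: "\<And>a c. coprime a c \<Longrightarrow> a * d (a, c) - b (a, c) * c = (1::int)"
    using coprime_completion by blast
  define M where "M w k = int_matrix (fst w) (b w + k * fst w) (snd w) (d w + k * snd w)" for w k
  have inner: "(\<integral>\<^sup>+k. (\<integral>\<^sup>+x. indicator B (tangent_act (M (a, c) k) (v x))
          * indicator {0..1} x \<partial>lborel) \<partial>count_space UNIV) = ennreal (l * y)"
    if ac: "(a, c) \<in> P" for a c
  proof -
    have cop: "coprime a c" and D: "(of_int a, of_int c) \<in> D" using ac by (auto simp: P_def primitive_points_def)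
    have c: "real_of_int c \<noteq> 0" using D y by (auto simp: D_def base_cone_def)
    define I where "I = {- (l * y / 2) - of_int (d (a, c)) / of_int c..l * y / 2 - of_int (d (a, c)) / of_int c}"
    have "indicator B (tangent_act (M (a, c) k) (v x)) =
          (indicator I (x + of_int k) :: ennreal)" for k x
    proof -
      have M: "M (a, c) k = int_matrix a (b (a, c) + k * a) c (d (a, c) + k * c)" by (simp add: M_def)
      have Z: "int_matrix a (b (a, c) + k * a) c (d (a, c) + k * c) \<in> SL2Z"
        using bd[OF cop] by (simp add: int_matrix_in_SL2Z algebra_simps)
      have "(of_int c * x + of_int (d (a, c) + k * c)) / (of_int c * y) = (x + of_int k + of_int (d (a, c)) / of_int c) / y"
        using c by (simp add: field_simps)
      hence "x \<in> C a c (d (a, c) + k * c) \<longleftrightarrow> \<bar>(x + of_int k + of_int (d (a, c)) / of_int c) / y\<bar> \<le> l / 2"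
        by (simp only: C_def mem_Collect_eq)
      also have "\<bar>t / y\<bar> \<le> l / 2 \<longleftrightarrow> - (l * y / 2) \<le> t \<and> t \<le> l * y / 2" for t
        using y by (simp add: abs_le_iff field_simps) linarith
      finally have "x \<in> C a c (d (a, c) + k * c) \<longleftrightarrow> x + of_int k \<in> I"
        by (auto simp: I_def)
      thus ?thesis using act[OF Z] D by (simp add: M indicator_def)
    qed
    hence "(\<integral>\<^sup>+k. (\<integral>\<^sup>+x. indicator B (tangent_act (M (a, c) k) (v x))
          * indicator {0..1} x \<partial>lborel) \<partial>count_space UNIV) = (\<integral>\<^sup>+x. indicator I x \<partial>lborel)"
      using nn_integral_unfold_integer_translates[of "indicator I"] by (simp add: I_def)
    also have "\<dots> = ennreal (l * y)" using ab y by (simp add: I_def)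
    finally show ?thesis .
  qed
  have supp: "(a, c) \<in> P" if "(\<integral>\<^sup>+x. indicator B (tangent_act (int_matrix a b c d) (v x)) * indicator {0..1} x \<partial>lborel) \<noteq> 0"
    "int_matrix a b c d \<in> SL2Z" for a b c d
  proof -
    have "\<exists>x. tangent_act (int_matrix a b c d) (v x) \<in> B"
    proof (rule ccontr)
      assume "\<nexists>x. tangent_act (int_matrix a b c d) (v x) \<in> B"
      hence "(\<lambda>x. indicator B (tangent_act (int_matrix a b c d) (v x)) * indicator {0..1} x) = (\<lambda>x. 0 :: ennreal)"
        by (auto simp: fun_eq_iff)
      thus False using that(1) by simp
    qed
    hence "(of_int a, of_int c) \<in> D" using act[OF that(2)] by blast
    moreover have "coprime a c"
    proof (rule coprimeI)
      fix e assume "e dvd a" "e dvd c"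
      hence "e dvd a * d - b * c" by (simp add: dvd_diff)
      moreover have "a * d - b * c = 1" using that(2) by (simp add: int_matrix_in_SL2Z)
      ultimately show "is_unit e" by simp
    qed
    ultimately show ?thesis by (simp add: P_def primitive_points_def)
  qed

  \<comment> \<open>Each point of \<open>B\<close> is counted for \<open>A\<close> and \<open>- A\<close>, which is the reason for the factor \<open>2\<close>.\<close>
  have "emeasure (m_horo y) (proj ` B) = emeasure (uniform_measure lborel {0..1}) ((\<lambda>x. proj (v x)) -` proj ` B)"
    unfolding m_horo_def v_def[symmetric] using pv' PB by (subst emeasure_distr) auto
  also have "\<dots> = emeasure lborel ({0..1} \<inter> (\<lambda>x. proj (v x)) -` proj ` B)"
    using pre by (subst emeasure_uniform_measure) (auto simp: divide_ennreal_def)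
  also have "\<dots> = (\<integral>\<^sup>+x. indicator (proj ` B) (proj (v x)) * indicator {0..1} x \<partial>lborel)"
  proof -
    have "emeasure lborel ({0..1} \<inter> (\<lambda>x. proj (v x)) -` proj ` B) =
        (\<integral>\<^sup>+x. indicator ({0..1} \<inter> (\<lambda>x. proj (v x)) -` proj ` B) x \<partial>lborel)"
      using pre by (intro nn_integral_indicator[symmetric]) auto
    also have "\<dots> = (\<integral>\<^sup>+x. indicator (proj ` B) (proj (v x)) * indicator {0..1} x \<partial>lborel)"
      by (intro nn_integral_cong) (auto simp: indicator_def)
    finally show ?thesis .
  qed
  finally have "2 * emeasure (m_horo y) (proj ` B) =
      (\<integral>\<^sup>+x. 2 * (indicator (proj ` B) (proj (v x)) * indicator {0..1} x) \<partial>lborel)"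
    using pre by (subst nn_integral_cmult)
      (auto intro!: borel_measurable_times_ennreal measurable_compose[OF pv borel_measurable_indicator])
  also have "\<dots> = (\<integral>\<^sup>+x. (\<integral>\<^sup>+A. indicator B (tangent_act A (v x)) * indicator {0..1} x \<partial>count_space SL2Z) \<partial>lborel)"
    using nn_integral_orbit_visits[OF vT top(4)] inj
    by (intro nn_integral_cong) (auto simp: nn_integral_multc B_def mult.assoc)
  also have "\<dots> = (\<integral>\<^sup>+A. (\<integral>\<^sup>+x. indicator B (tangent_act A (v x)) * indicator {0..1} x \<partial>lborel) \<partial>count_space SL2Z)"
    using actm by (intro nn_integral_count_space_nn_integral countable_SL2Z) auto
  also have "\<dots> = (\<integral>\<^sup>+w. (\<integral>\<^sup>+k. (\<integral>\<^sup>+x. indicator B (tangent_act (M w k) (v x))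
          * indicator {0..1} x \<partial>lborel) \<partial>count_space UNIV) \<partial>count_space P)"
    unfolding M_def
  proof (rule nn_integral_SL2Z_first_column)
    show "coprime a c" if "(a, c) \<in> P" for a c using that by (simp add: P_def primitive_points_def)
    thus "a * d (a, c) - b (a, c) * c = 1" if "(a, c) \<in> P" for a c using that bd by blast
  qed (rule supp)
  also have "\<dots> = (\<integral>\<^sup>+w. ennreal (l * y) \<partial>count_space P)"
  proof (rule nn_integral_cong)
    fix w assume "w \<in> space (count_space P)"
    hence "(fst w, snd w) \<in> P" by simp
    from inner[OF this] show "(\<integral>\<^sup>+k. (\<integral>\<^sup>+x. indicator B (tangent_act (M w k) (v x))
          * indicator {0..1} x \<partial>lborel) \<partial>count_space UNIV) = ennreal (l * y)" by simp
  qed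
  also have "\<dots> = ennreal (l * y * real (card P))"
    using finP ab y by (simp add: ennreal_mult ennreal_of_nat_eq_real_of_nat)
  finally show ?thesis by (simp add: B_def P_def)
qed

section \<open>Liouville measure and changes of variables\<close>

lemma SUP_indicator_incseq:
  fixes c :: ennreal and T :: "nat \<Rightarrow> 'a set"
  assumes "(\<Union>n. T n) = U"
  shows "(SUP n. c * indicator (T n) x) = c * indicator U x"
proof (cases "x \<in> U")
  case True
  then obtain n where "x \<in> T n" using assms by blast
  hence "c \<le> (SUP n. c * indicator (T n) x)" by (intro SUP_upper2[of n]) auto
  moreover have "(SUP n. c * indicator (T n) x) \<le> c" by (intro SUP_least) (auto simp: indicator_def)
  ultimately show ?thesis using True by simp
next
  case False
  thus ?thesis using assms by auto
qed

lemma nn_integral_indicator_SUP: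
  fixes f :: "real \<Rightarrow> ennreal"
  assumes [measurable]: "f \<in> borel_measurable borel" "\<And>n. T n \<in> sets borel"
    and inc: "incseq T" and T: "(\<Union>n. T n) = U"
  shows "(\<integral>\<^sup>+x. f x * indicator U x \<partial>lborel) = (SUP n::nat. \<integral>\<^sup>+x. f x * indicator (T n) x \<partial>lborel)"
proof -
  have "incseq (\<lambda>n x. f x * indicator (T n) x)"
    using inc by (auto simp: incseq_def le_fun_def indicator_def intro!: mult_left_mono)
  hence "(\<integral>\<^sup>+x. (SUP n. f x * indicator (T n) x) \<partial>lborel) = (SUP n. \<integral>\<^sup>+x. f x * indicator (T n) x \<partial>lborel)"
    by (intro nn_integral_monotone_convergence_SUP) auto
  thus ?thesis by (simp add: SUP_indicator_incseq[OF T])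
qed

text \<open>Substitution on an open or unbounded interval, by exhaustion with compact intervals.\<close>

lemma nn_integral_substitution_exhaustion:
  fixes f :: "real \<Rightarrow> ennreal" and g g' :: "real \<Rightarrow> real"
  assumes [measurable]: "f \<in> borel_measurable borel" "g \<in> borel_measurable borel" "g' \<in> borel_measurable borel"
    and ab: "\<And>n. a n < b n" "incseq (\<lambda>n. {a n..b n})" "(\<Union>n. {a n..b n}) = S"
    and im: "incseq (\<lambda>n. {g (a n)..g (b n)})" "(\<Union>n::nat. {g (a n)..g (b n)}) = T"
    and deriv: "\<And>x. x \<in> S \<Longrightarrow> (g has_real_derivative g' x) (at x)"
    and cont: "continuous_on S g'" and nonneg: "\<And>x. x \<in> S \<Longrightarrow> g' x \<ge> 0"
  shows "(\<integral>\<^sup>+x. f x * indicator T x \<partial>lborel) = (\<integral>\<^sup>+x. f (g x) * g' x * indicator S x \<partial>lborel)"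
proof -
  have sub: "{a n..b n} \<subseteq> S" for n using ab(3) by blast
  have "(\<integral>\<^sup>+x. f x * indicator T x \<partial>lborel) = (SUP n. \<integral>\<^sup>+x. f x * indicator {g (a n)..g (b n)} x \<partial>lborel)"
    by (rule nn_integral_indicator_SUP[OF _ _ im]) auto
  also have "\<dots> = (SUP n. \<integral>\<^sup>+x. f (g x) * g' x * indicator {a n..b n} x \<partial>lborel)"
  proof (rule SUP_cong[OF refl])
    fix n
    show "(\<integral>\<^sup>+x. f x * indicator {g (a n)..g (b n)} x \<partial>lborel) = (\<integral>\<^sup>+x. f (g x) * g' x * indicator {a n..b n} x \<partial>lborel)"
      by (rule nn_integral_substitution_aux)
         (use sub[of n] ab(1) deriv nonneg continuous_on_subset[OF cont] in auto)
  qed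
  also have "\<dots> = (\<integral>\<^sup>+x. f (g x) * g' x * indicator S x \<partial>lborel)"
    by (rule nn_integral_indicator_SUP[symmetric, OF _ _ ab(2,3)]) auto
  finally show ?thesis .
qed

lemma nn_integral_arctan_substitution:
  fixes f :: "real \<Rightarrow> ennreal"
  assumes [measurable]: "f \<in> borel_measurable borel"
  shows "(\<integral>\<^sup>+t. f t * indicator {-pi<..<pi} t \<partial>lborel) =
         (\<integral>\<^sup>+s. f (2 * arctan s) * ennreal (2 / (1 + s\<^sup>2)) \<partial>lborel)"
proof -
  have "(\<integral>\<^sup>+t. f t * indicator {-pi<..<pi} t \<partial>lborel) =
         (\<integral>\<^sup>+s. f (2 * arctan s) * ennreal (2 / (1 + s\<^sup>2)) * indicator UNIV s \<partial>lborel)"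
  proof (rule nn_integral_substitution_exhaustion[where a="\<lambda>n. - real (Suc n)" and b="\<lambda>n. real (Suc n)"])
    show "(\<Union>n. {- real (Suc n)..real (Suc n)}) = UNIV"
    proof (intro equalityI subsetI)
      fix x :: real
      obtain n where "\<bar>x\<bar> \<le> real n" using real_arch_simple by blast
      hence "x \<in> {- real (Suc n)..real (Suc n)}" by auto
      thus "x \<in> (\<Union>n. {- real (Suc n)..real (Suc n)})" by blast
    qed simp
    show "incseq (\<lambda>n. {2 * arctan (- real (Suc n))..2 * arctan (real (Suc n))})"
      by (auto simp: incseq_def arctan_minus intro: order_trans arctan_le_iff[THEN iffD2])
    show "(\<Union>n. {2 * arctan (- real (Suc n))..2 * arctan (real (Suc n))}) = {- pi<..<pi}"
    proof (intro equalityI subsetI)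
      fix t assume "t \<in> (\<Union>n. {2 * arctan (- real (Suc n))..2 * arctan (real (Suc n))})"
      then obtain n where "2 * arctan (- real (Suc n)) \<le> t" "t \<le> 2 * arctan (real (Suc n))" by auto
      thus "t \<in> {- pi<..<pi}"
        using arctan_lbound[of "- real (Suc n)"] arctan_ubound[of "real (Suc n)"] by simp
    next
      fix t :: real assume t: "t \<in> {- pi<..<pi}"
      obtain n where n: "\<bar>tan (t / 2)\<bar> \<le> real n" using real_arch_simple by blast
      have e: "arctan (tan (t / 2)) = t / 2" using t by (intro arctan_tan) auto
      have "arctan (- real (Suc n)) \<le> arctan (tan (t / 2))" "arctan (tan (t / 2)) \<le> arctan (real (Suc n))"
        using n by (intro arctan_le_iff[THEN iffD2]; simp)+
      hence "t \<in> {2 * arctan (- real (Suc n))..2 * arctan (real (Suc n))}" unfolding e by simp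
      thus "t \<in> (\<Union>n. {2 * arctan (- real (Suc n))..2 * arctan (real (Suc n))})" by blast
    qed
    show "((\<lambda>s. 2 * arctan s) has_real_derivative 2 / (1 + s\<^sup>2)) (at s)" for s
      by (auto intro!: derivative_eq_intros simp: field_simps)
    show "continuous_on UNIV (\<lambda>s::real. 2 / (1 + s\<^sup>2))"
      by (intro continuous_intros) (simp add: one_plus_square_nonzero)
  qed (auto simp: incseq_def add_nonneg_nonneg)
  thus ?thesis by simp
qed

text \<open>For negative \<open>q\<close> the substitution \<open>y = 1 / (q\<^sup>2 k)\<close> is increasing.\<close>

lemma nn_integral_inverse_square_substitution:
  fixes f :: "real \<Rightarrow> ennreal"
  assumes [measurable]: "f \<in> borel_measurable borel" and k: "k > 0"
  shows "(\<integral>\<^sup>+y. f y * indicator {0<..} y \<partial>lborel) =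
         (\<integral>\<^sup>+q. f (1 / (q\<^sup>2 * k)) * ennreal (- 2 / (q ^ 3 * k)) * indicator {..<0} q \<partial>lborel)"
proof (rule nn_integral_substitution_exhaustion[where a="\<lambda>n. - real (n + 2)" and b="\<lambda>n. - 1 / real (n + 2)"])
  have val: "1 / ((- real (n + 2))\<^sup>2 * k) = 1 / (real (n + 2))\<^sup>2 / k" "1 / ((- 1 / real (n + 2))\<^sup>2 * k) = (real (n + 2))\<^sup>2 / k" for n
  proof -
    have "1 / ((- r)\<^sup>2 * k) = 1 / r\<^sup>2 / k" "1 / ((- 1 / r)\<^sup>2 * k) = r\<^sup>2 / k" for r
      by (simp_all add: power_divide)
    thus "1 / ((- real (n + 2))\<^sup>2 * k) = 1 / (real (n + 2))\<^sup>2 / k" "1 / ((- 1 / real (n + 2))\<^sup>2 * k) = (real (n + 2))\<^sup>2 / k" .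
  qed
  show "- real (n + 2) < - 1 / real (n + 2)" for n
  proof -
    have "1 / real (n + 2) < 1" by simp
    also have "1 < real (n + 2)" by simp
    finally show ?thesis by simp
  qed
  have mono: "1 / real (n + 2) \<le> 1 / real (m + 2)" if "m \<le> n" for m n
    using that by (intro divide_left_mono) auto
  show "incseq (\<lambda>n. {- real (n + 2)..- 1 / real (n + 2)})"
    using mono by (fastforce simp: incseq_def)
  show "(\<Union>n. {- real (n + 2)..- 1 / real (n + 2)}) = {..<0}"
  proof (intro equalityI subsetI)
    fix x assume "x \<in> (\<Union>n. {- real (n + 2)..- 1 / real (n + 2)})"
    then obtain n where "x \<le> - 1 / real (n + 2)" by auto
    also have "\<dots> < 0" by simp
    finally show "x \<in> {..<0}" by simp
  next
    fix x :: real assume x: "x \<in> {..<0}"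
    obtain n where n: "max (- x) (- 1 / x) \<le> real n" using real_arch_simple by blast
    have "- 1 / x \<le> real (n + 2)" using n by simp
    hence "x \<le> - 1 / real (n + 2)" using x by (simp add: field_simps)
    hence "x \<in> {- real (n + 2)..- 1 / real (n + 2)}" using n by auto
    thus "x \<in> (\<Union>n. {- real (n + 2)..- 1 / real (n + 2)})" by blast
  qed
  have mono2: "1 / (real (n + 2))\<^sup>2 / k \<le> 1 / (real (m + 2))\<^sup>2 / k" "(real (m + 2))\<^sup>2 / k \<le> (real (n + 2))\<^sup>2 / k" if "m \<le> n" for m n
    using that k by (intro divide_right_mono divide_left_mono power_mono; simp)+
  show "incseq (\<lambda>n. {1 / ((- real (n + 2))\<^sup>2 * k)..1 / ((- 1 / real (n + 2))\<^sup>2 * k)})"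
    unfolding val incseq_def using mono2 by (auto intro: order_trans)
  show "(\<Union>n. {1 / ((- real (n + 2))\<^sup>2 * k)..1 / ((- 1 / real (n + 2))\<^sup>2 * k)}) = {0<..}"
    unfolding val
  proof (intro equalityI subsetI)
    fix x assume "x \<in> (\<Union>n. {1 / (real (n + 2))\<^sup>2 / k..(real (n + 2))\<^sup>2 / k})"
    then obtain n where "1 / (real (n + 2))\<^sup>2 / k \<le> x" by auto
    moreover have "0 < 1 / (real (n + 2))\<^sup>2 / k" using k by simp
    ultimately show "x \<in> {0<..}" by (meson greaterThan_iff less_le_trans)
  next
    fix x :: real assume x: "x \<in> {0<..}"
    obtain n where n: "max (x * k) (1 / (x * k)) \<le> real n" using real_arch_simple by blast
    have sq: "real n \<le> (real (n + 2))\<^sup>2" by (simp add: power2_eq_square algebra_simps)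
    have "x * k \<le> (real (n + 2))\<^sup>2" "1 / (x * k) \<le> (real (n + 2))\<^sup>2" using n sq by auto
    hence "x \<in> {1 / (real (n + 2))\<^sup>2 / k..(real (n + 2))\<^sup>2 / k}" using x k by (simp add: field_simps)
    thus "x \<in> (\<Union>n. {1 / (real (n + 2))\<^sup>2 / k..(real (n + 2))\<^sup>2 / k})" by blast
  qed
  show "((\<lambda>q. 1 / (q\<^sup>2 * k)) has_real_derivative - 2 / (q ^ 3 * k)) (at q)" if "q \<in> {..<0}" for q
    using that k by (auto intro!: derivative_eq_intros simp: field_simps power2_eq_square power3_eq_cube)
  show "continuous_on {..<0} (\<lambda>q. - 2 / (q ^ 3 * k))" using k by (intro continuous_intros) auto
  show "0 \<le> - 2 / (q ^ 3 * k)" if "q \<in> {..<0}" for q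
  proof -
    have "q ^ 3 * k \<le> 0" using that k by (simp add: power3_eq_cube mult_le_0_iff zero_le_mult_iff)
    thus ?thesis by (simp add: divide_nonpos_nonpos)
  qed
qed auto

lemma borel_measurable_Complex [measurable (raw)]:
  assumes [measurable]: "f \<in> borel_measurable M" "g \<in> borel_measurable M"
  shows "(\<lambda>x. Complex (f x) (g x)) \<in> borel_measurable M"
  unfolding Complex_eq by measurable

lemma borel_measurable_cis [measurable]: "cis \<in> borel_measurable borel"
  unfolding cis.ctr by measurable

lemma horo_chart_measurable [measurable]: "horo_chart \<in> borel_measurable borel"
proof -
  have "horo_chart \<in> borel \<Otimes>\<^sub>M (borel \<Otimes>\<^sub>M borel) \<rightarrow>\<^sub>M borel \<Otimes>\<^sub>M borel"
    unfolding horo_chart_def split_beta Complex_eq by measurable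
  thus ?thesis by (simp add: borel_prod)
qed

lemma cis_two_arctan: "cis (2 * arctan s) = - (Complex s (- 1) / Complex s 1)"
proof -
  have nz: "1 + s\<^sup>2 \<noteq> 0" "Complex s 1 \<noteq> 0" by (simp_all add: one_plus_square_nonzero complex_eq_iff)
  have c: "cos (arctan s) ^ 2 = 1 / (1 + s\<^sup>2)" by (simp add: cos_arctan power_divide)
  have sc: "sin (arctan s) = s * cos (arctan s)" by (simp add: sin_arctan cos_arctan)
  have "cis (2 * arctan s) = cis (arctan s) * cis (arctan s)" by (simp add: cis_mult)
  also have "\<dots> = of_real (cos (arctan s) ^ 2) * (Complex 1 s * Complex 1 s)"
    by (simp add: complex_eq_iff sc power2_eq_square algebra_simps)
  also have "\<dots> = - (Complex s (- 1) / Complex s 1)"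
  proof -
    have "of_real (1 / (1 + s\<^sup>2)) * (Complex 1 s * Complex 1 s) * Complex s 1 = - Complex s (- 1)"
      unfolding complex_eq_iff using nz(1) by (simp add: field_simps power2_eq_square)
    hence "of_real (1 / (1 + s\<^sup>2)) * (Complex 1 s * Complex 1 s) = - Complex s (- 1) / Complex s 1"
      by (rule nonzero_eq_divide_eq[OF nz(2), THEN iffD2])
    thus ?thesis unfolding c minus_divide_left .
  qed
  finally show ?thesis .
qed

lemma nn_integral_period_shift:
  fixes f :: "real \<Rightarrow> ennreal"
  assumes [measurable]: "f \<in> borel_measurable borel" and per: "\<And>t. f (t + 2 * pi) = f t"
  shows "(\<integral>\<^sup>+t. f t * indicator {0..<2 * pi} t \<partial>lborel) = (\<integral>\<^sup>+t. f t * indicator {-pi<..<pi} t \<partial>lborel)"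
proof -
  have "(\<integral>\<^sup>+t. f t * indicator {0..<2 * pi} t \<partial>lborel) =
      (\<integral>\<^sup>+t. f t * indicator {0..<pi} t + f t * indicator {pi..<2 * pi} t \<partial>lborel)"
    by (intro nn_integral_cong) (auto simp: indicator_def)
  also have "\<dots> = (\<integral>\<^sup>+t. f t * indicator {0..<pi} t \<partial>lborel) + (\<integral>\<^sup>+t. f t * indicator {pi..<2 * pi} t \<partial>lborel)"
    by (rule nn_integral_add) auto
  also have "(\<integral>\<^sup>+t. f t * indicator {pi..<2 * pi} t \<partial>lborel) = (\<integral>\<^sup>+t. f (2 * pi + 1 * t) * indicator {pi..<2 * pi} (2 * pi + 1 * t) \<partial>lborel)"
    using nn_integral_real_affine[of "\<lambda>t. f t * indicator {pi..<2 * pi} t" 1 "2 * pi"] by simp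
  also have "\<dots> = (\<integral>\<^sup>+t. f t * indicator {-pi..<0} t \<partial>lborel)"
    using per by (intro nn_integral_cong) (auto simp: indicator_def add.commute)
  also have "(\<integral>\<^sup>+t. f t * indicator {0..<pi} t \<partial>lborel) + (\<integral>\<^sup>+t. f t * indicator {-pi..<0} t \<partial>lborel) =
      (\<integral>\<^sup>+t. f t * indicator {0..<pi} t + f t * indicator {-pi..<0} t \<partial>lborel)"
    by (rule nn_integral_add[symmetric]) auto
  also have "\<dots> = (\<integral>\<^sup>+t. f t * indicator {-pi<..<pi} t \<partial>lborel)"
    by (rule nn_integral_lborel_cong_except[of "- pi"]) (auto simp: indicator_def)
  finally show ?thesis .
qed

lemma nn_integral_liouville_coordinates:
  fixes g :: "complex \<times> complex \<Rightarrow> ennreal"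
  assumes g[measurable]: "g \<in> borel_measurable borel"
  shows "(\<integral>\<^sup>+v. g v \<partial>liouville) =
    (\<integral>\<^sup>+t. (\<integral>\<^sup>+y. (\<integral>\<^sup>+x. g (Complex x y, cis t) \<partial>lborel) * ennreal (1 / y\<^sup>2) * indicator {0<..} y \<partial>lborel)
       * indicator {0..<2 * pi} t \<partial>lborel)"
proof -
  have g'[measurable]: "g \<in> borel_measurable (borel \<Otimes>\<^sub>M borel)" using g by (simp only: borel_prod)
  let ?f = "\<lambda>(x::real, y, \<theta>). (Complex x y, cis \<theta>)"
  let ?R = "restrict_space lborel coord_domain"
  let ?w = "\<lambda>(x::real, y::real, \<theta>::real). ennreal (1 / y\<^sup>2)"
  let ?h = "\<lambda>(x, y, t). g (Complex x y, cis t) * ennreal (1 / y\<^sup>2) * indicator {0<..} y * indicator {0..<2 * pi} t"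
  have f0[measurable]: "?f \<in> borel_measurable borel"
    by (rule borel_measurable_continuous_onI) (auto simp: Complex_eq split_beta intro!: continuous_intros)
  have w: "?w \<in> borel_measurable borel" by (simp add: borel_prod[symmetric])
  have wR: "?w \<in> borel_measurable ?R" using w by (intro measurable_restrict_space1) simp
  have gR: "g \<in> borel_measurable (restrict_space borel T1H)" by (intro measurable_restrict_space1 g)
  have f: "?f \<in> measurable (density ?R ?w) (restrict_space borel T1H)"
    using coord_measurable by (simp add: measurable_cong_sets[OF sets_density refl])
  have gf: "(\<lambda>p. g (?f p)) \<in> borel_measurable ?R"
    by (rule measurable_compose[OF coord_measurable gR])
  have gf0: "(\<lambda>p. g (?f p)) \<in> borel_measurable borel" by (rule measurable_compose[OF f0 g])
  have h: "?h \<in> borel_measurable borel"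
  proof -
    have "?h = (\<lambda>p. g (?f p) * ?w p * indicator {0<..} (fst (snd p)) * indicator {0..<2 * pi} (snd (snd p)))"
      by auto
    also have "\<dots> \<in> borel_measurable borel"
      by (intro borel_measurable_times_ennreal gf0 w) (simp_all add: borel_prod[symmetric])
    finally show ?thesis .
  qed
  have "(\<integral>\<^sup>+v. g v \<partial>liouville) = (\<integral>\<^sup>+p. g (?f p) \<partial>density ?R ?w)"
    unfolding liouville_def by (rule nn_integral_distr[OF f]) (simp add: gR)
  also have "\<dots> = (\<integral>\<^sup>+p. ?w p * g (?f p) \<partial>?R)" by (rule nn_integral_density[OF wR gf])
  also have "\<dots> = (\<integral>\<^sup>+p. ?w p * g (?f p) * indicator coord_domain p \<partial>lborel)"
    using coord_domain_borel by (intro nn_integral_restrict_space) simp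
  also have "\<dots> = (\<integral>\<^sup>+p. ?h p \<partial>lborel)"
    by (intro nn_integral_cong) (auto simp: indicator_def mult.commute)
  also have "\<dots> = (\<integral>\<^sup>+x. \<integral>\<^sup>+z. ?h (x, z) \<partial>lborel \<partial>lborel)" by (rule nn_integral_lborel_pair[OF h])
  also have "\<dots> = (\<integral>\<^sup>+z. \<integral>\<^sup>+x. ?h (x, z) \<partial>lborel \<partial>lborel)"
    by (rule lborel_pair.Fubini'[symmetric]) (use h in \<open>simp add: lborel_prod\<close>)
  also have "\<dots> = (\<integral>\<^sup>+y. \<integral>\<^sup>+t. \<integral>\<^sup>+x. ?h (x, y, t) \<partial>lborel \<partial>lborel \<partial>lborel)"
    by (rule nn_integral_lborel_pair) (unfold borel_prod[symmetric] case_prod_conv, measurable)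
  also have "\<dots> = (\<integral>\<^sup>+t. \<integral>\<^sup>+y. \<integral>\<^sup>+x. ?h (x, y, t) \<partial>lborel \<partial>lborel \<partial>lborel)"
    by (rule lborel_pair.Fubini'[symmetric]) (unfold case_prod_conv, measurable)
  also have "\<dots> = (\<integral>\<^sup>+t. (\<integral>\<^sup>+y. (\<integral>\<^sup>+x. g (Complex x y, cis t) \<partial>lborel) * ennreal (1 / y\<^sup>2) * indicator {0<..} y \<partial>lborel)
       * indicator {0..<2 * pi} t \<partial>lborel)"
    by (simp add: nn_integral_multc)
  finally show ?thesis .
qed

section \<open>Liouville measure in horocycle coordinates\<close>

text \<open>The vector \<open>(X + \<i> Y, \<theta>)\<close> with chart coordinates \<open>(p, q, s)\<close> has \<open>\<theta> = 2 arctan s\<close>,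
  \<open>Y = 1 / (q\<^sup>2 (1 + s\<^sup>2))\<close>, and \<open>X\<close> differs from \<open>p / q\<close> by a function of \<open>q\<close> and \<open>s\<close>. Hence
  \<open>dX = dp / \<bar>q\<bar>\<close>, \<open>dY / Y\<^sup>2 = 2 (1 + s\<^sup>2) \<bar>q\<bar> dq\<close> and \<open>d\<theta> = 2 ds / (1 + s\<^sup>2)\<close>, which makes
  \<open>4 dp dq ds\<close> on the half space \<open>q < 0\<close>. Since \<open>(p, q, s)\<close> and \<open>(-p, -q, s)\<close> give the same vector,
  this is \<open>2 dp dq ds\<close> on the whole space.\<close>

lemma nn_integral_liouville_chart:
  fixes g :: "complex \<times> complex \<Rightarrow> ennreal"
  assumes g: "g \<in> borel_measurable borel"
  shows "(\<integral>\<^sup>+v. g v \<partial>liouville) =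
    2 * (\<integral>\<^sup>+s. \<integral>\<^sup>+q. \<integral>\<^sup>+p. g (horo_chart (p, q, s)) \<partial>lborel \<partial>lborel \<partial>lborel)"
proof -
  have g'[measurable]: "g \<in> borel_measurable (borel \<Otimes>\<^sub>M borel)" using g by (simp only: borel_prod)
  define G where "G x = g (horo_chart x)" for x
  have G[measurable]: "G \<in> borel_measurable (borel \<Otimes>\<^sub>M borel \<Otimes>\<^sub>M borel)"
    unfolding G_def borel_prod by (rule measurable_compose[OF horo_chart_measurable g])
  define F where "F t = (\<integral>\<^sup>+y. (\<integral>\<^sup>+x. g (Complex x y, cis t) \<partial>lborel) * ennreal (1 / y\<^sup>2) * indicator {0<..} y \<partial>lborel)" for t
  have Fm[measurable]: "F \<in> borel_measurable borel" unfolding F_def by measurable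
  have per: "F (t + 2 * pi) = F t" for t
  proof -
    have "cis (t + 2 * pi) = cis t" by (simp add: cis_mult[symmetric])
    thus ?thesis by (simp only: F_def)
  qed
  define J where "J q s = (\<integral>\<^sup>+p. G (p, q, s) \<partial>lborel)" for q s
  have Jm[measurable]: "case_prod J \<in> borel_measurable (borel \<Otimes>\<^sub>M borel)" unfolding J_def by measurable
  have Jsym: "J (- q) s = J q s" for q s
  proof -
    have "J (- q) s = (\<integral>\<^sup>+p. G (0 + (- 1) * p, - q, s) \<partial>lborel)"
      unfolding J_def by (subst nn_integral_real_affine[of _ "- 1" 0]) auto
    thus ?thesis by (simp add: J_def G_def horo_chart_def)
  qed
  have Jhalf: "(\<integral>\<^sup>+q. J q s \<partial>lborel) = 2 * (\<integral>\<^sup>+q. J q s * indicator {..<0} q \<partial>lborel)" for s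
  proof -
    have "(\<integral>\<^sup>+q. J q s \<partial>lborel) = (\<integral>\<^sup>+q. J q s * indicator {..<0} q + J q s * indicator {0<..} q \<partial>lborel)"
      by (rule nn_integral_lborel_cong_except[of 0]) (auto simp: indicator_def)
    also have "\<dots> = (\<integral>\<^sup>+q. J q s * indicator {..<0} q \<partial>lborel) + (\<integral>\<^sup>+q. J q s * indicator {0<..} q \<partial>lborel)"
      by (rule nn_integral_add) auto
    also have "(\<integral>\<^sup>+q. J q s * indicator {0<..} q \<partial>lborel) = (\<integral>\<^sup>+q. J (0 + (- 1) * q) s * indicator {0<..} (0 + (- 1) * q) \<partial>lborel)"
      by (subst nn_integral_real_affine[of _ "- 1" 0]) auto
    also have "\<dots> = (\<integral>\<^sup>+q. J q s * indicator {..<0} q \<partial>lborel)"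
      by (intro nn_integral_cong) (auto simp: Jsym indicator_def)
    finally show ?thesis by (simp add: mult_2)
  qed
  have Fs: "F (2 * arctan s) * ennreal (2 / (1 + s\<^sup>2)) = 2 * (\<integral>\<^sup>+q. J q s \<partial>lborel)" for s
  proof -
    define k where "k = 1 + s\<^sup>2"
    have k: "k > 0" by (simp add: k_def add_pos_nonneg)
    define u where "u = cis (2 * arctan s)"
    have "F (2 * arctan s) = (\<integral>\<^sup>+q. (\<integral>\<^sup>+x. g (Complex x (1 / (q\<^sup>2 * k)), u) \<partial>lborel) * ennreal (1 / (1 / (q\<^sup>2 * k))\<^sup>2)
        * ennreal (- 2 / (q ^ 3 * k)) * indicator {..<0} q \<partial>lborel)"
      unfolding F_def u_def[symmetric] by (rule nn_integral_inverse_square_substitution[OF _ k]) measurable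
    also have "\<dots> = (\<integral>\<^sup>+q. ennreal (2 * k) * (J q s * indicator {..<0} q) \<partial>lborel)"
    proof (rule nn_integral_cong)
      fix q :: real
      show "(\<integral>\<^sup>+x. g (Complex x (1 / (q\<^sup>2 * k)), u) \<partial>lborel) * ennreal (1 / (1 / (q\<^sup>2 * k))\<^sup>2)
        * ennreal (- 2 / (q ^ 3 * k)) * indicator {..<0} q = ennreal (2 * k) * (J q s * indicator {..<0} q)"
      proof (cases "q < 0")
        case True
        have "(\<integral>\<^sup>+x. g (Complex x (1 / (q\<^sup>2 * k)), u) \<partial>lborel) =
            ennreal \<bar>1 / q\<bar> * (\<integral>\<^sup>+p. g (Complex (- s / (q\<^sup>2 * k) + 1 / q * p) (1 / (q\<^sup>2 * k)), u) \<partial>lborel)"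
          using True by (intro nn_integral_real_affine) auto
        also have "(\<integral>\<^sup>+p. g (Complex (- s / (q\<^sup>2 * k) + 1 / q * p) (1 / (q\<^sup>2 * k)), u) \<partial>lborel) = J q s"
          unfolding J_def G_def horo_chart_def k_def u_def cis_two_arctan by (simp add: algebra_simps)
        finally have "(\<integral>\<^sup>+x. g (Complex x (1 / (q\<^sup>2 * k)), u) \<partial>lborel) * ennreal (1 / (1 / (q\<^sup>2 * k))\<^sup>2) * ennreal (- 2 / (q ^ 3 * k))
            = (ennreal \<bar>1 / q\<bar> * ennreal (1 / (1 / (q\<^sup>2 * k))\<^sup>2) * ennreal (- 2 / (q ^ 3 * k))) * J q s"
          by (simp only: mult_ac)
        also have "ennreal \<bar>1 / q\<bar> * ennreal (1 / (1 / (q\<^sup>2 * k))\<^sup>2) * ennreal (- 2 / (q ^ 3 * k)) =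
            ennreal (\<bar>1 / q\<bar> * (1 / (1 / (q\<^sup>2 * k))\<^sup>2) * (- 2 / (q ^ 3 * k)))"
        proof -
          have "q ^ 3 * k \<le> 0" using True k by (simp add: power3_eq_cube mult_le_0_iff zero_le_mult_iff)
          hence "0 \<le> - 2 / (q ^ 3 * k)" by (simp add: divide_nonpos_nonpos)
          thus ?thesis by (simp only: ennreal_mult'' ennreal_mult' abs_ge_zero zero_le_mult_iff zero_le_divide_1_iff zero_le_power2 simp_thms)
        qed
        also have "\<bar>1 / q\<bar> * (1 / (1 / (q\<^sup>2 * k))\<^sup>2) * (- 2 / (q ^ 3 * k)) = 2 * k"
          using True k by (simp add: field_simps power2_eq_square power3_eq_cube)
        finally show ?thesis using True by simp
      qed simp
    qed
    also have "\<dots> = ennreal (2 * k) * (\<integral>\<^sup>+q. J q s * indicator {..<0} q \<partial>lborel)"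
      by (rule nn_integral_cmult) measurable
    finally have "F (2 * arctan s) * ennreal (2 / (1 + s\<^sup>2)) =
        (ennreal (2 * k) * ennreal (2 / k)) * (\<integral>\<^sup>+q. J q s * indicator {..<0} q \<partial>lborel)"
      by (simp add: k_def mult_ac)
    also have "ennreal (2 * k) * ennreal (2 / k) = 4"
    proof -
      have "ennreal (2 * k) * ennreal (2 / k) = ennreal (2 * k * (2 / k))"
        using k by (subst ennreal_mult) auto
      thus ?thesis using k by simp
    qed
    also have "4 * (\<integral>\<^sup>+q. J q s * indicator {..<0} q \<partial>lborel) = 2 * (\<integral>\<^sup>+q. J q s \<partial>lborel)"
      by (simp add: Jhalf mult.assoc[symmetric])
    finally show ?thesis .
  qed
  have "(\<integral>\<^sup>+v. g v \<partial>liouville) = (\<integral>\<^sup>+t. F t * indicator {0..<2 * pi} t \<partial>lborel)"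
    unfolding F_def by (rule nn_integral_liouville_coordinates[OF g])
  also have "\<dots> = (\<integral>\<^sup>+t. F t * indicator {-pi<..<pi} t \<partial>lborel)" by (rule nn_integral_period_shift[OF Fm per])
  also have "\<dots> = (\<integral>\<^sup>+s. F (2 * arctan s) * ennreal (2 / (1 + s\<^sup>2)) \<partial>lborel)" by (rule nn_integral_arctan_substitution[OF Fm])
  also have "\<dots> = 2 * (\<integral>\<^sup>+s. \<integral>\<^sup>+q. J q s \<partial>lborel \<partial>lborel)" unfolding Fs by (rule nn_integral_cmult) measurable
  finally show ?thesis by (simp add: J_def G_def)
qed

text \<open>If \<open>a\<close> is nonzero, the map is a substitution in \<open>p\<close> followed by one in \<open>q\<close>, with Jacobians \<open>1 / \<bar>a\<bar>\<close>
  and \<open>\<bar>a\<bar>\<close>.\<close>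

lemma nn_integral_plane_SL2_aux:
  fixes H :: "real \<times> real \<Rightarrow> ennreal"
  assumes [measurable]: "H \<in> borel_measurable (borel \<Otimes>\<^sub>M borel)" and det: "a * d - b * c = (1::real)"
    and a: "a \<noteq> 0"
  shows "(\<integral>\<^sup>+q. \<integral>\<^sup>+p. H (a * p + b * q, c * p + d * q) \<partial>lborel \<partial>lborel) = (\<integral>\<^sup>+q. \<integral>\<^sup>+p. H (p, q) \<partial>lborel \<partial>lborel)"
proof -
  have "(\<integral>\<^sup>+p. H (a * p + b * q, c * p + d * q) \<partial>lborel) =
      ennreal (1 / \<bar>a\<bar>) * (\<integral>\<^sup>+p. H (p, c / a * p + 1 / a * q) \<partial>lborel)" for q
  proof -
    have "(\<integral>\<^sup>+p. H (a * p + b * q, c * p + d * q) \<partial>lborel) =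
        ennreal \<bar>1 / a\<bar> * (\<integral>\<^sup>+p. H (a * (- b * q / a + 1 / a * p) + b * q, c * (- b * q / a + 1 / a * p) + d * q) \<partial>lborel)"
      using a by (intro nn_integral_real_affine[of "\<lambda>p. H (a * p + b * q, c * p + d * q)"]) auto
    moreover have "a * (- b * q / a + 1 / a * p) + b * q = p" for p using a by (simp add: field_simps)
    moreover have "c * (- b * q / a + 1 / a * p) + d * q = c / a * p + (a * d - b * c) / a * q" for p
      using a by (simp add: field_simps)
    ultimately show ?thesis using det by simp
  qed
  hence "(\<integral>\<^sup>+q. \<integral>\<^sup>+p. H (a * p + b * q, c * p + d * q) \<partial>lborel \<partial>lborel) =
      ennreal (1 / \<bar>a\<bar>) * (\<integral>\<^sup>+q. \<integral>\<^sup>+p. H (p, c / a * p + 1 / a * q) \<partial>lborel \<partial>lborel)"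
    by (simp add: nn_integral_cmult)
  also have "(\<integral>\<^sup>+q. \<integral>\<^sup>+p. H (p, c / a * p + 1 / a * q) \<partial>lborel \<partial>lborel) = (\<integral>\<^sup>+p. \<integral>\<^sup>+q. H (p, c / a * p + 1 / a * q) \<partial>lborel \<partial>lborel)"
    by (rule lborel_pair.Fubini') measurable
  also have "\<dots> = (\<integral>\<^sup>+p. ennreal \<bar>a\<bar> * (\<integral>\<^sup>+q. H (p, q) \<partial>lborel) \<partial>lborel)"
  proof (rule nn_integral_cong)
    fix p :: real
    have "(\<integral>\<^sup>+q. H (p, c / a * p + 1 / a * q) \<partial>lborel) = ennreal \<bar>a\<bar> * (\<integral>\<^sup>+q. H (p, c / a * p + 1 / a * (- c * p + a * q)) \<partial>lborel)"
      using a by (intro nn_integral_real_affine) auto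
    moreover have "c / a * p + 1 / a * (- c * p + a * q) = q" for q using a by (simp add: field_simps)
    ultimately show "(\<integral>\<^sup>+q. H (p, c / a * p + 1 / a * q) \<partial>lborel) = ennreal \<bar>a\<bar> * (\<integral>\<^sup>+q. H (p, q) \<partial>lborel)" by simp
  qed
  also have "\<dots> = ennreal \<bar>a\<bar> * (\<integral>\<^sup>+p. \<integral>\<^sup>+q. H (p, q) \<partial>lborel \<partial>lborel)" by (rule nn_integral_cmult) measurable
  also have "(\<integral>\<^sup>+p. \<integral>\<^sup>+q. H (p, q) \<partial>lborel \<partial>lborel) = (\<integral>\<^sup>+q. \<integral>\<^sup>+p. H (p, q) \<partial>lborel \<partial>lborel)"
    by (rule lborel_pair.Fubini') measurable
  finally show ?thesis using a
    by (simp add: mult.assoc[symmetric] ennreal_mult[symmetric])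
qed

lemma nn_integral_plane_SL2:
  fixes H :: "real \<times> real \<Rightarrow> ennreal"
  assumes [measurable]: "H \<in> borel_measurable (borel \<Otimes>\<^sub>M borel)" and det: "a * d - b * c = (1::real)"
  shows "(\<integral>\<^sup>+q. \<integral>\<^sup>+p. H (a * p + b * q, c * p + d * q) \<partial>lborel \<partial>lborel) = (\<integral>\<^sup>+q. \<integral>\<^sup>+p. H (p, q) \<partial>lborel \<partial>lborel)"
proof (cases "a = 0")
  case False
  thus ?thesis using nn_integral_plane_SL2_aux[OF assms] by blast
next
  case True
  hence b: "a + b \<noteq> 0" using det by auto
  \<comment> \<open>Shearing \<open>q\<close> by \<open>p\<close> replaces \<open>a\<close> by \<open>a + b\<close>.\<close>
  have "(\<integral>\<^sup>+q. \<integral>\<^sup>+p. H (a * p + b * q, c * p + d * q) \<partial>lborel \<partial>lborel) =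
      (\<integral>\<^sup>+p. \<integral>\<^sup>+q. H (a * p + b * q, c * p + d * q) \<partial>lborel \<partial>lborel)"
    by (rule lborel_pair.Fubini') measurable
  also have "\<dots> = (\<integral>\<^sup>+p. \<integral>\<^sup>+q. H (a * p + b * (p + 1 * q), c * p + d * (p + 1 * q)) \<partial>lborel \<partial>lborel)"
  proof (rule nn_integral_cong)
    fix p :: real
    show "(\<integral>\<^sup>+q. H (a * p + b * q, c * p + d * q) \<partial>lborel) =
        (\<integral>\<^sup>+q. H (a * p + b * (p + 1 * q), c * p + d * (p + 1 * q)) \<partial>lborel)"
      by (subst nn_integral_real_affine[of _ 1 p]) auto
  qed
  also have "\<dots> = (\<integral>\<^sup>+q. \<integral>\<^sup>+p. H (a * p + b * (p + 1 * q), c * p + d * (p + 1 * q)) \<partial>lborel \<partial>lborel)"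
    by (rule lborel_pair.Fubini') measurable
  also have "\<dots> = (\<integral>\<^sup>+q. \<integral>\<^sup>+p. H ((a + b) * p + b * q, (c + d) * p + d * q) \<partial>lborel \<partial>lborel)"
    by (simp add: algebra_simps)
  also have "\<dots> = (\<integral>\<^sup>+q. \<integral>\<^sup>+p. H (p, q) \<partial>lborel \<partial>lborel)"
    using det b by (intro nn_integral_plane_SL2_aux) (simp_all add: algebra_simps)
  finally show ?thesis .
qed

lemma emeasure_lborel_plane:
  assumes S: "S \<in> sets (borel :: (real \<times> real) measure)"
  shows "emeasure lborel S = (\<integral>\<^sup>+q. \<integral>\<^sup>+p. indicator S (p, q) \<partial>lborel \<partial>lborel)"
proof -
  have [measurable]: "S \<in> sets (borel \<Otimes>\<^sub>M borel)" using S by (simp only: borel_prod)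
  have "emeasure lborel S = (\<integral>\<^sup>+x. indicator S x \<partial>lborel)" using S by simp
  also have "\<dots> = (\<integral>\<^sup>+p. \<integral>\<^sup>+q. indicator S (p, q) \<partial>lborel \<partial>lborel)"
    using S by (intro nn_integral_lborel_pair) simp
  also have "\<dots> = (\<integral>\<^sup>+q. \<integral>\<^sup>+p. indicator S (p, q) \<partial>lborel \<partial>lborel)"
    by (rule lborel_pair.Fubini') measurable
  finally show ?thesis .
qed

section \<open>Invariance and the modular domain\<close>

lemma sets_liouville: "sets liouville = sets (restrict_space borel T1H)"
  unfolding liouville_def by (rule sets_distr)

lemma space_liouville: "space liouville = T1H"
  unfolding liouville_def by (simp add: space_restrict_space)

lemma T1H_borel [measurable]: "T1H \<in> sets borel"
proof -
  have "T1H = {v. 0 < Im (fst v)} \<inter> {v. norm (snd v) = 1}" by (auto simp: T1H_def)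
  moreover have "{v :: complex \<times> complex. 0 < Im (fst v)} \<in> sets borel"
    by (intro borel_open open_Collect_less continuous_intros)
  moreover have "{v :: complex \<times> complex. norm (snd v) = 1} \<in> sets borel"
    by (intro borel_closed closed_Collect_eq continuous_intros)
  ultimately show ?thesis by (metis sets.Int)
qed

lemma borel_measurable_tangent_act:
  fixes g :: "complex \<times> complex \<Rightarrow> ennreal"
  assumes "A \<in> SL2R" "g \<in> borel_measurable borel"
  shows "(\<lambda>v. g (tangent_act A v)) \<in> borel_measurable (restrict_space borel T1H)"
  by (rule measurable_compose[OF borel_measurable_continuous_on_restrict[OF continuous_on_tangent_act[OF assms(1)]] assms(2)])

text \<open>In the chart, \<open>A\<close> acts on \<open>(p, q)\<close> by a linear map of determinant one and on \<open>s\<close> by a translation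
  that depends on \<open>(p, q)\<close>.\<close>

lemma liouville_invariant:
  fixes g :: "complex \<times> complex \<Rightarrow> ennreal"
  assumes A: "A \<in> SL2R" and g: "g \<in> borel_measurable borel"
  shows "(\<integral>\<^sup>+v. g (tangent_act A v) \<partial>liouville) = (\<integral>\<^sup>+v. g v \<partial>liouville)"
proof -
  define a b c d where abcd: "a = A$1$1" "b = A$1$2" "c = A$2$1" "d = A$2$2"
  have det: "a * d - b * c = 1" using A by (simp add: SL2R_def det_2 abcd)
  define f where "f v = g (tangent_act A v) * indicator T1H v" for v
  have f: "f \<in> borel_measurable borel" unfolding f_def
    using borel_measurable_tangent_act[OF A g] by (subst (asm) borel_measurable_restrict_space_iff_ennreal) auto
  define G where "G x = g (horo_chart x)" for x
  have G[measurable]: "G \<in> borel_measurable (borel \<Otimes>\<^sub>M borel \<Otimes>\<^sub>M borel)"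
    unfolding G_def borel_prod by (rule measurable_compose[OF horo_chart_measurable g])
  define F where "F x = f (horo_chart x)" for x
  have F[measurable]: "F \<in> borel_measurable (borel \<Otimes>\<^sub>M borel \<Otimes>\<^sub>M borel)"
    unfolding F_def borel_prod by (rule measurable_compose[OF horo_chart_measurable f])
  define K where "K = (\<lambda>(p, q). \<integral>\<^sup>+s. G (p, q, s) \<partial>lborel)"
  have K[measurable]: "K \<in> borel_measurable (borel \<Otimes>\<^sub>M borel)" unfolding K_def by measurable
  have swap: "(\<integral>\<^sup>+s. \<integral>\<^sup>+q. \<integral>\<^sup>+p. X (p, q, s) \<partial>lborel \<partial>lborel \<partial>lborel) =
      (\<integral>\<^sup>+q. \<integral>\<^sup>+p. \<integral>\<^sup>+s. X (p, q, s) \<partial>lborel \<partial>lborel \<partial>lborel)"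
    if [measurable]: "X \<in> borel_measurable (borel \<Otimes>\<^sub>M borel \<Otimes>\<^sub>M borel)" for X :: "real \<times> real \<times> real \<Rightarrow> ennreal"
  proof -
    have "(\<integral>\<^sup>+s. \<integral>\<^sup>+q. \<integral>\<^sup>+p. X (p, q, s) \<partial>lborel \<partial>lborel \<partial>lborel) =
        (\<integral>\<^sup>+q. \<integral>\<^sup>+s. \<integral>\<^sup>+p. X (p, q, s) \<partial>lborel \<partial>lborel \<partial>lborel)"
      by (rule lborel_pair.Fubini') measurable
    also have "\<dots> = (\<integral>\<^sup>+q. \<integral>\<^sup>+p. \<integral>\<^sup>+s. X (p, q, s) \<partial>lborel \<partial>lborel \<partial>lborel)"
      by (intro nn_integral_cong lborel_pair.Fubini') measurable
    finally show ?thesis .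
  qed
  \<comment> \<open>\<open>A\<close> moves the chart point \<open>(p, q, s)\<close> to \<open>(a p + b q, c p + d q)\<close> and shifts \<open>s\<close> by a constant.\<close>
  have move: "F (p, q, s) = G (a * p + b * q, c * p + d * q, - c / (q * (c * p + d * q)) + 1 * s)"
    if q: "q \<noteq> 0" "c * p + d * q \<noteq> 0" for p q s
  proof -
    define B where "B = A ** coset_matrix p q s"
    have cm: "coset_matrix p q s \<in> SL2R" using q(1) by (rule coset_matrix_SL2R)
    have B: "B \<in> SL2R" "B$1$1 = a * p + b * q" "B$2$1 = c * p + d * q"
      using A cm by (simp_all add: B_def SL2R_mult matrix_mult_entries abcd)
    have "B$2$2 / B$2$1 = - c / (q * (c * p + d * q)) + s"
    proof -
      have "B$2$2 = s * (c * p + d * q) - c / q" by (simp add: B_def matrix_mult_entries abcd algebra_simps)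
      thus ?thesis using q by (simp add: B diff_divide_distrib)
    qed
    moreover have "B = coset_matrix (B$1$1) (B$2$1) (B$2$2 / B$2$1)"
      using SL2R_eq_coset_matrix[OF B(1)] B q by simp
    ultimately have "frame B = horo_chart (a * p + b * q, c * p + d * q, - c / (q * (c * p + d * q)) + 1 * s)"
      using frame_coset_matrix[of "B$2$1" "B$1$1" "B$2$2 / B$2$1"] q B by simp
    moreover have "frame B = tangent_act A (horo_chart (p, q, s))"
      unfolding B_def frame_mult[OF A cm] frame_coset_matrix[OF q(1)] ..
    moreover have "horo_chart (p, q, s) \<in> T1H"
      using frame_in_T1H[OF cm] frame_coset_matrix[OF q(1)] by simp
    ultimately show ?thesis by (simp add: F_def f_def G_def)
  qed
  have inner: "(\<integral>\<^sup>+s. F (p, q, s) \<partial>lborel) = K (a * p + b * q, c * p + d * q)"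
    if q: "q \<noteq> 0" "c * p + d * q \<noteq> 0" for p q
  proof -
    have "(\<integral>\<^sup>+s. F (p, q, s) \<partial>lborel) = (\<integral>\<^sup>+s. G (a * p + b * q, c * p + d * q, s) \<partial>lborel)"
      unfolding move[OF q]
      by (subst nn_integral_real_affine[of "\<lambda>s. G (a * p + b * q, c * p + d * q, s)" 1 "- c / (q * (c * p + d * q))"]) auto
    thus ?thesis by (simp add: K_def)
  qed
  have "(\<integral>\<^sup>+q. \<integral>\<^sup>+p. \<integral>\<^sup>+s. F (p, q, s) \<partial>lborel \<partial>lborel \<partial>lborel) =
        (\<integral>\<^sup>+q. \<integral>\<^sup>+p. K (a * p + b * q, c * p + d * q) \<partial>lborel \<partial>lborel)"
  proof (rule nn_integral_lborel_cong_except)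
    fix q :: real assume q: "q \<noteq> 0"
    show "(\<integral>\<^sup>+p. \<integral>\<^sup>+s. F (p, q, s) \<partial>lborel \<partial>lborel) = (\<integral>\<^sup>+p. K (a * p + b * q, c * p + d * q) \<partial>lborel)"
    proof (rule nn_integral_lborel_cong_except)
      fix p assume "p \<noteq> - d * q / c"
      hence "c * p + d * q \<noteq> 0" using det q by (cases "c = 0") (auto simp: field_simps add_eq_0_iff)
      thus "(\<integral>\<^sup>+s. F (p, q, s) \<partial>lborel) = K (a * p + b * q, c * p + d * q)" by (rule inner[OF q])
    qed
  qed
  also have "\<dots> = (\<integral>\<^sup>+q. \<integral>\<^sup>+p. \<integral>\<^sup>+s. G (p, q, s) \<partial>lborel \<partial>lborel \<partial>lborel)"
    unfolding nn_integral_plane_SL2[OF K det] by (simp add: K_def)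
  finally have FG: "(\<integral>\<^sup>+s. \<integral>\<^sup>+q. \<integral>\<^sup>+p. F (p, q, s) \<partial>lborel \<partial>lborel \<partial>lborel) =
      (\<integral>\<^sup>+s. \<integral>\<^sup>+q. \<integral>\<^sup>+p. G (p, q, s) \<partial>lborel \<partial>lborel \<partial>lborel)"
    unfolding swap[OF F] swap[OF G] .
  have "(\<integral>\<^sup>+v. g (tangent_act A v) \<partial>liouville) = (\<integral>\<^sup>+v. f v \<partial>liouville)"
    by (intro nn_integral_cong) (simp add: f_def space_liouville)
  also have "\<dots> = (\<integral>\<^sup>+v. g v \<partial>liouville)"
    unfolding nn_integral_liouville_chart[OF f] nn_integral_liouville_chart[OF g]
    using FG by (simp add: F_def G_def)
  finally show ?thesis .
qed

lemma Im_act_int_matrix: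
  assumes "int_matrix a b c d \<in> SL2Z" "v \<in> T1H"
  shows "Im (fst (tangent_act (int_matrix a b c d) v)) = Im (fst v) / (norm (of_int c * fst v + of_int d))\<^sup>2"
  using Im_tangent_act[OF SL2Z_SL2R[OF assms(1)], of "fst v" "snd v"] assms(2) by (auto simp: T1H_def)

lemma norm_cofactor_square:
  "(norm (of_int c * z + of_int d))\<^sup>2 = (of_int c)\<^sup>2 * (norm z)\<^sup>2 + 2 * of_int c * of_int d * Re z + (of_int d)\<^sup>2"
  unfolding cmod_power2 by (simp add: power2_eq_square algebra_simps)

lemma modular_domain_subset: "modular_domain \<subseteq> T1H"
  by (auto simp: modular_domain_def)

text \<open>The hypothesis on the imaginary parts means \<open>\<bar>c z + d\<bar> \<le> 1\<close>. For \<open>c \<noteq> 0\<close> this contradicts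
  \<open>\<bar>c z + d\<bar>\<^sup>2 > c\<^sup>2 - \<bar>c d\<bar> + d\<^sup>2 \<ge> 1\<close>, and a translation that preserves the open strip is trivial.\<close>

lemma modular_domain_rigid:
  assumes A: "A \<in> SL2Z" and v: "v \<in> modular_domain" "tangent_act A v \<in> modular_domain"
    and Im: "Im (fst v) \<le> Im (fst (tangent_act A v))"
  shows "tangent_act A v = v"
proof -
  obtain a b c d where abcd: "A = int_matrix a b c d" "a * d - b * c = 1" using A by (rule SL2Z_cases)
  define z where "z = fst v"
  have vT: "v \<in> T1H" using v by (auto simp: modular_domain_def)
  have z: "Im z > 0" "\<bar>Re z\<bar> < 1/2" "norm z > 1" using v by (auto simp: modular_domain_def T1H_def z_def)
  have le1: "(norm (of_int c * z + of_int d))\<^sup>2 \<le> 1"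
  proof (rule ccontr)
    assume "\<not> ?thesis"
    hence "Im z / (norm (of_int c * z + of_int d))\<^sup>2 < Im z / 1"
      using z by (intro divide_strict_left_mono) auto
    thus False using Im Im_act_int_matrix[OF A[unfolded abcd] vT] by (simp add: abcd z_def)
  qed
  have c0: "c = 0"
  proof (rule ccontr)
    assume c: "c \<noteq> 0"
    have "1 < (norm z)\<^sup>2" using z by (simp add: one_less_power)
    hence "(of_int c)\<^sup>2 * 1 < (of_int c)\<^sup>2 * (norm z)\<^sup>2" using c by (intro mult_strict_left_mono) auto
    moreover have "\<bar>2 * of_int c * of_int d * Re z\<bar> \<le> \<bar>of_int c * of_int d\<bar>"
    proof -
      have "\<bar>2 * of_int c * of_int d * Re z\<bar> = \<bar>real_of_int c * of_int d\<bar> * (2 * \<bar>Re z\<bar>)" by (simp add: abs_mult)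
      also have "\<dots> \<le> \<bar>real_of_int c * of_int d\<bar> * 1" using z by (intro mult_left_mono) auto
      finally show ?thesis by simp
    qed
    ultimately have "(of_int c)\<^sup>2 - \<bar>of_int c * of_int d\<bar> + (of_int d)\<^sup>2 < (1::real)"
      using le1 unfolding norm_cofactor_square by linarith
    hence "of_int (c\<^sup>2 - \<bar>c * d\<bar> + d\<^sup>2) < (of_int 1 :: real)" by simp
    hence "c\<^sup>2 - \<bar>c * d\<bar> + d\<^sup>2 < 1" unfolding of_int_less_iff .
    moreover have "c\<^sup>2 - \<bar>c * d\<bar> + d\<^sup>2 = (\<bar>c\<bar> - \<bar>d\<bar>)\<^sup>2 + \<bar>c\<bar> * \<bar>d\<bar>"
      by (simp add: power2_eq_square algebra_simps abs_mult)
    moreover have "(\<bar>c\<bar> - \<bar>d\<bar>)\<^sup>2 + \<bar>c\<bar> * \<bar>d\<bar> \<ge> 1"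
    proof (cases "d = 0")
      case True
      have "0 < c\<^sup>2" using c by simp
      hence "1 \<le> c\<^sup>2" by linarith
      thus ?thesis using True by simp
    next
      case False
      hence "0 < \<bar>c\<bar> * \<bar>d\<bar>" using c by simp
      moreover have "0 \<le> (\<bar>c\<bar> - \<bar>d\<bar>)\<^sup>2" by simp
      ultimately show ?thesis by linarith
    qed
    ultimately show False by linarith
  qed
  hence "a * d = 1" using abcd by simp
  hence ad: "a = 1 \<and> d = 1 \<or> a = - 1 \<and> d = - 1" by (metis zmult_eq_1_iff)
  have "fst (tangent_act A v) = z + of_int (a * b)"
    using ad by (cases v) (auto simp: abcd c0 tangent_act_def z_def)
  hence "Re (fst (tangent_act A v)) = Re z + of_int (a * b)" by simp
  moreover have "\<bar>Re (fst (tangent_act A v))\<bar> < 1/2" using v(2) by (auto simp: modular_domain_def)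
  ultimately have "\<bar>real_of_int (a * b)\<bar> < 1" using z by linarith
  hence "\<bar>a * b\<bar> < 1" by linarith
  hence "b = 0" using ad by auto
  hence "A = mat 1 \<or> A = - mat 1" using ad c0 by (auto simp: abcd vec_eq_iff forall_2 mat_def)
  thus ?thesis
    using tangent_act_one[of v] tangent_act_uminus[OF SL2Z_SL2R[OF SL2Z_one] vT] by metis
qed

lemma inj_on_proj_modular_domain: "inj_on proj modular_domain"
proof (rule inj_onI)
  fix v w assume v: "v \<in> modular_domain" and w: "w \<in> modular_domain" and e: "proj v = proj w"
  have T: "v \<in> T1H" "w \<in> T1H" using v w by (auto simp: modular_domain_def)
  have "proj v \<in> proj ` {w}" using e by simp
  then obtain A where A: "A \<in> SL2Z" "w = tangent_act A v"
    using proj_in_image_iff[OF T(1), of "{w}"] T by auto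
  have v': "v = tangent_act (adj A) w" using A tangent_act_adj(1)[OF SL2Z_SL2R T(1)] by simp
  show "v = w"
  proof (cases "Im (fst v) \<le> Im (fst w)")
    case True
    thus ?thesis using modular_domain_rigid[OF A(1) v] w A by simp
  next
    case False
    thus ?thesis using modular_domain_rigid[OF SL2Z_adj[OF A(1)] w] v v' by simp
  qed
qed

lemma translate_to_strip:
  assumes "v \<in> T1H"
  shows "\<exists>A\<in>SL2Z. \<bar>Re (fst (tangent_act A v))\<bar> \<le> 1/2 \<and> Im (fst (tangent_act A v)) = Im (fst v)"
proof -
  define n where "n = round (Re (fst v))"
  have A: "int_matrix 1 (- n) 0 1 \<in> SL2Z" by (simp add: int_matrix_in_SL2Z)
  have "fst (tangent_act (int_matrix 1 (- n) 0 1) v) = fst v - of_int n"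
    by (cases v) (simp add: tangent_act_def)
  thus ?thesis using A of_int_round_abs_le[of "Re (fst v)"]
    by (intro bexI[OF _ A]) (auto simp: n_def abs_minus_commute)
qed

text \<open>Among the points of the orbit in the strip that are at least as high as \<open>v\<close> there is a highest one,
  since by proper discontinuity they come from finitely many group elements. It lies outside the open
  unit disc, as otherwise \<open>z \<mapsto> -1 / z\<close> would raise it.\<close>

lemma orbit_meets_closed_modular_domain:
  assumes v: "v \<in> T1H"
  shows "\<exists>A\<in>SL2Z. \<bar>Re (fst (tangent_act A v))\<bar> \<le> 1/2 \<and> 1 \<le> norm (fst (tangent_act A v))"
proof -
  define y where "y = Im (fst v)"
  have y: "y > 0" using v by (auto simp: T1H_def y_def)
  define T where "T = {A \<in> SL2Z. \<bar>Re (fst (tangent_act A v))\<bar> \<le> 1/2 \<and> y \<le> Im (fst (tangent_act A v))}"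
  define M where "M = max y (1 / y)"
  define R where "R = max (height_norm v) ((1/4 + M\<^sup>2 + 1) / y)"
  have "T \<subseteq> visits R"
  proof
    fix A assume "A \<in> T"
    hence A: "A \<in> SL2Z" "\<bar>Re (fst (tangent_act A v))\<bar> \<le> 1/2" "y \<le> Im (fst (tangent_act A v))" by (auto simp: T_def)
    obtain a b c d where abcd: "A = int_matrix a b c d" "a * d - b * c = 1" using A(1) by (rule SL2Z_cases)
    have Imle: "Im (fst (tangent_act A v)) \<le> M"
    proof (cases "c = 0")
      case True
      hence "a * d = 1" using abcd by simp
      hence "d = 1 \<or> d = - 1" by (metis zmult_eq_1_iff)
      hence "Im (fst (tangent_act A v)) = y"
        using Im_act_int_matrix[OF A(1)[unfolded abcd] v] True by (auto simp: abcd y_def)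
      thus ?thesis by (simp add: M_def)
    next
      case False
      hence "1 \<le> \<bar>c\<bar>" by linarith
      hence "1 \<le> \<bar>real_of_int c\<bar>" by linarith
      hence "1 * y \<le> \<bar>of_int c\<bar> * y" using y by (intro mult_right_mono) auto
      also have "\<dots> = \<bar>Im (of_int c * fst v + of_int d)\<bar>" using y by (simp add: y_def abs_mult)
      also have "\<dots> \<le> norm (of_int c * fst v + of_int d)" by (rule abs_Im_le_cmod)
      finally have n: "y \<le> norm (of_int c * fst v + of_int d)" by simp
      hence "y\<^sup>2 \<le> (norm (of_int c * fst v + of_int d))\<^sup>2" using y by (intro power_mono) auto
      moreover have "0 < norm (of_int c * fst v + of_int d)" using n y by (rule less_le_trans[rotated])
      ultimately have "y / (norm (of_int c * fst v + of_int d))\<^sup>2 \<le> y / y\<^sup>2"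
        using y by (intro divide_left_mono mult_pos_pos zero_less_power) auto
      also have "\<dots> = 1 / y" using y by (simp add: power2_eq_square)
      finally show ?thesis
        using Im_act_int_matrix[OF A(1)[unfolded abcd] v] by (simp add: abcd y_def M_def)
    qed
    define w where "w = fst (tangent_act A v)"
    have w: "\<bar>Re w\<bar> \<le> 1/2" "y \<le> Im w" "Im w \<le> M" using A Imle by (auto simp: w_def)
    have "\<bar>Re w\<bar>\<^sup>2 \<le> (1/2)\<^sup>2" using w by (intro power_mono) auto
    moreover have "(Im w)\<^sup>2 \<le> M\<^sup>2" using w y by (intro power_mono) auto
    ultimately have "(norm w)\<^sup>2 + 1 \<le> 1/4 + M\<^sup>2 + 1" unfolding cmod_power2 by (simp add: power_divide)
    hence "height_norm (tangent_act A v) \<le> (1/4 + M\<^sup>2 + 1) / y"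
      unfolding height_norm_def w_def[symmetric] using w y by (intro frac_le) auto
    thus "A \<in> visits R"
      using A(1) v by (auto simp: R_def visits_def intro!: bexI[of _ v])
  qed
  hence finT: "finite T" using finite_visits finite_subset by blast
  have neT: "T \<noteq> {}" using translate_to_strip[OF v] by (auto simp: T_def y_def)
  obtain A where A: "A \<in> T" and max: "\<And>B. B \<in> T \<Longrightarrow> Im (fst (tangent_act B v)) \<le> Im (fst (tangent_act A v))"
  proof -
    define f where "f B = Im (fst (tangent_act B v))" for B
    have "Max (f ` T) \<in> f ` T" using finT neT by simp
    then obtain A where "A \<in> T" "f A = Max (f ` T)" by auto
    moreover have "f B \<le> Max (f ` T)" if "B \<in> T" for B using finT that by simp
    ultimately show ?thesis using that by (simp add: f_def)
  qed
  have AZ: "A \<in> SL2Z" using A by (simp add: T_def)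
  define w where "w = tangent_act A v"
  have wT: "w \<in> T1H" using tangent_act_in[OF SL2Z_SL2R[OF AZ] v] by (simp add: w_def)
  have "1 \<le> norm (fst w)"
  proof (rule ccontr)
    assume "\<not> 1 \<le> norm (fst w)"
    define S where "S = int_matrix 0 (- 1) 1 0"
    have S: "S \<in> SL2Z" by (simp add: S_def int_matrix_in_SL2Z)
    have Imw: "Im (fst w) > 0" using wT by (auto simp: T1H_def)
    hence "fst w \<noteq> 0" by auto
    hence n: "0 < norm (fst w)" "(norm (fst w))\<^sup>2 < 1"
      using \<open>\<not> 1 \<le> norm (fst w)\<close> by (auto simp: power_less_one_iff)
    have ST: "tangent_act S w \<in> T1H" using tangent_act_in[OF SL2Z_SL2R[OF S] wT] .
    have "Im (fst (tangent_act S w)) = Im (fst w) / (norm (fst w))\<^sup>2"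
      using Im_act_int_matrix[OF S[unfolded S_def] wT] by (simp add: S_def)
    also have "\<dots> > Im (fst w) / 1" using n Imw by (intro divide_strict_left_mono) auto
    finally have gr: "Im (fst w) < Im (fst (tangent_act S w))" by simp
    obtain B where B: "B \<in> SL2Z" "\<bar>Re (fst (tangent_act B (tangent_act S w)))\<bar> \<le> 1/2"
      "Im (fst (tangent_act B (tangent_act S w))) = Im (fst (tangent_act S w))"
      using translate_to_strip[OF ST] by blast
    have BS: "B ** S \<in> SL2Z" using B S by (simp add: SL2Z_mult)
    have e: "tangent_act (B ** S ** A) v = tangent_act B (tangent_act S w)"
      using tangent_act_mult[OF SL2Z_SL2R[OF BS] SL2Z_SL2R[OF AZ] v]
        tangent_act_mult[OF SL2Z_SL2R[OF B(1)] SL2Z_SL2R[OF S] wT] by (simp add: w_def)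
    have "y \<le> Im (fst w)" using A by (simp add: T_def w_def)
    hence "B ** S ** A \<in> T" unfolding T_def using B gr e SL2Z_mult[OF BS AZ] by auto
    from max[OF this] show False using gr B e by (simp add: w_def)
  qed
  thus ?thesis using A by (auto simp: T_def w_def)
qed

lemma nn_integral_swap_weighted:
  fixes f :: "real \<Rightarrow> real \<Rightarrow> ennreal"
  assumes [measurable]: "case_prod f \<in> borel_measurable (borel \<Otimes>\<^sub>M borel)"
  shows "(\<integral>\<^sup>+y. (\<integral>\<^sup>+x. f x y \<partial>lborel) * ennreal (1 / y\<^sup>2) * indicator {0<..} y \<partial>lborel) =
         (\<integral>\<^sup>+x. (\<integral>\<^sup>+y. f x y * ennreal (1 / y\<^sup>2) * indicator {0<..} y \<partial>lborel) \<partial>lborel)"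
proof -
  have "(\<integral>\<^sup>+y. (\<integral>\<^sup>+x. f x y \<partial>lborel) * ennreal (1 / y\<^sup>2) * indicator {0<..} y \<partial>lborel) =
      (\<integral>\<^sup>+y. (\<integral>\<^sup>+x. f x y * ennreal (1 / y\<^sup>2) * indicator {0<..} y \<partial>lborel) \<partial>lborel)"
    by (simp add: nn_integral_multc)
  also have "\<dots> = (\<integral>\<^sup>+x. (\<integral>\<^sup>+y. f x y * ennreal (1 / y\<^sup>2) * indicator {0<..} y \<partial>lborel) \<partial>lborel)"
    by (rule lborel_pair.Fubini') measurable
  finally show ?thesis .
qed

text \<open>For fixed \<open>x\<close> the integral of \<open>1 / y\<^sup>2\<close> over \<open>y > \<surd>(1 - x\<^sup>2)\<close> is \<open>1 / \<surd>(1 - x\<^sup>2)\<close>, whose primitive is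
  the arcsine.\<close>

lemma emeasure_modular_domain_eq: "emeasure liouville modular_domain = ennreal (2 * pi\<^sup>2 / 3)"
proof -
  define X where "X = {v :: complex \<times> complex. \<bar>Re (fst v)\<bar> < 1/2 \<and> 1 < norm (fst v)}"
  have "open X" unfolding X_def by (intro open_Collect_conj open_Collect_less continuous_intros)
  hence X: "X \<in> sets borel" by simp
  have Xm[measurable]: "X \<in> sets (borel \<Otimes>\<^sub>M borel)" using X by (simp only: borel_prod)
  have sq: "1 < norm (Complex x y) \<longleftrightarrow> sqrt (1 - x\<^sup>2) < y" if "\<bar>x\<bar> < 1/2" "y > 0" for x y :: real
  proof -
    have "1 < norm (Complex x y) \<longleftrightarrow> 1 < x\<^sup>2 + y\<^sup>2" by (simp add: cmod_def)
    also have "\<dots> \<longleftrightarrow> sqrt (1 - x\<^sup>2) < sqrt (y\<^sup>2)" by (simp only: real_sqrt_less_iff) linarith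
    finally show ?thesis using that by simp
  qed
  have x1: "0 < 1 - x\<^sup>2" if "\<bar>x\<bar> \<le> 1/2" for x :: real
  proof -
    have "\<bar>x\<bar>\<^sup>2 \<le> (1/2)\<^sup>2" using that by (intro power_mono) auto
    thus ?thesis by (simp add: power_divide)
  qed
  have inner: "(\<integral>\<^sup>+y. indicator X (Complex x y, u) * ennreal (1 / y\<^sup>2) * indicator {0<..} y \<partial>lborel) =
      ennreal (1 / sqrt (1 - x\<^sup>2)) * indicator {-1/2..1/2} x" if x: "\<bar>x\<bar> \<noteq> 1/2" for x and u :: complex
  proof (cases "\<bar>x\<bar> < 1/2")
    case True
    define r where "r = sqrt (1 - x\<^sup>2)"
    have r: "r > 0" using x1 True by (simp add: r_def)
    have "(\<integral>\<^sup>+y. indicator X (Complex x y, u) * ennreal (1 / y\<^sup>2) * indicator {0<..} y \<partial>lborel) =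
        (\<integral>\<^sup>+y. ennreal (1 / y\<^sup>2) * indicator {r..} y \<partial>lborel)"
    proof (rule nn_integral_lborel_cong_except[of r])
      fix y assume "y \<noteq> r"
      thus "indicator X (Complex x y, u) * ennreal (1 / y\<^sup>2) * indicator {0<..} y = ennreal (1 / y\<^sup>2) * indicator {r..} y"
        using sq[OF True, of y] r True by (cases "y > 0") (auto simp: X_def indicator_def r_def[symmetric])
    qed
    also have "(\<integral>\<^sup>+y. ennreal (1 / y\<^sup>2) * indicator {r..} y \<partial>lborel) = ennreal (0 - (- 1 / r))"
    proof (rule nn_integral_FTC_atLeast)
      show "((\<lambda>y::real. - 1 / y) \<longlongrightarrow> 0) at_top" by real_asymp
      show "DERIV (\<lambda>y::real. - 1 / y) y :> 1 / y\<^sup>2" if "r \<le> y" for y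
        using that r by (auto intro!: derivative_eq_intros simp: power2_eq_square)
    qed auto
    finally have "(\<integral>\<^sup>+y. indicator X (Complex x y, u) * ennreal (1 / y\<^sup>2) * indicator {0<..} y \<partial>lborel) = ennreal (1 / r)"
      by simp
    moreover have "x \<in> {-1/2..1/2}" using True by (simp only: atLeastAtMost_iff) linarith
    ultimately show ?thesis by (simp add: r_def)
  next
    case False
    hence "\<not> (- 1/2 \<le> x \<and> x \<le> 1/2)" using x by linarith
    thus ?thesis using False by (simp add: X_def)
  qed
  have width: "(\<integral>\<^sup>+x. ennreal (1 / sqrt (1 - x\<^sup>2)) * indicator {-1/2..1/2} x \<partial>lborel) = ennreal (pi / 3)"
  proof -
    have "(\<integral>\<^sup>+x. ennreal (1 / sqrt (1 - x\<^sup>2)) * indicator {-1/2..1/2} x \<partial>lborel) =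
        ennreal (arcsin (1/2) - arcsin (- 1/2))"
    proof (rule nn_integral_FTC_Icc)
      show "DERIV arcsin x :> 1 / sqrt (1 - x\<^sup>2)" if "x \<in> {- 1 / 2..1 / 2}" for x
        using DERIV_arcsin[of x] that by (simp add: inverse_eq_divide)
      show "0 \<le> 1 / sqrt (1 - x\<^sup>2)" if "x \<in> {- 1 / 2..1 / 2}" for x
      proof -
        have "\<bar>x\<bar> \<le> 1/2" using that by (simp only: atLeastAtMost_iff) linarith
        thus ?thesis using x1[of x] by simp
      qed
    qed auto
    also have "arcsin (1/2) - arcsin (- 1/2) = pi / 3"
      using arcsin_minus_one_half by simp
    finally show ?thesis .
  qed
  have per_angle: "(\<integral>\<^sup>+y. (\<integral>\<^sup>+x. indicator X (Complex x y, cis t) \<partial>lborel) * ennreal (1 / y\<^sup>2) * indicator {0<..} y \<partial>lborel)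
      = ennreal (pi / 3)" for t
  proof -
    have "(\<integral>\<^sup>+y. (\<integral>\<^sup>+x. indicator X (Complex x y, cis t) \<partial>lborel) * ennreal (1 / y\<^sup>2) * indicator {0<..} y \<partial>lborel) =
       (\<integral>\<^sup>+x. (\<integral>\<^sup>+y. indicator X (Complex x y, cis t) * ennreal (1 / y\<^sup>2) * indicator {0<..} y \<partial>lborel) \<partial>lborel)"
      by (rule nn_integral_swap_weighted) measurable
    also have "\<dots> = (\<integral>\<^sup>+x. ennreal (1 / sqrt (1 - x\<^sup>2)) * indicator {-1/2..1/2} x \<partial>lborel)"
    proof (rule nn_integral_cong_AE)
      have "AE x in lborel. x \<noteq> (1/2::real)" "AE x in lborel. x \<noteq> (- (1/2)::real)" by (rule AE_lborel_singleton)+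
      thus "AE x in lborel. (\<integral>\<^sup>+y. indicator X (Complex x y, cis t) * ennreal (1 / y\<^sup>2) * indicator {0<..} y \<partial>lborel) =
          ennreal (1 / sqrt (1 - x\<^sup>2)) * indicator {-1/2..1/2} x"
      proof eventually_elim
        fix x :: real assume "x \<noteq> 1/2" "x \<noteq> - (1/2)"
        hence "\<bar>x\<bar> \<noteq> 1/2" by linarith
        thus "(\<integral>\<^sup>+y. indicator X (Complex x y, cis t) * ennreal (1 / y\<^sup>2) * indicator {0<..} y \<partial>lborel) =
          ennreal (1 / sqrt (1 - x\<^sup>2)) * indicator {-1/2..1/2} x" by (rule inner)
      qed
    qed
    finally show ?thesis unfolding width .
  qed
  have "emeasure liouville modular_domain = (\<integral>\<^sup>+v. indicator modular_domain v \<partial>liouville)"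
    using modular_domain_sets by (simp add: sets_liouville)
  also have "\<dots> = (\<integral>\<^sup>+v. indicator X v \<partial>liouville)"
    by (intro nn_integral_cong) (auto simp: indicator_def X_def modular_domain_def space_liouville)
  also have "\<dots> = (\<integral>\<^sup>+t. ennreal (pi / 3) * indicator {0..<2 * pi} t \<partial>lborel)"
    using X by (subst nn_integral_liouville_coordinates) (simp_all add: per_angle)
  also have "\<dots> = ennreal (pi / 3) * ennreal (2 * pi)"
    by (simp add: nn_integral_cmult_indicator)
  also have "\<dots> = ennreal (2 * pi\<^sup>2 / 3)"
    by (simp add: ennreal_mult[symmetric] power2_eq_square)
  finally show ?thesis .
qed

text \<open>An orbit that misses the open modular domain has a point over one of the lines \<open>\<bar>Re z\<bar> = 1/2\<close> or over
  the unit circle. The vectors over these curves form a null set, and by invariance so do their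
  countably many translates.\<close>

lemma AE_visits_modular_domain: "AE v in liouville. proj v \<in> proj ` modular_domain"
proof -
  define N where "N = {v :: complex \<times> complex. \<bar>Re (fst v)\<bar> = 1/2 \<or> norm (fst v) = 1}"
  have "closed N" unfolding N_def
    by (intro closed_Collect_disj closed_Collect_eq continuous_intros)
  hence N: "N \<in> sets borel" by simp
  have line: "(\<integral>\<^sup>+x. indicator N (Complex x y, u) \<partial>lborel) = 0" for y and u :: complex
  proof -
    have "{x. (Complex x y, u) \<in> N} \<subseteq> {1/2, - (1/2), sqrt (1 - y\<^sup>2), - sqrt (1 - y\<^sup>2)}"
    proof
      fix x assume "x \<in> {x. (Complex x y, u) \<in> N}"
      hence "\<bar>x\<bar> = 1/2 \<or> x\<^sup>2 + y\<^sup>2 = 1" by (simp add: N_def cmod_def)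
      moreover have "\<bar>x\<bar> = sqrt (1 - y\<^sup>2)" if "x\<^sup>2 + y\<^sup>2 = 1"
        using that by (metis add_diff_cancel_right' real_sqrt_abs)
      ultimately show "x \<in> {1/2, - (1/2), sqrt (1 - y\<^sup>2), - sqrt (1 - y\<^sup>2)}" by auto
    qed
    hence "finite {x. (Complex x y, u) \<in> N}" by (rule finite_subset) simp
    hence "{x. (Complex x y, u) \<in> N} \<in> null_sets lborel" by (rule finite_imp_null_set_lborel)
    hence "emeasure lborel {x. (Complex x y, u) \<in> N} = 0" "{x. (Complex x y, u) \<in> N} \<in> sets lborel" by auto
    moreover have "(\<lambda>x. indicator N (Complex x y, u)) = (indicator {x. (Complex x y, u) \<in> N} :: real \<Rightarrow> ennreal)"
      by (auto simp: indicator_def fun_eq_iff)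
    ultimately show ?thesis by (simp only: nn_integral_indicator)
  qed
  have null: "(\<integral>\<^sup>+v. indicator N v \<partial>liouville) = 0"
    using N by (subst nn_integral_liouville_coordinates) (simp_all add: line)
  have "AE v in liouville. tangent_act A v \<notin> N" if A: "A \<in> SL2Z" for A
  proof -
    have m: "(\<lambda>v. indicator N (tangent_act A v) :: ennreal) \<in> borel_measurable liouville"
      using borel_measurable_tangent_act[OF SL2Z_SL2R[OF A], of "indicator N"] N
      by (simp add: measurable_cong_sets[OF sets_liouville refl])
    have "(\<integral>\<^sup>+v. indicator N (tangent_act A v) \<partial>liouville) = 0"
      using liouville_invariant[OF SL2Z_SL2R[OF A], of "indicator N"] N null by simp
    hence "AE v in liouville. indicator N (tangent_act A v) = (0::ennreal)"
      using nn_integral_0_iff_AE[OF m] by simp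
    thus ?thesis by eventually_elim (auto simp: indicator_def split: if_splits)
  qed
  hence "AE v in liouville. \<forall>A\<in>SL2Z. tangent_act A v \<notin> N"
    by (subst AE_ball_countable[OF countable_SL2Z]) blast
  moreover have "AE v in liouville. v \<in> T1H" by (rule AE_I2) (simp add: space_liouville)
  ultimately show ?thesis
  proof eventually_elim
    fix v assume v: "\<forall>A\<in>SL2Z. tangent_act A v \<notin> N" "v \<in> T1H"
    obtain A where A: "A \<in> SL2Z" "\<bar>Re (fst (tangent_act A v))\<bar> \<le> 1/2" "1 \<le> norm (fst (tangent_act A v))"
      using orbit_meets_closed_modular_domain[OF v(2)] by blast
    have "tangent_act A v \<in> T1H" by (rule tangent_act_in[OF SL2Z_SL2R[OF A(1)] v(2)])
    moreover have "tangent_act A v \<notin> N" using v A by blast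
    ultimately have "tangent_act A v \<in> modular_domain"
      using A by (cases "tangent_act A v") (auto simp: N_def modular_domain_def)
    thus "proj v \<in> proj ` modular_domain"
      using proj_in_image_iff[OF v(2) modular_domain_subset] A(1) by blast
  qed
qed

section \<open>The Haar measure of a box\<close>

lemma bij_betw_adj_SL2Z: "bij_betw adj SL2Z SL2Z"
  by (rule bij_betw_byWitness[where f'=adj]) (auto simp: SL2Z_adj)

text \<open>The modular domain and \<open>K\<close> play symmetric roles: the integral over \<open>liouville\<close> of the sum over \<open>A\<close> of
  \<open>indicator F v * indicator K (A v)\<close> is, by the unfolding identity for \<open>K\<close>, twice the measure of the
  part of \<open>F\<close> over \<open>proj ` K\<close>, and, after the invariant substitution \<open>v \<mapsto> A\<^sup>-\<^sup>1 v\<close> and the unfolding identity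
  for \<open>F\<close>, twice the measure of \<open>K\<close>.\<close>

lemma emeasure_m_bar_image:
  assumes K: "compact K" "K \<subseteq> T1H" "inj_on proj K"
  shows "emeasure m_bar (proj ` K) = emeasure liouville K / emeasure liouville modular_domain"
proof -
  define F where "F = modular_domain"
  have Kb[measurable]: "K \<in> sets borel" using K by (simp add: borel_closed compact_imp_closed)
  have KL: "K \<in> sets liouville" unfolding sets_liouville using K Kb by (auto simp: sets_restrict_space_iff)
  have FL: "F \<in> sets liouville" unfolding sets_liouville F_def by (rule modular_domain_sets)
  have Fb[measurable]: "F \<in> sets borel"
    using FL T1H_borel unfolding sets_liouville by (auto simp: sets_restrict_space)
  have PK: "proj ` K \<in> sets M_borel" by (rule proj_compact_measurable[OF K(1,2)])
  have pm: "proj \<in> measurable liouville M_borel"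
    unfolding measurable_cong_sets[OF sets_liouville refl] by (rule proj_measurable)
  define E where "E = proj -` proj ` K \<inter> T1H"
  have EL: "E \<in> sets liouville" using measurable_sets[OF pm PK] by (simp add: E_def space_liouville)
  have actF: "(\<lambda>v. indicator F (tangent_act A v) :: ennreal) \<in> borel_measurable liouville"
    and actK: "(\<lambda>v. indicator K (tangent_act A v) :: ennreal) \<in> borel_measurable liouville" if "A \<in> SL2Z" for A
    unfolding measurable_cong_sets[OF sets_liouville refl]
    using borel_measurable_tangent_act[OF SL2Z_SL2R[OF that]] Fb Kb by auto
  have "2 * emeasure liouville (F \<inter> E) = (\<integral>\<^sup>+v. 2 * indicator (F \<inter> E) v \<partial>liouville)"
    using FL EL by (subst nn_integral_cmult) auto
  also have "\<dots> = (\<integral>\<^sup>+v. (\<integral>\<^sup>+A. indicator F v * indicator K (tangent_act A v) \<partial>count_space SL2Z) \<partial>liouville)"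
  proof (rule nn_integral_cong)
    fix v assume "v \<in> space liouville"
    hence "v \<in> T1H" by (simp add: space_liouville)
    thus "2 * indicator (F \<inter> E) v = (\<integral>\<^sup>+A. indicator F v * indicator K (tangent_act A v) \<partial>count_space SL2Z)"
      using nn_integral_orbit_visits[OF _ K(2,3), of v] by (simp add: nn_integral_cmult E_def indicator_def)
  qed
  also have "\<dots> = (\<integral>\<^sup>+A. (\<integral>\<^sup>+v. indicator F v * indicator K (tangent_act A v) \<partial>liouville) \<partial>count_space SL2Z)"
    using actK FL by (intro nn_integral_count_space_nn_integral countable_SL2Z) auto
  also have "\<dots> = (\<integral>\<^sup>+A. (\<integral>\<^sup>+v. indicator F (tangent_act (adj A) v) * indicator K v \<partial>liouville) \<partial>count_space SL2Z)"
  proof (rule nn_integral_cong)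
    fix A assume "A \<in> space (count_space SL2Z)"
    hence A: "A \<in> SL2Z" by simp
    define g where "g v = indicator F (tangent_act (adj A) v) * indicator T1H v * (indicator K v :: ennreal)" for v
    have "(\<lambda>v. indicator F (tangent_act (adj A) v) :: ennreal) \<in> borel_measurable (restrict_space borel T1H)"
      using Fb by (intro borel_measurable_tangent_act SL2Z_SL2R SL2Z_adj A) simp
    hence m: "(\<lambda>v. indicator F (tangent_act (adj A) v) * indicator T1H v :: ennreal) \<in> borel_measurable borel"
      by (subst (asm) borel_measurable_restrict_space_iff_ennreal) auto
    have g: "g \<in> borel_measurable borel" unfolding g_def by (rule borel_measurable_times_ennreal[OF m]) simp
    have "(\<integral>\<^sup>+v. indicator F v * indicator K (tangent_act A v) \<partial>liouville) = (\<integral>\<^sup>+v. g (tangent_act A v) \<partial>liouville)"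
      by (intro nn_integral_cong)
         (simp add: g_def space_liouville tangent_act_adj[OF SL2Z_SL2R[OF A]] tangent_act_in[OF SL2Z_SL2R[OF A]])
    also have "\<dots> = (\<integral>\<^sup>+v. g v \<partial>liouville)" by (rule liouville_invariant[OF SL2Z_SL2R[OF A] g])
    finally show "(\<integral>\<^sup>+v. indicator F v * indicator K (tangent_act A v) \<partial>liouville) =
        (\<integral>\<^sup>+v. indicator F (tangent_act (adj A) v) * indicator K v \<partial>liouville)"
      by (simp add: g_def space_liouville cong: nn_integral_cong_simp)
  qed
  also have "\<dots> = (\<integral>\<^sup>+A. (\<integral>\<^sup>+v. indicator F (tangent_act A v) * indicator K v \<partial>liouville) \<partial>count_space SL2Z)"
    by (rule nn_integral_bij_count_space[OF bij_betw_adj_SL2Z])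
  also have "\<dots> = (\<integral>\<^sup>+v. (\<integral>\<^sup>+A. indicator F (tangent_act A v) * indicator K v \<partial>count_space SL2Z) \<partial>liouville)"
    using actF KL by (intro nn_integral_count_space_nn_integral[symmetric] countable_SL2Z) auto
  also have "\<dots> = (\<integral>\<^sup>+v. 2 * indicator K v \<partial>liouville)"
  proof (rule nn_integral_cong_AE)
    have "AE v in liouville. v \<in> T1H" by (rule AE_I2) (simp add: space_liouville)
    with AE_visits_modular_domain
    show "AE v in liouville. (\<integral>\<^sup>+A. indicator F (tangent_act A v) * indicator K v \<partial>count_space SL2Z) = 2 * indicator K v"
    proof eventually_elim
      fix v assume "proj v \<in> proj ` modular_domain" "v \<in> T1H"
      thus "(\<integral>\<^sup>+A. indicator F (tangent_act A v) * indicator K v \<partial>count_space SL2Z) = 2 * indicator K v"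
        using nn_integral_orbit_visits[OF _ modular_domain_subset inj_on_proj_modular_domain, of v]
        by (simp add: nn_integral_multc F_def)
    qed
  qed
  also have "\<dots> = 2 * emeasure liouville K" using KL by (subst nn_integral_cmult) auto
  finally have FE: "emeasure liouville (F \<inter> E) = emeasure liouville K" by (simp add: ennreal_mult_cancel_left)
  have pu: "proj \<in> measurable (uniform_measure liouville F) M_borel"
    using pm by (simp add: measurable_cong_sets[OF sets_uniform_measure refl])
  have "emeasure m_bar (proj ` K) = emeasure (uniform_measure liouville F) E"
    unfolding m_bar_def F_def[symmetric] E_def
    using emeasure_distr[OF pu PK] by (simp add: space_liouville)
  also have "\<dots> = emeasure liouville (F \<inter> E) / emeasure liouville F"
    by (rule emeasure_uniform_measure[OF FL EL])
  finally show ?thesis unfolding FE unfolding F_def .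
qed

lemma base_cone_measurable [measurable]: "base_cone a1 a2 b1 b2 \<in> sets (borel \<Otimes>\<^sub>M borel)"
proof -
  have "base_cone a1 a2 b1 b2 = {x \<in> space (borel \<Otimes>\<^sub>M borel). snd x \<noteq> 0 \<and> a1 \<le> fst x / snd x \<and>
      fst x / snd x \<le> a2 \<and> b1 \<le> 1 / (snd x)\<^sup>2 \<and> 1 / (snd x)\<^sup>2 \<le> b2}"
    by (auto simp: base_cone_def space_pair_measure)
  also have "\<dots> \<in> sets (borel \<Otimes>\<^sub>M borel)" by measurable
  finally show ?thesis .
qed

lemma emeasure_liouville_box:
  assumes ab: "0 < b1" "a1 < a2" "b1 < b2" "0 < l"
  shows "emeasure liouville (box_lift a1 a2 b1 b2 l) = ennreal (2 * l) * emeasure lborel (base_cone a1 a2 b1 b2)"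
proof -
  define B where "B = box_lift a1 a2 b1 b2 l"
  define W where "W = base_cone a1 a2 b1 b2"
  note top = box_lift_topology[OF ab, folded B_def]
  have Bb: "B \<in> sets borel" using top by (simp add: borel_closed compact_imp_closed)
  have BL: "B \<in> sets liouville" unfolding sets_liouville using top Bb by (auto simp: sets_restrict_space_iff)
  have Wm[measurable]: "W \<in> sets (borel \<Otimes>\<^sub>M borel)" unfolding W_def by (rule base_cone_measurable)
  have Wb: "W \<in> sets borel" using Wm by (simp only: borel_prod)
  have iff: "horo_chart (p, q, s) \<in> B \<longleftrightarrow> (p, q) \<in> W \<and> s \<in> {- (l / 2)..l / 2}" for p q s
  proof (cases "q = 0")
    case True
    hence "horo_chart (p, q, s) \<notin> T1H" by (simp add: horo_chart_def T1H_def)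
    thus ?thesis using top(4) True by (auto simp: W_def base_cone_def)
  next
    case False
    thus ?thesis
      using frame_in_box_lift_iff[OF ab(1) coset_matrix_SL2R[OF False, of p s], of a1 a2 b2 l]
      by (auto simp: frame_coset_matrix B_def W_def abs_le_iff)
  qed
  have "emeasure liouville B = (\<integral>\<^sup>+v. indicator B v \<partial>liouville)" using BL by simp
  also have "\<dots> = 2 * (\<integral>\<^sup>+s. \<integral>\<^sup>+q. \<integral>\<^sup>+p. indicator B (horo_chart (p, q, s)) \<partial>lborel \<partial>lborel \<partial>lborel)"
    using Bb by (intro nn_integral_liouville_chart) simp
  also have "(\<integral>\<^sup>+s. \<integral>\<^sup>+q. \<integral>\<^sup>+p. indicator B (horo_chart (p, q, s)) \<partial>lborel \<partial>lborel \<partial>lborel) =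
      (\<integral>\<^sup>+s. \<integral>\<^sup>+q. \<integral>\<^sup>+p. indicator W (p, q) * indicator {- (l / 2)..l / 2} s \<partial>lborel \<partial>lborel \<partial>lborel)"
    by (simp add: indicator_def iff of_bool_conj)
  also have "\<dots> = (\<integral>\<^sup>+q. \<integral>\<^sup>+p. indicator W (p, q) \<partial>lborel \<partial>lborel) * ennreal l"
    using ab by (simp add: nn_integral_multc nn_integral_cmult)
  also have "(\<integral>\<^sup>+q. \<integral>\<^sup>+p. indicator W (p, q) \<partial>lborel \<partial>lborel) = emeasure lborel W"
    by (rule emeasure_lborel_plane[OF Wb, symmetric])
  also have "2 * (emeasure lborel W * ennreal l) = ennreal (2 * l) * emeasure lborel W"
    using ab by (simp add: ennreal_mult mult_ac)
  finally show ?thesis by (simp add: B_def W_def)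
qed

text \<open>One of the two opposite parts of the base cone. In contrast to the whole, it is convex.\<close>

definition half_cone :: "real \<Rightarrow> real \<Rightarrow> real \<Rightarrow> real \<Rightarrow> (real \<times> real) set" where
  "half_cone a1 a2 b1 b2 =
     {(p, q). a1 * q \<le> p \<and> p \<le> a2 * q \<and> 1 / sqrt b2 \<le> q \<and> q \<le> 1 / sqrt b1}"

lemma base_cone_eq:
  assumes "0 < b1" "b1 < b2"
  shows "base_cone a1 a2 b1 b2 = half_cone a1 a2 b1 b2 \<union> uminus ` half_cone a1 a2 b1 b2"
    "half_cone a1 a2 b1 b2 \<inter> uminus ` half_cone a1 a2 b1 b2 = {}"
    "\<And>p q. (p, q) \<in> half_cone a1 a2 b1 b2 \<Longrightarrow> q > 0"
proof -
  have b2: "0 < b2" using assms by simp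
  show pos: "q > 0" if "(p, q) \<in> half_cone a1 a2 b1 b2" for p q
  proof -
    have "0 < 1 / sqrt b2" using b2 by simp
    also have "1 / sqrt b2 \<le> q" using that by (simp add: half_cone_def)
    finally show ?thesis .
  qed
  have uminus_iff: "(p, q) \<in> uminus ` half_cone a1 a2 b1 b2 \<longleftrightarrow> (- p, - q) \<in> half_cone a1 a2 b1 b2" for p q
  proof
    assume "(p, q) \<in> uminus ` half_cone a1 a2 b1 b2"
    thus "(- p, - q) \<in> half_cone a1 a2 b1 b2" by auto
  next
    assume "(- p, - q) \<in> half_cone a1 a2 b1 b2"
    thus "(p, q) \<in> uminus ` half_cone a1 a2 b1 b2" by (rule rev_image_eqI) simp
  qed
  show "half_cone a1 a2 b1 b2 \<inter> uminus ` half_cone a1 a2 b1 b2 = {}"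
  proof (rule equals0I)
    fix v assume "v \<in> half_cone a1 a2 b1 b2 \<inter> uminus ` half_cone a1 a2 b1 b2"
    moreover obtain p q where "v = (p, q)" by fastforce
    ultimately have "(p, q) \<in> half_cone a1 a2 b1 b2" "(p, q) \<in> uminus ` half_cone a1 a2 b1 b2"
      by (simp_all only: Int_iff)
    hence "q > 0" "- q > 0" using pos uminus_iff by blast+
    thus False by simp
  qed
  have half: "(p, q) \<in> base_cone a1 a2 b1 b2 \<longleftrightarrow> (p, q) \<in> half_cone a1 a2 b1 b2" if q: "q > 0" for p q
  proof -
    have "1 / sqrt b2 \<le> q \<longleftrightarrow> 1 / q\<^sup>2 \<le> b2"
    proof -
      have "1 / sqrt b2 \<le> q \<longleftrightarrow> sqrt (1 / b2) \<le> sqrt (q\<^sup>2)" using q by (simp add: real_sqrt_divide)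
      thus ?thesis using q b2 by (simp only: real_sqrt_le_iff) (simp add: field_simps)
    qed
    moreover have "q \<le> 1 / sqrt b1 \<longleftrightarrow> b1 \<le> 1 / q\<^sup>2"
    proof -
      have "q \<le> 1 / sqrt b1 \<longleftrightarrow> sqrt (q\<^sup>2) \<le> sqrt (1 / b1)" using q by (simp add: real_sqrt_divide)
      thus ?thesis using q assms by (simp only: real_sqrt_le_iff) (simp add: field_simps)
    qed
    moreover have "a1 \<le> p / q \<longleftrightarrow> a1 * q \<le> p" "p / q \<le> a2 \<longleftrightarrow> p \<le> a2 * q"
      using q by (simp_all add: field_simps)
    ultimately show ?thesis using q by (auto simp: base_cone_def half_cone_def)
  qed
  have sym: "(- p, - q) \<in> base_cone a1 a2 b1 b2 \<longleftrightarrow> (p, q) \<in> base_cone a1 a2 b1 b2" for p q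
    by (simp add: base_cone_def)
  have "(p, q) \<in> base_cone a1 a2 b1 b2 \<longleftrightarrow> (p, q) \<in> half_cone a1 a2 b1 b2 \<or> (- p, - q) \<in> half_cone a1 a2 b1 b2" for p q
  proof (cases "q > 0")
    case True
    thus ?thesis using half pos[of "- p" "- q"] by auto
  next
    case False
    show ?thesis
    proof (cases "q = 0")
      case True
      thus ?thesis using pos[of p q] pos[of "- p" "- q"] by (auto simp: base_cone_def)
    next
      case nz: False
      thus ?thesis using half[of "- q" "- p"] sym[of p q] pos[of p q] False by auto
    qed
  qed
  thus "base_cone a1 a2 b1 b2 = half_cone a1 a2 b1 b2 \<union> uminus ` half_cone a1 a2 b1 b2"
    using uminus_iff by auto
qed

lemma half_cone_compact_convex:
  assumes "0 < b1" "b1 < b2"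
  shows "compact (half_cone a1 a2 b1 b2)" "convex (half_cone a1 a2 b1 b2)"
proof -
  have eq: "half_cone a1 a2 b1 b2 = (\<lambda>(x, q). (x * q, q)) ` ({a1..a2} \<times> {1 / sqrt b2..1 / sqrt b1})"
  proof (intro equalityI subsetI)
    fix v assume v: "v \<in> half_cone a1 a2 b1 b2"
    obtain p q where pq: "v = (p, q)" by fastforce
    have q: "q > 0" using base_cone_eq(3)[OF assms] v pq by blast
    show "v \<in> (\<lambda>(x, q). (x * q, q)) ` ({a1..a2} \<times> {1 / sqrt b2..1 / sqrt b1})"
      by (rule image_eqI[where x="(p / q, q)"]) (use v pq q in \<open>auto simp: half_cone_def field_simps\<close>)
  next
    fix v assume "v \<in> (\<lambda>(x, q). (x * q, q)) ` ({a1..a2} \<times> {1 / sqrt b2..1 / sqrt b1})"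
    then obtain w where w: "v = (\<lambda>(x, q). (x * q, q)) w" "w \<in> {a1..a2} \<times> {1 / sqrt b2..1 / sqrt b1}" by (rule imageE)
    define x q where "x = fst w" and "q = snd w"
    have v: "v = (x * q, q)" "a1 \<le> x" "x \<le> a2" "1 / sqrt b2 \<le> q" "q \<le> 1 / sqrt b1"
      using w by (auto simp: x_def q_def)
    have "0 < 1 / sqrt b2" using assms by simp
    hence "0 < q" using v(4) by (rule less_le_trans)
    thus "v \<in> half_cone a1 a2 b1 b2" using v by (auto simp: half_cone_def intro!: mult_right_mono)
  qed
  show "compact (half_cone a1 a2 b1 b2)" unfolding eq split_beta
    by (intro compact_continuous_image continuous_intros compact_Times compact_Icc)
  have "half_cone a1 a2 b1 b2 = {x. (- 1, a1) \<bullet> x \<le> 0} \<inter> {x. (1, - a2) \<bullet> x \<le> 0} \<inter>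
      {x. (0, 1) \<bullet> x \<ge> 1 / sqrt b2} \<inter> {x. (0, 1) \<bullet> x \<le> 1 / sqrt b1}"
    by (auto simp: half_cone_def inner_prod_def)
  thus "convex (half_cone a1 a2 b1 b2)"
    by (simp only:) (intro convex_Int convex_halfspace_le convex_halfspace_ge)
qed

section \<open>Counting and the error term\<close>

lemma emeasure_base_cone:
  assumes "0 < b1" "b1 < b2"
  shows "emeasure lborel (base_cone a1 a2 b1 b2) = ennreal (2 * measure lborel (half_cone a1 a2 b1 b2))"
proof -
  define H where "H = half_cone a1 a2 b1 b2"
  have H: "compact H" unfolding H_def by (rule half_cone_compact_convex[OF assms])
  have eq: "uminus ` H = (*\<^sub>R) (- 1) ` H" by simp
  have H': "compact (uminus ` H)" unfolding eq using H by (rule compact_scaling)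
  have fin: "emeasure lborel H = ennreal (measure lborel H)" "emeasure lborel (uminus ` H) = ennreal (measure lborel (uminus ` H))"
    using emeasure_compact_finite[OF H] emeasure_compact_finite[OF H'] by (simp_all add: emeasure_eq_ennreal_measure)
  have "emeasure lborel (base_cone a1 a2 b1 b2) = emeasure lborel H + emeasure lborel (uminus ` H)"
    unfolding base_cone_eq(1)[OF assms] H_def[symmetric]
    using base_cone_eq(2)[OF assms] H H'
    by (intro plus_emeasure[symmetric]) (auto simp: H_def borel_closed compact_imp_closed)
  also have "\<dots> = ennreal (2 * measure lborel H)"
  proof -
    have "measure lborel (uminus ` H) = measure lborel H"
      using measure_lborel_scale[OF H, of "- 1"] by simp
    thus ?thesis unfolding fin by (simp add: ennreal_plus[symmetric] del: ennreal_plus)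
  qed
  finally show ?thesis by (simp add: H_def)
qed

lemma measure_m_bar_box:
  assumes ab: "a1 < a2" "0 < b1" "b1 < b2" "0 < l"
    and inj: "inj_on proj (box_lift a1 a2 b1 b2 l)"
  shows "measure m_bar (proj ` box_lift a1 a2 b1 b2 l) = 6 / pi\<^sup>2 * l * measure lborel (half_cone a1 a2 b1 b2)"
proof -
  note top = box_lift_topology[OF ab(2,1,3,4)]
  have "emeasure m_bar (proj ` box_lift a1 a2 b1 b2 l) =
      ennreal (2 * l) * ennreal (2 * measure lborel (half_cone a1 a2 b1 b2)) / ennreal (2 * pi\<^sup>2 / 3)"
    unfolding emeasure_m_bar_image[OF top(1,4) inj] emeasure_liouville_box[OF ab(2,1,3,4)]
      emeasure_base_cone[OF ab(2,3)] emeasure_modular_domain_eq ..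
  also have "\<dots> = ennreal (6 / pi\<^sup>2 * l * measure lborel (half_cone a1 a2 b1 b2))"
  proof -
    have "ennreal (2 * l) * ennreal (2 * measure lborel (half_cone a1 a2 b1 b2)) / ennreal (2 * pi\<^sup>2 / 3) =
        ennreal (2 * l * (2 * measure lborel (half_cone a1 a2 b1 b2))) / ennreal (2 * pi\<^sup>2 / 3)"
      using ab by (subst ennreal_mult) auto
    also have "\<dots> = ennreal (2 * l * (2 * measure lborel (half_cone a1 a2 b1 b2)) / (2 * pi\<^sup>2 / 3))"
      using ab by (intro divide_ennreal) auto
    finally show ?thesis by (simp add: field_simps)
  qed
  finally show ?thesis using ab by (simp add: measure_def)
qed

lemma measure_m_horo_box:
  assumes ab: "0 < a1" "a1 < a2" "a2 \<le> 1" "0 < b1" "b1 < b2" "0 < l" and y: "0 < y"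
    and inj: "inj_on proj (box_lift a1 a2 b1 b2 l)"
  shows "measure (m_horo y) (proj ` box_lift a1 a2 b1 b2 l) =
    l * y * real (card (primitive_points ((*\<^sub>R) (1 / sqrt y) ` half_cone a1 a2 b1 b2)))"
proof -
  define D where "D = {(p, q). (sqrt y * p, sqrt y * q) \<in> base_cone a1 a2 b1 b2}"
  define H where "H = half_cone a1 a2 b1 b2"
  define P where "P = primitive_points ((*\<^sub>R) (1 / sqrt y) ` H)"
  have scale: "(p, q) \<in> (*\<^sub>R) (1 / sqrt y) ` H \<longleftrightarrow> (sqrt y * p, sqrt y * q) \<in> H" for p q
  proof
    assume "(p, q) \<in> (*\<^sub>R) (1 / sqrt y) ` H"
    thus "(sqrt y * p, sqrt y * q) \<in> H" using y by auto
  next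
    assume "(sqrt y * p, sqrt y * q) \<in> H"
    thus "(p, q) \<in> (*\<^sub>R) (1 / sqrt y) ` H"
      by (rule rev_image_eqI) (use y in simp)
  qed
  have un: "(p, q) \<in> uminus ` H \<longleftrightarrow> (- p, - q) \<in> H" for p q
    by (force intro: image_eqI[where x="(- p, - q)"])
  have mem: "(a, c) \<in> primitive_points D \<longleftrightarrow> (a, c) \<in> P \<or> (- a, - c) \<in> P" for a c
    using base_cone_eq(1)[OF ab(4,5), of a1 a2]
    by (auto simp: primitive_points_def D_def P_def scale un H_def[symmetric])
  have eq: "primitive_points D = P \<union> uminus ` P"
  proof (intro equalityI subsetI)
    fix v assume "v \<in> primitive_points D"
    then obtain a c where v: "v = (a, c)" "(a, c) \<in> P \<or> (- a, - c) \<in> P" using mem by (cases v) auto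
    have "(a, c) \<in> uminus ` P" if "(- a, - c) \<in> P" using that by (rule rev_image_eqI) simp
    thus "v \<in> P \<union> uminus ` P" using v by blast
  next
    fix v assume "v \<in> P \<union> uminus ` P"
    thus "v \<in> primitive_points D" using mem by (cases v) auto
  qed
  have posP: "c > 0" if "(a, c) \<in> P" for a c
  proof -
    have "(sqrt y * of_int a, sqrt y * of_int c) \<in> H" using that by (simp add: P_def primitive_points_def scale)
    hence "0 < sqrt y * real_of_int c" using base_cone_eq(3)[OF ab(4,5)] unfolding H_def by blast
    thus ?thesis using y by (simp add: zero_less_mult_iff)
  qed
  have disj: "P \<inter> uminus ` P = {}"
  proof (rule equals0I)
    fix v assume "v \<in> P \<inter> uminus ` P"
    then obtain w where w: "v \<in> P" "w \<in> P" "v = - w" by blast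
    have "snd x > 0" if "x \<in> P" for x using posP[of "fst x" "snd x"] that by simp
    from this[OF w(1)] this[OF w(2)] show False using w(3) by simp
  qed
  have finP: "finite P" unfolding P_def
  proof (rule finite_primitive_points)
    fix p q assume "(p, q) \<in> (*\<^sub>R) (1 / sqrt y) ` H"
    hence "(sqrt y * p, sqrt y * q) \<in> H" using scale by blast
    hence "(sqrt y * p, sqrt y * q) \<in> base_cone a1 a2 b1 b2"
      unfolding base_cone_eq(1)[OF ab(4,5)] H_def by (rule UnI1)
    thus "\<bar>p\<bar> \<le> 1 / sqrt b1 / sqrt y \<and> \<bar>q\<bar> \<le> 1 / sqrt b1 / sqrt y"
      by (rule scaled_base_cone_bounded[OF ab(1,3,4) y])
  qed
  have "card (primitive_points D) = card P + card (uminus ` P)"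
    unfolding eq using finP disj by (intro card_Un_disjoint) auto
  also have "card (uminus ` P) = card P" by (intro card_image) (simp add: inj_on_def)
  finally have card: "real (card (primitive_points D)) = 2 * real (card P)" by simp
  have fin: "emeasure (m_horo y) (proj ` box_lift a1 a2 b1 b2 l) = ennreal (measure (m_horo y) (proj ` box_lift a1 a2 b1 b2 l))"
    using prob_space_m_horo[OF y] by (simp add: prob_space_def finite_measure.emeasure_eq_measure)
  have "ennreal (2 * measure (m_horo y) (proj ` box_lift a1 a2 b1 b2 l)) = ennreal (l * y * (2 * real (card P)))"
    using emeasure_m_horo_box[OF ab y inj, folded D_def] unfolding fin card by (simp add: ennreal_mult)
  hence "2 * measure (m_horo y) (proj ` box_lift a1 a2 b1 b2 l) = l * y * (2 * real (card P))"
    using ab y by (subst (asm) ennreal_inj) auto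
  thus ?thesis by (simp add: P_def H_def)
qed

definition plane_act :: "real^2^2 \<Rightarrow> real \<times> real \<Rightarrow> real \<times> real" where
  "plane_act A = (\<lambda>(p, q). (A$1$1 * p + A$1$2 * q, A$2$1 * p + A$2$2 * q))"

lemma plane_act_adj:
  assumes "A \<in> SL2R" shows "plane_act (adj A) (plane_act A v) = v" "plane_act A (plane_act (adj A) v) = v"
proof -
  have det: "A$1$1 * A$2$2 - A$1$2 * A$2$1 = 1" using assms by (simp add: SL2R_def det_2)
  obtain p q where v: "v = (p, q)" by fastforce
  have "A$2$2 * (A$1$1 * p + A$1$2 * q) - A$1$2 * (A$2$1 * p + A$2$2 * q) = (A$1$1 * A$2$2 - A$1$2 * A$2$1) * p"
    "A$1$1 * (A$2$1 * p + A$2$2 * q) - A$2$1 * (A$1$1 * p + A$1$2 * q) = (A$1$1 * A$2$2 - A$1$2 * A$2$1) * q"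
    "A$1$1 * (A$2$2 * p - A$1$2 * q) + A$1$2 * (A$1$1 * q - A$2$1 * p) = (A$1$1 * A$2$2 - A$1$2 * A$2$1) * p"
    "A$2$1 * (A$2$2 * p - A$1$2 * q) + A$2$2 * (A$1$1 * q - A$2$1 * p) = (A$1$1 * A$2$2 - A$1$2 * A$2$1) * q"
    by (simp_all add: algebra_simps)
  thus "plane_act (adj A) (plane_act A v) = v" "plane_act A (plane_act (adj A) v) = v"
    unfolding v by (simp_all add: plane_act_def det)
qed

lemma plane_act_linear: "linear (plane_act A)"
  by (rule linearI) (auto simp: plane_act_def algebra_simps)

lemma measure_plane_act:
  assumes A: "A \<in> SL2R" and H: "compact H"
  shows "measure lborel (plane_act A ` H) = measure lborel H"
proof -
  have AH: "compact (plane_act A ` H)"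
    using H linear_continuous_on[OF linear_conv_bounded_linear[THEN iffD1, OF plane_act_linear]] by (intro compact_continuous_image)
  have Hb: "H \<in> sets borel" "plane_act A ` H \<in> sets borel" using H AH by (simp_all add: borel_closed compact_imp_closed)
  have det: "A$1$1 * A$2$2 - A$1$2 * A$2$1 = 1" using A by (simp add: SL2R_def det_2)
  have m: "indicator (plane_act A ` H) \<in> borel_measurable (borel \<Otimes>\<^sub>M borel)" using Hb(2) by (simp add: borel_prod)
  have mem: "plane_act A v \<in> plane_act A ` H \<longleftrightarrow> v \<in> H" for v
    using plane_act_adj(1)[OF A] by (metis imageE imageI)
  have "emeasure lborel (plane_act A ` H) =
      (\<integral>\<^sup>+q. \<integral>\<^sup>+p. indicator (plane_act A ` H) (A$1$1 * p + A$1$2 * q, A$2$1 * p + A$2$2 * q) \<partial>lborel \<partial>lborel)"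
    unfolding emeasure_lborel_plane[OF Hb(2)] by (rule nn_integral_plane_SL2[OF m det, symmetric])
  also have "\<dots> = (\<integral>\<^sup>+q. \<integral>\<^sup>+p. indicator H (p, q) \<partial>lborel \<partial>lborel)"
  proof -
    have "(A$1$1 * p + A$1$2 * q, A$2$1 * p + A$2$2 * q) = plane_act A (p, q)" for p q
      by (simp add: plane_act_def)
    thus ?thesis by (intro nn_integral_cong) (simp only: indicator_def mem)
  qed
  also have "\<dots> = emeasure lborel H" by (rule emeasure_lborel_plane[OF Hb(1), symmetric])
  finally show ?thesis by (simp add: measure_def)
qed

text \<open>The action and its inverse both map primitive points injectively to primitive points.\<close>

lemma card_primitive_points_plane_act:
  assumes A: "A \<in> SL2Z"
  shows "card (primitive_points (plane_act A ` D)) = card (primitive_points D)"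
proof -
  have sub: "\<exists>f. inj f \<and> f ` primitive_points D \<subseteq> primitive_points (plane_act A ` D)" if A: "A \<in> SL2Z" for A D
  proof -
    obtain a b c d where abcd: "A = int_matrix a b c d" "a * d - b * c = 1" using A by (rule SL2Z_cases)
    define f where "f = (\<lambda>(p, q). (a * p + b * q, c * p + d * q))"
    have r1: "d * (a * p + b * q) - b * (c * p + d * q) = p" and r2: "a * (c * p + d * q) - c * (a * p + b * q) = q" for p q
    proof -
      have "d * (a * p + b * q) - b * (c * p + d * q) = (a * d - b * c) * p"
        "a * (c * p + d * q) - c * (a * p + b * q) = (a * d - b * c) * q" by (simp_all add: algebra_simps)
      thus "d * (a * p + b * q) - b * (c * p + d * q) = p" "a * (c * p + d * q) - c * (a * p + b * q) = q"
        using abcd(2) by simp_all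
    qed
    have "inj f"
    proof (rule injI)
      fix v w assume "f v = f w"
      thus "v = w" using r1[of "fst v" "snd v"] r1[of "fst w" "snd w"] r2[of "fst v" "snd v"] r2[of "fst w" "snd w"]
        by (auto simp: f_def split_beta prod_eq_iff)
    qed
    moreover have "f v \<in> primitive_points (plane_act A ` D)" if v: "v \<in> primitive_points D" for v
    proof -
      obtain p q where pq: "v = (p, q)" by fastforce
      have cop: "coprime p q" and D: "(of_int p, of_int q) \<in> D" using v by (auto simp: pq primitive_points_def)
      have "coprime (a * p + b * q) (c * p + d * q)"
      proof (rule coprimeI)
        fix e assume "e dvd a * p + b * q" "e dvd c * p + d * q"
        hence "e dvd d * (a * p + b * q) - b * (c * p + d * q)" "e dvd a * (c * p + d * q) - c * (a * p + b * q)"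
          by (simp_all add: dvd_diff)
        hence "e dvd p" "e dvd q" unfolding r1 r2 .
        thus "is_unit e" using cop coprime_common_divisor by blast
      qed
      moreover have "plane_act A (of_int p, of_int q) = (of_int (a * p + b * q), of_int (c * p + d * q))"
        by (simp add: plane_act_def abcd)
      ultimately show ?thesis using D by (auto simp: primitive_points_def f_def pq intro: rev_image_eqI)
    qed
    ultimately show ?thesis by blast
  qed
  have le: "card (primitive_points D) \<le> card (primitive_points (plane_act A ` D))"
    if AD: "A \<in> SL2Z" "finite (primitive_points (plane_act A ` D))" for A D
  proof -
    obtain f where f: "inj f" "f ` primitive_points D \<subseteq> primitive_points (plane_act A ` D)" using sub[OF AD(1)] by blast
    have "card (f ` primitive_points D) = card (primitive_points D)" using f(1) by (intro card_image) (auto intro: inj_on_subset)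
    thus ?thesis using card_mono[OF AD(2) f(2)] by simp
  qed
  have fin: "finite (primitive_points D)" if AD: "A \<in> SL2Z" "finite (primitive_points (plane_act A ` D))" for A D
  proof -
    obtain f where f: "inj f" "f ` primitive_points D \<subseteq> primitive_points (plane_act A ` D)" using sub[OF AD(1)] by blast
    show ?thesis by (rule finite_imageD[of f]) (use f AD(2) finite_subset in \<open>auto intro: inj_on_subset\<close>)
  qed
  have ret: "plane_act (adj A) ` plane_act A ` D = D"
    using plane_act_adj(1)[OF SL2Z_SL2R[OF A]] by (simp add: image_image)
  show ?thesis
  proof (cases "finite (primitive_points D)")
    case True
    hence "finite (primitive_points (plane_act (adj A) ` plane_act A ` D))" by (simp add: ret)
    hence fA: "finite (primitive_points (plane_act A ` D))" using fin SL2Z_adj[OF A] by blast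
    show ?thesis using le[OF A fA] le[OF SL2Z_adj[OF A], of "plane_act A ` D"] True by (simp add: ret)
  next
    case False
    hence "infinite (primitive_points (plane_act A ` D))" using fin[OF A] by blast
    thus ?thesis using False by simp
  qed
qed

text \<open>The radius \<open>\<rho>\<close> refers to a translate of the trapezoid by an element of \<open>SL2Z\<close>, which has the same
  area and the same number of primitive points. The trapezoid itself can be much larger.\<close>

lemma box_discrepancy:
  assumes ab: "0 < a1" "a1 < a2" "a2 \<le> 1" "0 < b1" "b1 < b2" "0 < l" and y: "0 < y" "y \<le> 1"
    and inj: "inj_on proj (box_lift a1 a2 b1 b2 l)"
    and A: "A \<in> SL2Z" and \<rho>: "\<rho> \<ge> 1"
    and sub: "\<And>p q. (p, q) \<in> plane_act A ` half_cone a1 a2 b1 b2 \<Longrightarrow> \<bar>p\<bar> \<le> \<rho> \<and> \<bar>q\<bar> \<le> \<rho>"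
  shows "\<bar>measure (m_horo y) (proj ` box_lift a1 a2 b1 b2 l) - measure m_bar (proj ` box_lift a1 a2 b1 b2 l)\<bar>
    \<le> 21 * l * \<rho> * sqrt y * (1 + ln \<rho> + \<bar>ln y\<bar> / 2)"
proof -
  define H where "H = half_cone a1 a2 b1 b2"
  define D where "D = (*\<^sub>R) (1 / sqrt y) ` H"
  define D' where "D' = plane_act A ` D"
  define R where "R = \<rho> / sqrt y"
  have sy: "0 < sqrt y" "sqrt y \<le> 1" using y by auto
  have "sqrt y \<le> \<rho>" using sy(2) \<rho> by linarith
  hence R: "R \<ge> 1" using sy(1) by (simp add: R_def)
  note H = half_cone_compact_convex[OF ab(4,5), of a1 a2, folded H_def]
  have D: "compact D" "convex D" unfolding D_def using H by (auto intro: compact_scaling convex_scaling)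
  have D': "compact D'" "convex D'" unfolding D'_def
    using D linear_continuous_on[OF linear_conv_bounded_linear[THEN iffD1, OF plane_act_linear]] convex_linear_image[OF plane_act_linear]
    by (auto intro!: compact_continuous_image)
  have D'_eq: "D' = (*\<^sub>R) (1 / sqrt y) ` plane_act A ` H"
    by (simp add: D'_def D_def image_image linear_cmul[OF plane_act_linear])
  have box: "\<bar>p\<bar> \<le> R \<and> \<bar>q\<bar> \<le> R" if pqD: "(p, q) \<in> D'" for p q
  proof -
    obtain v where v: "(p, q) = (1 / sqrt y) *\<^sub>R v" "v \<in> plane_act A ` H"
      using pqD unfolding D'_eq by (rule imageE)
    define p' q' where "p' = fst v" and "q' = snd v"
    have pq: "(p', q') \<in> plane_act A ` H" "p = p' / sqrt y" "q = q' / sqrt y"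
      using v by (simp_all add: p'_def q'_def prod_eq_iff)
    show ?thesis using sub[of p' q'] pq sy by (auto simp: H_def R_def abs_divide intro!: divide_right_mono)
  qed
  have 0: "(0, 0) \<notin> D'"
  proof
    assume "(0, 0) \<in> D'"
    then obtain v where v: "v \<in> H" "plane_act A v = (0, 0)" using sy unfolding D'_eq by (auto simp: zero_prod_def[symmetric])
    hence "v = plane_act (adj A) (0, 0)" using plane_act_adj(1)[OF SL2Z_SL2R[OF A]] by metis
    hence "(0, 0) \<in> H" using v by (simp add: plane_act_def)
    thus False using base_cone_eq(3)[OF ab(4,5)] unfolding H_def by blast
  qed
  have "measure lborel D' = measure lborel D" unfolding D'_def by (rule measure_plane_act[OF SL2Z_SL2R[OF A] D(1)])
  also have "\<dots> = (1 / sqrt y)\<^sup>2 * measure lborel H" unfolding D_def using sy by (intro measure_lborel_scale H) auto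
  finally have mD: "measure lborel D' = measure lborel H / y" using y by (simp add: power_divide)
  have cD: "card (primitive_points D') = card (primitive_points D)"
    unfolding D'_def by (rule card_primitive_points_plane_act[OF A])
  have "measure (m_horo y) (proj ` box_lift a1 a2 b1 b2 l) - measure m_bar (proj ` box_lift a1 a2 b1 b2 l) =
      l * y * (real (card (primitive_points D')) - 6 / pi\<^sup>2 * measure lborel D')"
    unfolding measure_m_horo_box[OF ab y(1) inj] measure_m_bar_box[OF ab(2,4,5,6) inj] mD cD
    using y by (simp add: D_def H_def algebra_simps)
  hence "\<bar>measure (m_horo y) (proj ` box_lift a1 a2 b1 b2 l) - measure m_bar (proj ` box_lift a1 a2 b1 b2 l)\<bar> =
      l * y * \<bar>real (card (primitive_points D')) - 6 / pi\<^sup>2 * measure lborel D'\<bar>"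
    using ab y by (simp add: abs_mult)
  also have "\<dots> \<le> l * y * (21 * R * (1 + ln R))"
    using ab y by (intro mult_left_mono primitive_points_convex[OF D' box 0 R]) auto
  also have "\<dots> = 21 * l * \<rho> * sqrt y * (1 + ln R)"
  proof -
    have "y * R = \<rho> * sqrt y" using y by (simp add: R_def field_simps)
    thus ?thesis by (simp add: mult_ac) 
  qed
  also have "ln R = ln \<rho> + \<bar>ln y\<bar> / 2"
    using \<rho> y by (simp add: R_def ln_div ln_sqrt)
  finally show ?thesis by (simp add: add.assoc)
qed

text \<open>The element that carries the lift of the smaller box into the lift of the larger one maps the
  horocycle segments, of length \<open>l'\<close>, into segments of length \<open>l\<close>, and the first columns into the
  base cone of the larger box.\<close>

lemma sub_box_translate:
  assumes ab: "0 < a1" "a1 < a2" "a2 \<le> 1" "0 < b1" "b1 < b2" "0 < l"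
    and ab': "a1' < a2'" "0 < b1'" "b1' < b2'" "0 < l'"
    and inj: "inj_on proj (box_lift a1 a2 b1 b2 l)"
    and sub: "proj ` box_lift a1' a2' b1' b2' l' \<subseteq> proj ` box_lift a1 a2 b1 b2 l"
  obtains A where "A \<in> SL2Z" "l' \<le> l"
    "\<And>p q. (p, q) \<in> plane_act A ` half_cone a1' a2' b1' b2' \<Longrightarrow> \<bar>p\<bar> \<le> 1 / sqrt b1 \<and> \<bar>q\<bar> \<le> 1 / sqrt b1"
proof -
  define H where "H = half_cone a1' a2' b1' b2'"
  note top = box_lift_topology[OF ab(4,2,5,6)]
  note top' = box_lift_topology[OF ab'(2,1,3,4)]
  obtain A where A: "A \<in> SL2Z" and act: "\<And>v. v \<in> box_lift a1' a2' b1' b2' l' \<Longrightarrow> tangent_act A v \<in> box_lift a1 a2 b1 b2 l"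
    using connected_lift_in_one_translate[OF top(1,4) inj top'(1,4,2,3) sub] by blast
  have key: "plane_act A (p, q) \<in> base_cone a1 a2 b1 b2 \<and>
      \<bar>s - A$2$1 / (q * snd (plane_act A (p, q)))\<bar> \<le> l / 2"
    if pq: "(p, q) \<in> H" and s: "\<bar>s\<bar> \<le> l' / 2" for p q s
  proof -
    have q: "q > 0" using base_cone_eq(3)[OF ab'(2,3)] pq unfolding H_def by blast
    have cm: "coset_matrix p q s \<in> SL2R" using q by (intro coset_matrix_SL2R) simp
    define B where "B = A ** coset_matrix p q s"
    have B: "B \<in> SL2R" "frame B = tangent_act A (frame (coset_matrix p q s))"
      using cm A by (simp_all add: B_def SL2R_mult SL2Z_SL2R frame_mult)
    have "(p, q) \<in> base_cone a1' a2' b1' b2'" using base_cone_eq(1)[OF ab'(2,3)] pq by (simp add: H_def)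
    hence "frame (coset_matrix p q s) \<in> box_lift a1' a2' b1' b2' l'"
      using frame_in_box_lift_iff[OF ab'(2) cm] q s by simp
    hence "frame B \<in> box_lift a1 a2 b1 b2 l" using act B by simp
    hence in_cone: "(B$1$1, B$2$1) \<in> base_cone a1 a2 b1 b2" and s': "\<bar>B$2$2 / B$2$1\<bar> \<le> l / 2"
      using frame_in_box_lift_iff[OF ab(4) B(1)] by auto
    have col: "(B$1$1, B$2$1) = plane_act A (p, q)" by (simp add: B_def matrix_mult_entries plane_act_def)
    have nz: "B$2$1 \<noteq> 0" using in_cone by (simp add: base_cone_def)
    have "B$2$2 = s * B$2$1 - A$2$1 / q" by (simp add: B_def matrix_mult_entries algebra_simps)
    hence "B$2$2 / B$2$1 = s - A$2$1 / (q * B$2$1)" using nz by (simp add: diff_divide_distrib)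
    thus ?thesis using s' in_cone col by (metis snd_conv)
  qed
  have "l' \<le> l"
  proof -
    define q where "q = 1 / sqrt b1'"
    have "1 / sqrt b2' \<le> q" using ab' by (simp add: q_def frac_le)
    moreover have "0 < q" using ab' by (simp add: q_def)
    ultimately have "(a1' * q, q) \<in> H" using ab' by (auto simp: H_def half_cone_def q_def[symmetric])
    note k = key[OF this]
    define t where "t = A$2$1 / (q * snd (plane_act A (a1' * q, q)))"
    have "\<bar>l' / 2 - t\<bar> \<le> l / 2" "\<bar>- (l' / 2) - t\<bar> \<le> l / 2"
      using k[of "l' / 2"] k[of "- (l' / 2)"] ab' by (simp_all add: t_def)
    thus ?thesis by linarith
  qed
  moreover have "\<bar>p\<bar> \<le> 1 / sqrt b1 \<and> \<bar>q\<bar> \<le> 1 / sqrt b1" if pq: "(p, q) \<in> plane_act A ` H" for p q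
  proof -
    obtain v where v: "v \<in> H" "(p, q) = plane_act A v" using pq by blast
    have "(p, q) \<in> base_cone a1 a2 b1 b2" using key[of "fst v" "snd v" 0] v ab' by simp
    thus ?thesis by (rule base_cone_bounded[OF ab(1,3,4)])
  qed
  ultimately show ?thesis using that A unfolding H_def by blast
qed

theorem theorem4p18:
  fixes C :: "(complex \<times> complex) set set"
  assumes "adapted_box C"
  shows "\<exists>k>0.
    (\<exists>K :: real \<Rightarrow> real. \<forall>y. 0 < y \<and> y \<le> 1/2 \<longrightarrow>
        measure (m_horo y) C = measure m_bar C + K y * y powr (1/2) * ln y \<and> \<bar>K y\<bar> \<le> k) \<and>
    (\<forall>C'. adapted_box C' \<and> C' \<subseteq> C \<longrightarrow>
        (\<forall>y. 0 < y \<and> y \<le> 1/2 \<longrightarrow>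
          \<bar>measure (m_horo y) C' - measure m_bar C'\<bar> \<le> k * y powr (1/2) * \<bar>ln y\<bar>))"
proof -
  obtain a1 a2 b1 b2 l where ab: "0 < a1" "a1 < a2" "a2 \<le> 1" "0 < b1" "b1 < b2" "0 < l"
    and inj: "inj_on proj (box_lift a1 a2 b1 b2 l)" and C: "C = proj ` box_lift a1 a2 b1 b2 l"
    using assms unfolding adapted_box_def by blast
  \<comment> \<open>The base cone of \<open>C\<close> lies in the square of radius \<open>1 / sqrt b1\<close>; the summand \<open>(1 + ln \<rho>) / ln 2\<close> of
    \<open>k\<close> uses \<open>\<bar>ln y\<bar> \<ge> ln 2\<close> to absorb the part of the error without a logarithm of \<open>y\<close>.\<close>
  define \<rho> where "\<rho> = max 1 (1 / sqrt b1)"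
  have \<rho>: "\<rho> \<ge> 1" "1 / sqrt b1 \<le> \<rho>" "ln \<rho> \<ge> 0" by (auto simp: \<rho>_def)
  define k where "k = 21 * l * \<rho> * ((1 + ln \<rho>) / ln 2 + 1 / 2)"
  have k: "k > 0" unfolding k_def using ab \<rho> by (intro mult_pos_pos add_nonneg_pos) auto
  have bound: "\<bar>measure (m_horo y) C' - measure m_bar C'\<bar> \<le> k * y powr (1/2) * \<bar>ln y\<bar>"
    if C': "adapted_box C'" "C' \<subseteq> C" and y: "0 < y" "y \<le> 1/2" for C' y
  proof -
    obtain a1' a2' b1' b2' l' where ab': "0 < a1'" "a1' < a2'" "a2' \<le> 1" "0 < b1'" "b1' < b2'" "0 < l'"
      and inj': "inj_on proj (box_lift a1' a2' b1' b2' l')" and C'_eq: "C' = proj ` box_lift a1' a2' b1' b2' l'"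
      using C'(1) unfolding adapted_box_def by blast
    obtain A where A: "A \<in> SL2Z" "l' \<le> l"
      "\<And>p q. (p, q) \<in> plane_act A ` half_cone a1' a2' b1' b2' \<Longrightarrow> \<bar>p\<bar> \<le> 1 / sqrt b1 \<and> \<bar>q\<bar> \<le> 1 / sqrt b1"
      using sub_box_translate[OF ab ab'(2,4,5,6) inj] C'(2) C C'_eq by blast
    have "ln y \<le> ln (1/2)" using y by (subst ln_le_cancel_iff) auto
    hence lny: "ln 2 \<le> \<bar>ln y\<bar>" by (simp add: ln_div)
    have "\<bar>measure (m_horo y) C' - measure m_bar C'\<bar> \<le> 21 * l' * \<rho> * sqrt y * (1 + ln \<rho> + \<bar>ln y\<bar> / 2)"
      unfolding C'_eq
    proof (rule box_discrepancy[OF ab' _ _ inj' A(1) \<rho>(1)])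
      show "\<bar>p\<bar> \<le> \<rho> \<and> \<bar>q\<bar> \<le> \<rho>" if "(p, q) \<in> plane_act A ` half_cone a1' a2' b1' b2'" for p q
        using A(3)[OF that] \<rho>(2) by linarith
    qed (use y in auto)
    also have "\<dots> \<le> 21 * l * \<rho> * sqrt y * (((1 + ln \<rho>) / ln 2 + 1 / 2) * \<bar>ln y\<bar>)"
    proof (intro mult_mono)
      have "(1 + ln \<rho>) * 1 \<le> (1 + ln \<rho>) * (\<bar>ln y\<bar> / ln 2)"
        using lny \<rho> by (intro mult_left_mono) auto
      thus "1 + ln \<rho> + \<bar>ln y\<bar> / 2 \<le> ((1 + ln \<rho>) / ln 2 + 1 / 2) * \<bar>ln y\<bar>" by (simp add: algebra_simps)
      show "0 \<le> 1 + ln \<rho> + \<bar>ln y\<bar> / 2" using \<rho>(3) abs_ge_zero[of "ln y"] by linarith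
    qed (use A \<rho> ab ab' y in auto)
    also have "\<dots> = k * y powr (1/2) * \<bar>ln y\<bar>" using y by (simp add: k_def powr_half_sqrt mult_ac)
    finally show ?thesis .
  qed
  define K where "K y = (measure (m_horo y) C - measure m_bar C) / (y powr (1/2) * ln y)" for y
  have K: "measure (m_horo y) C = measure m_bar C + K y * y powr (1/2) * ln y \<and> \<bar>K y\<bar> \<le> k"
    if y: "0 < y" "y \<le> 1/2" for y
  proof -
    have "ln y < 0" using y by simp
    hence nz: "0 < \<bar>y powr (1/2) * ln y\<bar>" using y by simp
    have "\<bar>measure (m_horo y) C - measure m_bar C\<bar> \<le> k * \<bar>y powr (1/2) * ln y\<bar>"
      using bound[OF assms order_refl y] by (simp add: abs_mult mult_ac)
    hence "\<bar>K y\<bar> \<le> k" using nz by (simp add: K_def abs_divide pos_divide_le_eq)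
    moreover have "measure (m_horo y) C = measure m_bar C + K y * y powr (1/2) * ln y"
      using nz by (simp add: K_def)
    ultimately show ?thesis by blast
  qed
  show ?thesis
  proof (intro exI[of _ k] exI[of _ K] conjI allI impI)
    show "measure (m_horo y) C = measure m_bar C + K y * y powr (1/2) * ln y" "\<bar>K y\<bar> \<le> k"
      if "0 < y \<and> y \<le> 1/2" for y using K[of y] that by simp_all
    show "\<bar>measure (m_horo y) C' - measure m_bar C'\<bar> \<le> k * y powr (1/2) * \<bar>ln y\<bar>"
      if "adapted_box C' \<and> C' \<subseteq> C" "0 < y \<and> y \<le> 1/2" for C' y
      using bound[of C' y] that by blast
  qed (rule k)
qed

end
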